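(* Let $F$ be a non-constant meromorphic inner function on the upper half-plane $\mathbb{U}$ such that the symmetric operator $M^F$ of multiplication by $z$ in $K^2_F$ is densely defined, and let $\tau:\mathbb{R}\to\mathbb{R}$ be continuous with $F(x)=e^{i\tau(x)}$ for all $x\in\mathbb{R}$. Then $\tau'(x)=2\pi\|k^F_x\|^2>0$ for all $x\in\mathbb{R}$, and $\tau$ is a $C^\infty$ bijection of $\mathbb{R}$ onto $(-\infty,b)$, $(a,\infty)$ or $\mathbb{R}$ (for some real $a,b$), according as the spectrum of each self-adjoint extension of $M^F$ is bounded above, bounded below, or neither bounded above nor below, respectively. Moreover $\tau$ has a local analytic extension about every point $x\in\mathbb{R}$.
   Context: A meromorphic inner function is an inner function on $\mathbb{U}$ that extends meromorphically to $\mathbb{C}$ (analytic on a neighbourhood of $\mathbb{R}$). $K^2_F=H^2(\mathbb{U})\ominus FH^2(\mathbb{U})$; for every $x\in\mathbb{R}$ point evaluation at $x$ is bounded on $K^2_F$ with reproducing kernel $k^F_x(z)=\frac{i}{2\pi}\frac{1-\overline{F(x)}F(z)}{z-x}$. $M^F$ is $f\mapsto zf$ on $\{f\in K^2_F: zf\in K^2_F\}$; it is a closed, simple, regular symmetric linear transformation with deficiency indices $(1,1)$. *)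

theory Defs
  imports "HOL-Complex_Analysis.Complex_Analysis"
begin

definition upper_half_plane :: "complex set" where
  "upper_half_plane = {z. Im z > 0}"

text \<open>Elements of H^2(U) are represented by functions complex => complex that are
  holomorphic on U and (as canonical representatives) vanish off U.\<close>

definition H2 :: "(complex \<Rightarrow> complex) set" where
  "H2 = {f. f holomorphic_on upper_half_plane
          \<and> (\<forall>z. Im z \<le> 0 \<longrightarrow> f z = 0)
          \<and> (\<forall>y>0. integrable lborel (\<lambda>t. (cmod (f (Complex t y)))\<^sup>2))
          \<and> bdd_above ((\<lambda>y. LINT t|lborel. (cmod (f (Complex t y)))\<^sup>2) ` {0<..})}"

definition h2_inner :: "(complex \<Rightarrow> complex) \<Rightarrow> (complex \<Rightarrow> complex) \<Rightarrow> complex" where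
  "h2_inner f g = Lim (at_right 0)
     (\<lambda>y::real. LINT t|lborel. f (Complex t y) * cnj (g (Complex t y)))"

definition h2_norm :: "(complex \<Rightarrow> complex) \<Rightarrow> real" where
  "h2_norm f = sqrt (Re (h2_inner f f))"

text \<open>An inner function on U that extends meromorphically to C and is analytic on a
  neighbourhood of the real line; its boundary values are then its values on R.\<close>

definition meromorphic_inner :: "(complex \<Rightarrow> complex) \<Rightarrow> bool" where
  "meromorphic_inner F \<longleftrightarrow>
     F holomorphic_on upper_half_plane
     \<and> (\<forall>z\<in>upper_half_plane. cmod (F z) \<le> 1)
     \<and> F meromorphic_on UNIV
     \<and> F analytic_on \<real>
     \<and> (\<forall>x::real. cmod (F (of_real x)) = 1)"

definition mult_fun :: "(complex \<Rightarrow> complex) \<Rightarrow> (complex \<Rightarrow> complex) \<Rightarrow> (complex \<Rightarrow> complex)" where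
  "mult_fun F h = (\<lambda>z. if Im z > 0 then F z * h z else 0)"

definition model_space :: "(complex \<Rightarrow> complex) \<Rightarrow> (complex \<Rightarrow> complex) set" where
  "model_space F = {f \<in> H2. \<forall>g\<in>H2. h2_inner f (mult_fun F g) = 0}"

definition mult_z :: "(complex \<Rightarrow> complex) \<Rightarrow> (complex \<Rightarrow> complex)" where
  "mult_z f = (\<lambda>z. z * f z)"

definition MF_domain :: "(complex \<Rightarrow> complex) \<Rightarrow> (complex \<Rightarrow> complex) set" where
  "MF_domain F = {f \<in> model_space F. mult_z f \<in> model_space F}"

definition MF_densely_defined :: "(complex \<Rightarrow> complex) \<Rightarrow> bool" where
  "MF_densely_defined F \<longleftrightarrow>
     (\<forall>f\<in>model_space F. \<forall>e>0. \<exists>g\<in>MF_domain F. h2_norm (\<lambda>z. f z - g z) < e)"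

definition repr_kernel :: "(complex \<Rightarrow> complex) \<Rightarrow> real \<Rightarrow> (complex \<Rightarrow> complex)" where
  "repr_kernel F x = (\<lambda>z. if Im z > 0 then
       (\<i> / (2 * pi)) * (1 - cnj (F (of_real x)) * F z) / (z - of_real x) else 0)"

definition selfadjoint_extension ::
  "(complex \<Rightarrow> complex) \<Rightarrow> (complex \<Rightarrow> complex) set
     \<Rightarrow> ((complex \<Rightarrow> complex) \<Rightarrow> (complex \<Rightarrow> complex)) \<Rightarrow> bool" where
  "selfadjoint_extension F D A \<longleftrightarrow>
     D \<subseteq> model_space F
     \<and> (\<lambda>z. 0) \<in> D
     \<and> (\<forall>f\<in>D. \<forall>g\<in>D. \<forall>a b. (\<lambda>z. a * f z + b * g z) \<in> D
            \<and> A (\<lambda>z. a * f z + b * g z) = (\<lambda>z. a * A f z + b * A g z))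
     \<and> (\<forall>f\<in>D. A f \<in> model_space F)
     \<and> MF_domain F \<subseteq> D
     \<and> (\<forall>f\<in>MF_domain F. A f = mult_z f)
     \<and> (\<forall>f\<in>D. \<forall>g\<in>D. h2_inner (A f) g = h2_inner f (A g))
     \<and> (\<forall>g\<in>model_space F.
          (\<exists>h\<in>model_space F. \<forall>f\<in>D. h2_inner (A f) g = h2_inner f h) \<longrightarrow> g \<in> D)"

definition op_spectrum ::
  "(complex \<Rightarrow> complex) \<Rightarrow> (complex \<Rightarrow> complex) set
     \<Rightarrow> ((complex \<Rightarrow> complex) \<Rightarrow> (complex \<Rightarrow> complex)) \<Rightarrow> complex set" where
  "op_spectrum F D A =
     {c. \<not> bij_betw (\<lambda>f. (\<lambda>z. A f z - c * f z)) D (model_space F)}"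

definition C_infinity :: "(real \<Rightarrow> real) \<Rightarrow> bool" where
  "C_infinity f \<longleftrightarrow> (\<forall>n x. ((deriv ^^ n) f) differentiable (at x))"

end

theory Submission
  imports Defs
begin

text \<open>
  Boundary values of Hardy functions are never formed: for \<open>f\<close> and \<open>g\<close> in \<open>H\<^sup>2\<close> the pairing of \<open>f\<close> at height \<open>y\<close>
  with \<open>g\<close> at height \<open>y'\<close> depends on \<open>y + y'\<close> only, which makes \<open>y \<mapsto> \<parallel>f(\<cdot> + i y)\<parallel>\<^sup>2\<close> midpoint convex, hence decreasing, and
  the traces on horizontal lines Cauchy in \<open>L\<^sup>2\<close> as \<open>y\<close> tends to \<open>0\<close>.

  For \<open>f\<close> in the domain of the adjoint of \<open>M\<^sup>F\<close> the function \<open>z f - (M\<^sup>F)\<^sup>* f\<close> has the form \<open>a + b F\<close>, and Green's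
  formula turns the boundary form into \<open>- 2 \<pi> i (a cnj a' - b cnj b')\<close>. Self-adjoint extensions therefore correspond to
  the lines \<open>b = - cnj \<alpha> a\<close> with \<open>|\<alpha>| = 1\<close>, and the spectrum of such an extension is the set of real \<open>x\<close> with
  \<open>F x = \<alpha>\<close>, that is, \<open>\<tau> x \<in> arg \<alpha> + 2 \<pi> \<int>\<close>; it is bounded on the same sides as the range of \<open>\<tau>\<close>.

  The derivative of \<open>\<tau>\<close> comes from letting \<open>z\<close> tend to \<open>x\<close> in \<open>k\<^sub>x(z) = \<langle>k\<^sub>x, k\<^sub>z\<rangle>\<close>. Finally \<open>\<tau>\<close> cannot be bounded on both sides: the
  integral of \<open>\<parallel>k\<^sub>x\<parallel>\<^sup>2 = \<tau>' x / 2 \<pi>\<close> bounds the dimension of the model space, and in finite dimension \<open>M\<^sup>F\<close> is not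
  densely defined.
\<close>

section \<open>Square integrable functions on the line\<close>

text \<open>The crux is the surjectivity of \<open>A - c\<close>. For \<open>Im c > 0\<close>,
  \<open>Im c = 0\<close> and \<open>Im c < 0\<close> alike, division of an element of the model
  space by \<open>z - c\<close> within that space is secured by the vanishing of one linear
  functional: evaluation at \<open>c\<close>, pairing with the kernel at \<open>c\<close>, or one
  leftover orthogonality relation. A single free boundary parameter can meet a single condition,
  except at a real \<open>c\<close> with \<open>F c = \<alpha>\<close>. The same solvability, used
  at one point of the lower half-plane, identifies the adjoint of \<open>M\<^sup>F\<close>;
  completeness of the model space is avoided, since all projections are onto explicit finite spans.
  Division is most delicate at a real point: the quotient may fail to be square integrable near it,
  and multiples of \<open>z - c\<close> are only dense in \<open>H2\<close>. This is why real
  kernels are compared with interior ones by a Lipschitz estimate in norm. Density of the domain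
  enters twice: it makes the adjoint graph single-valued, so that an extension is determined by its
  boundary condition, and it excludes a phase bounded on both sides.\<close>

lemma borel_measurable_cnj [measurable (raw)]:
  fixes f :: "'a \<Rightarrow> complex"
  assumes "f \<in> borel_measurable M" shows "(\<lambda>x. cnj (f x)) \<in> borel_measurable M"
  using assms by (rule borel_measurable_continuous_on[rotated]) (intro continuous_intros)

definition sq_int :: "(real \<Rightarrow> complex) \<Rightarrow> bool" where
  "sq_int u \<longleftrightarrow> u \<in> borel_measurable lborel \<and> integrable lborel (\<lambda>t. (cmod (u t))\<^sup>2)"

definition l2sq :: "(real \<Rightarrow> complex) \<Rightarrow> real" where
  "l2sq u = (LINT t|lborel. (cmod (u t))\<^sup>2)"

definition l2ip :: "(real \<Rightarrow> complex) \<Rightarrow> (real \<Rightarrow> complex) \<Rightarrow> complex" where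
  "l2ip u v = (LINT t|lborel. u t * cnj (v t))"

lemma l2sq_nonneg [simp]: "0 \<le> l2sq u"
  unfolding l2sq_def by simp

lemma sq_int_scale:
  assumes "sq_int u" shows "sq_int (\<lambda>t. a * u t)"
  using assms unfolding sq_int_def by (auto simp: norm_mult power_mult_distrib)

lemma sq_int_mult_bounded:
  assumes u: "sq_int u" and m: "m \<in> borel_measurable lborel" "\<And>t. cmod (m t) \<le> C"
  shows "sq_int (\<lambda>t. m t * u t)" "l2sq (\<lambda>t. m t * u t) \<le> C\<^sup>2 * l2sq u"
proof -
  have [measurable]: "u \<in> borel_measurable lborel" "m \<in> borel_measurable lborel"
    using u m by (auto simp: sq_int_def)
  have iu: "integrable lborel (\<lambda>t. C\<^sup>2 * (cmod (u t))\<^sup>2)"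
    using u by (auto simp: sq_int_def)
  have le: "(cmod (m t * u t))\<^sup>2 \<le> C\<^sup>2 * (cmod (u t))\<^sup>2" for t
    unfolding norm_mult power_mult_distrib
    by (intro mult_right_mono power_mono m) auto
  have i: "integrable lborel (\<lambda>t. (cmod (m t * u t))\<^sup>2)"
    by (rule Bochner_Integration.integrable_bound[OF iu]) (use le in \<open>auto intro: order_trans\<close>)
  show "sq_int (\<lambda>t. m t * u t)" using i unfolding sq_int_def by auto
  show "l2sq (\<lambda>t. m t * u t) \<le> C\<^sup>2 * l2sq u"
    unfolding l2sq_def using integral_mono[OF i iu le] by simp
qed

lemma sq_int_dominated:
  assumes v: "integrable lborel v" and m: "u \<in> borel_measurable lborel"
    and le: "\<And>t. (cmod (u t))\<^sup>2 \<le> v t"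
  shows "sq_int u" "l2sq u \<le> integral\<^sup>L lborel v"
proof -
  have [measurable]: "u \<in> borel_measurable lborel" using m .
  have i: "integrable lborel (\<lambda>t. (cmod (u t))\<^sup>2)"
    by (rule Bochner_Integration.integrable_bound[OF v]) (auto intro!: AE_I2 order_trans[OF le])
  show "sq_int u" using i m unfolding sq_int_def by auto
  show "l2sq u \<le> integral\<^sup>L lborel v"
    unfolding l2sq_def by (rule integral_mono[OF i v le])
qed

lemma cmod_sum_squared_le: "(cmod (x + y))\<^sup>2 \<le> 2 * (cmod x)\<^sup>2 + 2 * (cmod y)\<^sup>2"
proof -
  have "(cmod (x + y))\<^sup>2 \<le> (cmod x + cmod y)\<^sup>2"
    by (intro power_mono norm_triangle_ineq) auto
  also have "\<dots> \<le> 2 * (cmod x)\<^sup>2 + 2 * (cmod y)\<^sup>2"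
    using sum_squares_bound[of "cmod x" "cmod y"] by (simp add: power2_sum)
  finally show ?thesis .
qed

lemma sq_int_add:
  assumes "sq_int u" "sq_int v"
  shows "sq_int (\<lambda>t. u t + v t)" "l2sq (\<lambda>t. u t + v t) \<le> 2 * l2sq u + 2 * l2sq v"
proof -
  have i: "integrable lborel (\<lambda>t. 2 * (cmod (u t))\<^sup>2 + 2 * (cmod (v t))\<^sup>2)"
    using assms unfolding sq_int_def by auto
  have m: "(\<lambda>t. u t + v t) \<in> borel_measurable lborel" using assms unfolding sq_int_def by auto
  note * = sq_int_dominated[OF i m cmod_sum_squared_le]
  show "sq_int (\<lambda>t. u t + v t)" by (rule *)
  show "l2sq (\<lambda>t. u t + v t) \<le> 2 * l2sq u + 2 * l2sq v"
    using *(2) assms unfolding l2sq_def sq_int_def by simp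
qed

lemma sq_int_lin:
  assumes "sq_int u" "sq_int v" shows "sq_int (\<lambda>t. a * u t + b * v t)"
  using assms by (intro sq_int_add sq_int_scale)

lemma sq_int_mult_integrable:
  assumes "sq_int u" "sq_int v"
  shows "integrable lborel (\<lambda>t. u t * cnj (v t))" "integrable lborel (\<lambda>t. cmod (u t) * cmod (v t))"
proof -
  have [measurable]: "u \<in> borel_measurable lborel" "v \<in> borel_measurable lborel"
    using assms by (auto simp: sq_int_def)
  have i: "integrable lborel (\<lambda>t. (cmod (u t))\<^sup>2 + (cmod (v t))\<^sup>2)"
    using assms unfolding sq_int_def by auto
  have le: "cmod (u t) * cmod (v t) \<le> (cmod (u t))\<^sup>2 + (cmod (v t))\<^sup>2" for t
    using sum_squares_bound[of "cmod (u t)" "cmod (v t)"]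
      mult_nonneg_nonneg[OF norm_ge_zero[of "u t"] norm_ge_zero[of "v t"]] by linarith
  show "integrable lborel (\<lambda>t. u t * cnj (v t))"
    by (rule Bochner_Integration.integrable_bound[OF i]) (use le in \<open>auto simp: norm_mult\<close>)
  show "integrable lborel (\<lambda>t. cmod (u t) * cmod (v t))"
    by (rule Bochner_Integration.integrable_bound[OF i]) (use le in \<open>auto simp: norm_mult\<close>)
qed

text \<open>Integrates the weighted arithmetic-geometric mean inequality and optimises the weight.
  Both squared norms are first enlarged by \<open>e > 0\<close>, so that the optimal weight is
  positive and finite even when a norm vanishes; then \<open>e\<close> tends to 0.\<close>

lemma sq_int_cauchy_schwarz:
  assumes "sq_int u" "sq_int v"
  shows "(LINT t|lborel. cmod (u t) * cmod (v t)) \<le> sqrt (l2sq u) * sqrt (l2sq v)"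
proof -
  have [measurable]: "u \<in> borel_measurable lborel" "v \<in> borel_measurable lborel"
    using assms by (auto simp: sq_int_def)
  define A where "A = (LINT t|lborel. cmod (u t) * cmod (v t))"
  have *: "A \<le> (c\<^sup>2 * l2sq u + l2sq v / c\<^sup>2) / 2" if "c > 0" for c :: real
  proof -
    have "A \<le> (LINT t|lborel. (c\<^sup>2 * (cmod (u t))\<^sup>2 + (cmod (v t))\<^sup>2 / c\<^sup>2) / 2)"
      unfolding A_def
    proof (rule integral_mono)
      show "cmod (u t) * cmod (v t) \<le> (c\<^sup>2 * (cmod (u t))\<^sup>2 + (cmod (v t))\<^sup>2 / c\<^sup>2) / 2" for t
        using sum_squares_bound[of "c * cmod (u t)" "cmod (v t) / c"] that
        by (simp add: power_mult_distrib power_divide)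
      show "integrable lborel (\<lambda>t. (c\<^sup>2 * (cmod (u t))\<^sup>2 + (cmod (v t))\<^sup>2 / c\<^sup>2) / 2)"
        using assms unfolding sq_int_def by auto
    qed (rule sq_int_mult_integrable[OF assms])
    also have "\<dots> = (c\<^sup>2 * l2sq u + l2sq v / c\<^sup>2) / 2"
      using assms unfolding sq_int_def l2sq_def by simp
    finally show ?thesis .
  qed
  have "A \<le> sqrt ((l2sq u + e) * (l2sq v + e))" if "e > 0" for e
  proof -
    \<comment> \<open>The weight for which the two summands of the bound agree.\<close>
    define c where "c = sqrt (sqrt ((l2sq v + e) / (l2sq u + e)))"
    have p: "l2sq u + e > 0" "l2sq v + e > 0" using that l2sq_nonneg[of u] l2sq_nonneg[of v] by linarith+
    have c: "c > 0" "c\<^sup>2 = sqrt (l2sq v + e) / sqrt (l2sq u + e)"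
      using p unfolding c_def by (auto simp: real_sqrt_divide power_divide)
    define p q where "p = sqrt (l2sq u + e)" and "q = sqrt (l2sq v + e)"
    have pq: "p > 0" "q > 0" "l2sq u + e = p\<^sup>2" "l2sq v + e = q\<^sup>2"
      using p unfolding p_def q_def by auto
    have "A \<le> (c\<^sup>2 * (l2sq u + e) + (l2sq v + e) / c\<^sup>2) / 2"
    proof -
      have "c\<^sup>2 * l2sq u \<le> c\<^sup>2 * (l2sq u + e)" "l2sq v / c\<^sup>2 \<le> (l2sq v + e) / c\<^sup>2"
        using that by (auto intro!: mult_left_mono divide_right_mono)
      thus ?thesis using *[OF c(1)] by simp
    qed
    also have "\<dots> = (q / p * p\<^sup>2 + q\<^sup>2 / (q / p)) / 2"
      using c(2) pq unfolding p_def q_def by simp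
    also have "\<dots> = p * q" using pq(1,2) by (simp add: field_simps power2_eq_square)
    finally show ?thesis unfolding p_def q_def by (simp add: real_sqrt_mult)
  qed
  hence "\<forall>\<^sub>F e in at_right 0. A \<le> sqrt ((l2sq u + e) * (l2sq v + e))"
    by (auto simp: eventually_at_right_less eventually_at_filter)
  moreover have "((\<lambda>e. sqrt ((l2sq u + e) * (l2sq v + e))) \<longlongrightarrow> sqrt ((l2sq u + 0) * (l2sq v + 0))) (at_right 0)"
    by (intro tendsto_intros)
  ultimately have "A \<le> sqrt ((l2sq u + 0) * (l2sq v + 0))"
    by (intro tendsto_lowerbound[of _ _ "at_right 0"]) auto
  thus ?thesis unfolding A_def by (simp add: real_sqrt_mult)
qed

lemma cmod_l2ip_le:
  assumes "sq_int u" "sq_int v"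
  shows "cmod (l2ip u v) \<le> sqrt (l2sq u) * sqrt (l2sq v)"
proof -
  have "cmod (l2ip u v) \<le> (LINT t|lborel. cmod (u t * cnj (v t)))"
    unfolding l2ip_def by (rule integral_norm_bound)
  thus ?thesis using sq_int_cauchy_schwarz[OF assms] by (simp add: norm_mult)
qed

lemma l2ip_self: "l2ip u u = of_real (l2sq u)"
proof -
  have "l2ip u u = (LINT t|lborel. complex_of_real ((cmod (u t))\<^sup>2))"
    unfolding l2ip_def by (simp only: complex_norm_square)
  also have "\<dots> = of_real (l2sq u)" unfolding l2sq_def by (rule integral_complex_of_real)
  finally show ?thesis .
qed

lemma l2ip_cnj: "l2ip v u = cnj (l2ip u v)"
  unfolding l2ip_def by (subst Bochner_Integration.integral_cnj[symmetric]) (simp add: mult.commute)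

lemma l2ip_lin_left:
  assumes "sq_int u" "sq_int v" "sq_int w"
  shows "l2ip (\<lambda>t. a * u t + b * v t) w = a * l2ip u w + b * l2ip v w"
proof -
  have "l2ip (\<lambda>t. a * u t + b * v t) w = (LINT t|lborel. a * (u t * cnj (w t)) + b * (v t * cnj (w t)))"
    unfolding l2ip_def by (simp add: algebra_simps)
  thus ?thesis using assms unfolding l2ip_def by (simp add: sq_int_mult_integrable)
qed

lemma l2ip_lin_right:
  assumes "sq_int u" "sq_int v" "sq_int w"
  shows "l2ip w (\<lambda>t. a * u t + b * v t) = cnj a * l2ip w u + cnj b * l2ip w v"
  using l2ip_lin_left[OF assms, of a b] by (metis complex_cnj_add complex_cnj_mult l2ip_cnj)

lemma l2sq_diff:
  assumes "sq_int u" "sq_int v"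
  shows "l2sq (\<lambda>t. u t - v t) = l2sq u + l2sq v - 2 * Re (l2ip u v)"
proof -
  have s: "sq_int (\<lambda>t. 1 * u t + (-1) * v t)" by (rule sq_int_lin[OF assms])
  have "of_real (l2sq (\<lambda>t. u t - v t)) = l2ip (\<lambda>t. 1 * u t + (-1) * v t) (\<lambda>t. 1 * u t + (-1) * v t)"
    by (simp add: l2ip_self)
  also have "\<dots> = 1 * l2ip u (\<lambda>t. 1 * u t + (-1) * v t) + (-1) * l2ip v (\<lambda>t. 1 * u t + (-1) * v t)"
    by (rule l2ip_lin_left[OF assms s])
  also have "\<dots> = l2ip u u - l2ip u v - (l2ip v u - l2ip v v)"
    unfolding l2ip_lin_right[OF assms assms(1)] l2ip_lin_right[OF assms assms(2)] by simp
  also have "\<dots> = of_real (l2sq u) + of_real (l2sq v) - (l2ip u v + cnj (l2ip u v))"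
    by (simp add: l2ip_self l2ip_cnj[of v u])
  also have "\<dots> = of_real (l2sq u + l2sq v - 2 * Re (l2ip u v))"
    by (simp add: complex_add_cnj)
  finally show ?thesis by (simp only: of_real_eq_iff)
qed

text \<open>The source of every \<open>pi\<close> in the norm computations: on a line at distance
  \<open>b\<close> from the pole, \<open>1 / (z - p)\<close> has squared norm
  \<open>pi / b\<close>.\<close>

lemma integral_inverse_square_shift:
  fixes a b :: real assumes "b > 0"
  shows "integrable lborel (\<lambda>t. 1 / ((t - a)\<^sup>2 + b\<^sup>2))"
    "(LINT t|lborel. 1 / ((t - a)\<^sup>2 + b\<^sup>2)) = pi / b"
proof -
  have pos: "(t - a)\<^sup>2 + b\<^sup>2 > 0" for t using assms by (simp add: add_nonneg_pos)
  let ?F = "\<lambda>t. arctan ((t - a) / b) / b"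
  have D: "DERIV ?F t :> 1 / ((t - a)\<^sup>2 + b\<^sup>2)" for t
  proof -
    have e: "1 + ((t - a) / b)\<^sup>2 = ((t - a)\<^sup>2 + b\<^sup>2) / b\<^sup>2"
      using assms by (simp add: power_divide add_divide_distrib)
    have "DERIV ?F t :> inverse (1 + ((t - a) / b)\<^sup>2) * (1 / b) / b"
      using assms by (auto intro!: derivative_eq_intros)
    also have "inverse (1 + ((t - a) / b)\<^sup>2) * (1 / b) / b = 1 / ((t - a)\<^sup>2 + b\<^sup>2)"
      unfolding e using assms by (simp add: power2_eq_square)
    finally show ?thesis .
  qed
  have A: "(?F \<longlongrightarrow> - (pi / 2) / b) at_bot" "(?F \<longlongrightarrow> (pi / 2) / b) at_top"
  proof -
    have "\<forall>\<^sub>F t in at_top. Z \<le> (t - a) / b" for Z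
      using eventually_ge_at_top[of "Z * b + a"] by eventually_elim (use assms in \<open>simp add: field_simps\<close>)
    hence l1: "filterlim (\<lambda>t. (t - a) / b) at_top at_top" by (simp add: filterlim_at_top)
    have "\<forall>\<^sub>F t in at_bot. (t - a) / b \<le> Z" for Z
      using eventually_le_at_bot[of "Z * b + a"] by eventually_elim (use assms in \<open>simp add: field_simps\<close>)
    hence l2: "filterlim (\<lambda>t. (t - a) / b) at_bot at_bot" by (simp add: filterlim_at_bot)
    show "(?F \<longlongrightarrow> - (pi / 2) / b) at_bot" "(?F \<longlongrightarrow> (pi / 2) / b) at_top"
      using assms
      by (intro tendsto_divide tendsto_const filterlim_compose[OF tendsto_arctan_at_top l1]
            filterlim_compose[OF tendsto_arctan_at_bot l2, simplified]; simp)+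
  qed
  have A': "((?F \<circ> real_of_ereal) \<longlongrightarrow> - (pi / 2) / b) (at_right (-\<infinity>))"
           "((?F \<circ> real_of_ereal) \<longlongrightarrow> (pi / 2) / b) (at_left \<infinity>)"
    unfolding ereal_tendsto_simps1 by (fact A)+
  have c: "isCont (\<lambda>t. 1 / ((t - a)\<^sup>2 + b\<^sup>2)) t" for t
    using pos[of t] by (intro continuous_intros) auto
  note * = interval_integral_FTC_nonneg[of "-\<infinity>" "\<infinity>" ?F "\<lambda>t. 1 / ((t - a)\<^sup>2 + b\<^sup>2)", OF _ D c _ A']
  show "integrable lborel (\<lambda>t. 1 / ((t - a)\<^sup>2 + b\<^sup>2))"
    using *(1) by (simp add: set_integrable_def)
  show "(LINT t|lborel. 1 / ((t - a)\<^sup>2 + b\<^sup>2)) = pi / b"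
    using *(2) by (simp add: interval_integral_to_infinity_eq interval_lebesgue_integral_def set_lebesgue_integral_def)
qed

lemma cmod_inverse_diff_squared:
  "(cmod (1 / (Complex t y - p)))\<^sup>2 = 1 / ((t - Re p)\<^sup>2 + (y - Im p)\<^sup>2)"
  by (simp add: norm_divide power_divide cmod_power2)

lemma sq_int_inverse:
  assumes "y \<noteq> Im p"
  shows "sq_int (\<lambda>t. 1 / (Complex t y - p))" "l2sq (\<lambda>t. 1 / (Complex t y - p)) = pi / \<bar>y - Im p\<bar>"
proof -
  have e: "(cmod (1 / (Complex t y - p)))\<^sup>2 = 1 / ((t - Re p)\<^sup>2 + \<bar>y - Im p\<bar>\<^sup>2)" for t
    by (simp add: cmod_inverse_diff_squared)
  have c: "Complex t y \<noteq> p" for t using assms by auto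
  have "continuous_on UNIV (\<lambda>t. 1 / (Complex t y - p))"
    unfolding Complex_eq using c by (intro continuous_intros) (auto simp: Complex_eq)
  hence m: "(\<lambda>t. 1 / (Complex t y - p)) \<in> borel_measurable lborel"
    by (simp add: borel_measurable_continuous_onI)
  have b: "\<bar>y - Im p\<bar> > 0" using assms by auto
  show "sq_int (\<lambda>t. 1 / (Complex t y - p))" "l2sq (\<lambda>t. 1 / (Complex t y - p)) = pi / \<bar>y - Im p\<bar>"
    unfolding sq_int_def l2sq_def e using m integral_inverse_square_shift[OF b, of "Re p"] by auto
qed

lemma borel_measurable_horizontal_line:
  assumes "f holomorphic_on S" "\<And>t. Complex t y \<in> S"
  shows "(\<lambda>t. f (Complex t y)) \<in> borel_measurable lborel"
proof -
  have "continuous_on UNIV (\<lambda>t. f (Complex t y))"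
    by (rule continuous_on_compose2[OF holomorphic_on_imp_continuous_on[OF assms(1)]])
       (use assms(2) in \<open>auto simp: Complex_eq intro!: continuous_intros\<close>)
  thus ?thesis by (simp add: borel_measurable_continuous_onI)
qed

section \<open>Moving a line of integration within a strip\<close>

lemma not_integrable_if_bounded_below_at_top:
  fixes J :: "real \<Rightarrow> real"
  assumes J: "integrable lborel J" "\<And>x. 0 \<le> J x" and c: "c > 0" and ge: "\<And>x. x \<ge> R \<Longrightarrow> c \<le> J x"
  shows False
proof -
  have "real n * c \<le> integral\<^sup>L lborel J" for n
  proof -
    have "real n * c = (LINT x|lborel. c * indicator {R..R + real n} x)" by simp
    also have "\<dots> \<le> integral\<^sup>L lborel J"
    proof (rule integral_mono[OF _ J(1)])
      show "integrable lborel (\<lambda>x. c * indicator {R..R + real n} x)" by simp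
    qed (auto simp: indicator_def J(2) ge)
    finally show ?thesis .
  qed
  moreover obtain n where "integral\<^sup>L lborel J < real n * c"
    using reals_Archimedean3[OF c] by blast
  ultimately show False by (meson leD)
qed

text \<open>Cauchy's theorem on rectangles, although no pointwise decay is known on the vertical
  sides. By Fubini the uniform bound \<open>C\<close> makes \<open>I t\<close>, the integral of the
  modulus over the vertical segment at abscissa \<open>t\<close>, integrable in \<open>t\<close>;
  hence the contribution of the sides at \<open>R\<close> and \<open>-R\<close> cannot stay away
  from 0 as \<open>R\<close> grows.\<close>

lemma line_integral_shift:
  fixes \<Phi> :: "complex \<Rightarrow> complex"
  assumes holo: "\<Phi> holomorphic_on {z. \<alpha> < Im z \<and> Im z < \<beta>}"
    and int: "\<And>y. \<alpha> < y \<Longrightarrow> y < \<beta> \<Longrightarrow> integrable lborel (\<lambda>t. \<Phi> (Complex t y))"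
    and bd: "\<And>y. \<alpha> < y \<Longrightarrow> y < \<beta> \<Longrightarrow> (LINT t|lborel. cmod (\<Phi> (Complex t y))) \<le> C"
    and y: "\<alpha> < y1" "y1 \<le> y2" "y2 < \<beta>"
  shows "(LINT t|lborel. \<Phi> (Complex t y1)) = (LINT t|lborel. \<Phi> (Complex t y2))"
proof -
  define S where "S = {z. \<alpha> < Im z \<and> Im z < \<beta>}"
  have S: "open S" "convex S"
  proof -
    have "S = {z. \<alpha> < Im z} \<inter> {z. Im z < \<beta>}" unfolding S_def by auto
    thus "open S" "convex S"
      by (auto intro!: open_Int open_halfspace_Im_gt open_halfspace_Im_lt convex_Int
            convex_halfspace_Im_gt convex_halfspace_Im_lt)
  qed
  obtain \<Psi> where \<Psi>: "\<And>z. z \<in> S \<Longrightarrow> (\<Psi> has_field_derivative \<Phi> z) (at z)"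
    using holomorphic_convex_primitive'[OF S(2,1) holo[folded S_def]] S(1) by (metis at_within_open)
  have inS: "Complex t y \<in> S" if "y1 \<le> y" "y \<le> y2" for t y
    using that y unfolding S_def by auto
  have cont: "continuous_on S \<Phi>" using holo unfolding S_def by (rule holomorphic_on_imp_continuous_on)
  \<comment> \<open>Heights come first and the strip is cut down to a closed band, so that
    integrability on the product follows from the bounds on single lines.\<close>
  define K where "K = (\<lambda>(\<eta>, t). indicator ({y1..y2} \<times> UNIV) (\<eta>, t) *\<^sub>R \<Phi> (Complex t \<eta>))"
  have Kmeas: "K \<in> borel_measurable (lborel \<Otimes>\<^sub>M lborel)"
  proof -
    have "continuous_on ({y1..y2} \<times> UNIV) (\<lambda>p. \<Phi> (Complex (snd p) (fst p)))"
      by (rule continuous_on_compose2[OF cont]) (auto simp: Complex_eq inS[unfolded Complex_eq] intro!: continuous_intros)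
    hence "(\<lambda>p. indicator ({y1..y2} \<times> UNIV) p *\<^sub>R \<Phi> (Complex (snd p) (fst p))) \<in> borel_measurable borel"
      by (intro borel_measurable_continuous_on_indicator) (auto intro!: borel_closed closed_Times)
    thus ?thesis unfolding lborel_prod K_def by (simp add: case_prod_unfold)
  qed
  have Kval: "K (\<eta>, t) = (if \<eta> \<in> {y1..y2} then \<Phi> (Complex t \<eta>) else 0)" for \<eta> t
    unfolding K_def by (auto simp: indicator_def)
  have C0: "0 \<le> C" using bd[of y1] y by (smt (verit) Bochner_Integration.integral_nonneg norm_ge_zero)
  have Kint: "integrable (lborel \<Otimes>\<^sub>M lborel) K"
  proof (rule lborel_pair.Fubini_integrable[OF Kmeas])
    have m: "(\<lambda>\<eta>. LINT t|lborel. norm (K (\<eta>, t))) \<in> borel_measurable lborel"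
      using Kmeas by measurable
    have "integrable lborel (\<lambda>\<eta>. C * indicator {y1..y2} \<eta>)"
      by (intro integrable_mult_right integrable_real_indicator) (auto simp: emeasure_lborel_Icc_eq)
    thus "integrable lborel (\<lambda>\<eta>. LINT t|lborel. norm (K (\<eta>, t)))"
    proof (rule Bochner_Integration.integrable_bound[OF _ m])
      show "AE \<eta> in lborel. norm (LINT t|lborel. norm (K (\<eta>, t))) \<le> norm (C * indicator {y1..y2} \<eta>)"
        using bd y C0 by (auto simp: Kval indicator_def)
    qed
    show "AE \<eta> in lborel. integrable lborel (\<lambda>t. K (\<eta>, t))"
    proof (rule AE_I2)
      fix \<eta>
      have "(\<lambda>t. K (\<eta>, t)) = (if \<eta> \<in> {y1..y2} then (\<lambda>t. \<Phi> (Complex t \<eta>)) else (\<lambda>t. 0))"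
        by (auto simp: Kval fun_eq_iff)
      thus "integrable lborel (\<lambda>t. K (\<eta>, t))" using int y by (auto split: if_splits)
    qed
  qed
  define I where "I = (\<lambda>t. LINT \<eta>|lborel. norm (K (\<eta>, t)))"
  have "integrable (lborel \<Otimes>\<^sub>M lborel) (\<lambda>(t, \<eta>). norm (K (\<eta>, t)))"
    using lborel_pair.integrable_product_swap[OF integrable_norm[OF Kint]] by simp
  hence Iint: "integrable lborel I"
    using lborel_pair.integrable_fst'[of "\<lambda>(t, \<eta>). norm (K (\<eta>, t))"] unfolding I_def by simp
  have I0: "0 \<le> I t" for t unfolding I_def by simp
  have vd: "(Complex t has_vector_derivative \<i>) (at \<eta> within A)"
    "((\<lambda>t. Complex t \<eta>) has_vector_derivative 1) (at t within B)" for t \<eta> A B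
    by (auto simp: has_vector_derivative_complex_iff intro!: derivative_eq_intros)
  have vert: "cmod (\<Psi> (Complex t y2) - \<Psi> (Complex t y1)) \<le> I t" for t
  proof -
    have "(LINT \<eta>|lborel. indicator {y1..y2} \<eta> *\<^sub>R (\<Phi> (Complex t \<eta>) * \<i>)) = \<Psi> (Complex t y2) - \<Psi> (Complex t y1)"
    proof (rule integral_FTC_atLeastAtMost[OF y(2)])
      fix \<eta> assume "y1 \<le> \<eta>" "\<eta> \<le> y2"
      hence "((\<Psi> \<circ> Complex t) has_vector_derivative (\<i> * \<Phi> (Complex t \<eta>))) (at \<eta> within {y1..y2})"
        by (intro field_vector_diff_chain_within has_field_derivative_at_within[OF \<Psi>] inS vd)
      thus "((\<lambda>\<eta>. \<Psi> (Complex t \<eta>)) has_vector_derivative \<Phi> (Complex t \<eta>) * \<i>) (at \<eta> within {y1..y2})"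
        by (simp add: o_def mult.commute)
    next
      show "continuous_on {y1..y2} (\<lambda>\<eta>. \<Phi> (Complex t \<eta>) * \<i>)"
        by (intro continuous_on_mult continuous_on_const continuous_on_compose2[OF cont])
           (auto simp: Complex_eq inS[unfolded Complex_eq] intro!: continuous_intros)
    qed
    hence "cmod (\<Psi> (Complex t y2) - \<Psi> (Complex t y1)) = cmod (LINT \<eta>|lborel. indicator {y1..y2} \<eta> *\<^sub>R (\<Phi> (Complex t \<eta>) * \<i>))"
      by simp
    also have "\<dots> \<le> (LINT \<eta>|lborel. cmod (indicator {y1..y2} \<eta> *\<^sub>R (\<Phi> (Complex t \<eta>) * \<i>)))"
      by (rule integral_norm_bound)
    also have "\<dots> = I t" unfolding I_def
      by (intro Bochner_Integration.integral_cong refl) (auto simp: Kval norm_mult indicator_def)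
    finally show ?thesis .
  qed
  have horiz: "(LINT t|lborel. indicator {-R..R} t *\<^sub>R \<Phi> (Complex t \<eta>)) = \<Psi> (Complex R \<eta>) - \<Psi> (Complex (-R) \<eta>)"
    if "R \<ge> 0" "y1 \<le> \<eta>" "\<eta> \<le> y2" for R \<eta>
  proof (rule integral_FTC_atLeastAtMost)
    show "-R \<le> R" using that by simp
    fix t assume "-R \<le> t" "t \<le> R"
    have "((\<Psi> \<circ> (\<lambda>t. Complex t \<eta>)) has_vector_derivative (1 * \<Phi> (Complex t \<eta>))) (at t within {-R..R})"
      using that by (intro field_vector_diff_chain_within has_field_derivative_at_within[OF \<Psi>] inS vd)
    thus "((\<lambda>t. \<Psi> (Complex t \<eta>)) has_vector_derivative \<Phi> (Complex t \<eta>)) (at t within {-R..R})"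
      by (simp add: o_def)
  next
    show "continuous_on {-R..R} (\<lambda>t. \<Phi> (Complex t \<eta>))"
      using that by (intro continuous_on_compose2[OF cont])
        (auto simp: Complex_eq inS[unfolded Complex_eq] intro!: continuous_intros)
  qed
  define D where "D = (\<lambda>t. \<Phi> (Complex t y2) - \<Phi> (Complex t y1))"
  define L where "L = integral\<^sup>L lborel D"
  have Dint: "integrable lborel D"
    using int y unfolding D_def by auto
  have lim: "((\<lambda>R. LINT t|lborel. indicator {-R..R} t *\<^sub>R D t) \<longlongrightarrow> L) at_top"
    unfolding L_def
  proof (rule integral_dominated_convergence_at_top[where w = "\<lambda>t. cmod (D t)"])
    have "\<forall>\<^sub>F R in at_top. indicator {-R..R} t *\<^sub>R D t = D t" for t
      using eventually_ge_at_top[of "\<bar>t\<bar>"] by eventually_elim (auto simp: indicator_def)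
    thus "AE t in lborel. ((\<lambda>R. indicator {-R..R} t *\<^sub>R D t) \<longlongrightarrow> D t) at_top"
      by (auto intro: tendsto_eventually)
  qed (use Dint in \<open>auto simp: indicator_def intro: borel_measurable_integrable\<close>)
  have le: "cmod (LINT t|lborel. indicator {-R..R} t *\<^sub>R D t) \<le> I R + I (-R)" if "R \<ge> 0" for R
  proof -
    have "integrable lborel (\<lambda>t. indicator {-R..R} t *\<^sub>R \<Phi> (Complex t \<eta>))" if "y1 \<le> \<eta>" "\<eta> \<le> y2" for \<eta>
      using int[of \<eta>] that y by (intro integrable_mult_indicator) auto
    hence "(LINT t|lborel. indicator {-R..R} t *\<^sub>R D t) =
      (LINT t|lborel. indicator {-R..R} t *\<^sub>R \<Phi> (Complex t y2)) - (LINT t|lborel. indicator {-R..R} t *\<^sub>R \<Phi> (Complex t y1))"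
      unfolding D_def scaleR_diff_right using y by (intro Bochner_Integration.integral_diff) auto
    also have "\<dots> = (\<Psi> (Complex R y2) - \<Psi> (Complex R y1)) - (\<Psi> (Complex (-R) y2) - \<Psi> (Complex (-R) y1))"
      using horiz[OF that] y by simp
    finally show ?thesis
      using norm_triangle_ineq4[of "\<Psi> (Complex R y2) - \<Psi> (Complex R y1)" "\<Psi> (Complex (-R) y2) - \<Psi> (Complex (-R) y1)"]
        vert[of R] vert[of "-R"] by simp
  qed
  \<comment> \<open>\<open>L\<close> is the limit of truncated differences that are at most
    \<open>I R + I (- R)\<close>. If it were not 0, this integrable function would stay above
    \<open>cmod L / 2\<close> from some point on.\<close>
  have "L = 0"
  proof (rule ccontr)
    assume "L \<noteq> 0"
    hence "cmod L / 2 < cmod L" by simp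
    from order_tendstoD(1)[OF tendsto_norm[OF lim] this]
    obtain R0 where R0: "\<And>R. R \<ge> R0 \<Longrightarrow> cmod L / 2 < cmod (LINT t|lborel. indicator {-R..R} t *\<^sub>R D t)"
      by (auto simp: eventually_at_top_linorder)
    have "integrable lborel (\<lambda>R. I R + I (- R))"
      using Iint lborel_integrable_real_affine[OF Iint, of "-1" 0] by auto
    thus False
    proof (rule not_integrable_if_bounded_below_at_top[where c = "cmod L / 2" and R = "max R0 0"])
      show "cmod L / 2 \<le> I R + I (- R)" if "R \<ge> max R0 0" for R
        using R0[of R] le[of R] that by simp
    qed (use \<open>L \<noteq> 0\<close> I0 in \<open>auto intro: add_nonneg_nonneg\<close>)
  qed
  thus ?thesis unfolding L_def D_def using int y by simp
qed

section \<open>The inner product of the Hardy space\<close>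

abbreviation hline :: "(complex \<Rightarrow> complex) \<Rightarrow> real \<Rightarrow> real \<Rightarrow> complex" where
  "hline f y \<equiv> \<lambda>t. f (Complex t y)"

abbreviation msq :: "(complex \<Rightarrow> complex) \<Rightarrow> real \<Rightarrow> real \<Rightarrow> real" where
  "msq f y t \<equiv> (cmod (f (Complex t y)))\<^sup>2"

lemma open_upper_half_plane [simp, intro]: "open upper_half_plane"
  unfolding upper_half_plane_def by (rule open_halfspace_Im_gt)

lemma H2_holomorphic: "f \<in> H2 \<Longrightarrow> f holomorphic_on upper_half_plane"
  by (simp add: H2_def)

lemma H2_vanish: "f \<in> H2 \<Longrightarrow> Im z \<le> 0 \<Longrightarrow> f z = 0"
  by (simp add: H2_def)

lemma H2_sq_int: "f \<in> H2 \<Longrightarrow> y > 0 \<Longrightarrow> sq_int (hline f y)"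
  unfolding sq_int_def
  by (auto intro!: borel_measurable_horizontal_line[OF H2_holomorphic, simplified] simp: upper_half_plane_def H2_def)

lemma H2_bounded:
  assumes "f \<in> H2" obtains C where "C \<ge> 0" "\<And>y. y > 0 \<Longrightarrow> l2sq (hline f y) \<le> C"
proof -
  from assms obtain C where C: "\<And>y. y > 0 \<Longrightarrow> l2sq (hline f y) \<le> C"
    unfolding H2_def bdd_above_def l2sq_def by auto
  have "C \<ge> 0" using order_trans[OF l2sq_nonneg C[of 1]] by simp
  with C show ?thesis using that by blast
qed

lemma H2I:
  assumes "f holomorphic_on upper_half_plane" "\<And>z. Im z \<le> 0 \<Longrightarrow> f z = 0"
    and "\<And>y. y > 0 \<Longrightarrow> sq_int (hline f y)" "\<And>y. y > 0 \<Longrightarrow> l2sq (hline f y) \<le> C"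
  shows "f \<in> H2"
  using assms unfolding H2_def sq_int_def l2sq_def bdd_above_def by auto

lemma H2_lin:
  assumes "f \<in> H2" "g \<in> H2" shows "(\<lambda>z. a * f z + b * g z) \<in> H2"
proof -
  obtain C where C: "\<And>y. y > 0 \<Longrightarrow> l2sq (hline f y) \<le> C" using H2_bounded[OF assms(1)] by metis
  obtain D where D: "\<And>y. y > 0 \<Longrightarrow> l2sq (hline g y) \<le> D" using H2_bounded[OF assms(2)] by metis
  have sc: "l2sq (\<lambda>t. c * u t) = (cmod c)\<^sup>2 * l2sq u" for c u
    unfolding l2sq_def by (simp add: norm_mult power_mult_distrib)
  show ?thesis
  proof (rule H2I)
    show "(\<lambda>z. a * f z + b * g z) holomorphic_on upper_half_plane"
      using assms by (intro holomorphic_intros H2_holomorphic)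
    show "sq_int (hline (\<lambda>z. a * f z + b * g z) y)" if "y > 0" for y
      using assms that by (intro sq_int_lin H2_sq_int)
    show "l2sq (hline (\<lambda>z. a * f z + b * g z) y) \<le> 2 * ((cmod a)\<^sup>2 * C) + 2 * ((cmod b)\<^sup>2 * D)" if "y > 0" for y
    proof -
      have "l2sq (hline (\<lambda>z. a * f z + b * g z) y) \<le> 2 * l2sq (\<lambda>t. a * hline f y t) + 2 * l2sq (\<lambda>t. b * hline g y t)"
        using assms that by (intro sq_int_add sq_int_scale H2_sq_int)
      also have "\<dots> \<le> 2 * ((cmod a)\<^sup>2 * C) + 2 * ((cmod b)\<^sup>2 * D)"
        unfolding sc using C[OF that] D[OF that] by (intro add_mono mult_left_mono) auto
      finally show ?thesis .
    qed
  qed (use assms in \<open>auto simp: H2_vanish\<close>)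
qed

lemma H2_zero: "(\<lambda>z. 0) \<in> H2"
  by (rule H2I[where C = 0]) (auto simp: sq_int_def l2sq_def)

lemma H2_scale: "f \<in> H2 \<Longrightarrow> (\<lambda>z. a * f z) \<in> H2"
  using H2_lin[of f f a 0] by simp

lemma H2_diff: "f \<in> H2 \<Longrightarrow> g \<in> H2 \<Longrightarrow> (\<lambda>z. f z - g z) \<in> H2"
  using H2_lin[of f g 1 "-1"] by simp

text \<open>On the line at height \<open>\<eta>\<close> the integrand \<open>f(z) cnj (g (cnj z + i s))\<close> pairs \<open>f\<close> at height \<open>\<eta>\<close>
  with \<open>g\<close> at height \<open>s - \<eta>\<close>, and it is holomorphic in \<open>z\<close>.\<close>

lemma H2_l2ip_shift:
  assumes f: "f \<in> H2" and g: "g \<in> H2" and y: "y1 > 0" "y2 > 0" "y1' > 0" "y2' > 0" "y1 + y2 = y1' + y2'"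
  shows "l2ip (hline f y1) (hline g y2) = l2ip (hline f y1') (hline g y2')"
proof -
  define s where "s = y1 + y2"
  obtain C where C: "C \<ge> 0" "\<And>y. y > 0 \<Longrightarrow> l2sq (hline f y) \<le> C" using H2_bounded[OF f] by metis
  obtain D where D: "D \<ge> 0" "\<And>y. y > 0 \<Longrightarrow> l2sq (hline g y) \<le> D" using H2_bounded[OF g] by metis
  define \<Phi> where "\<Phi> = (\<lambda>z. f z * cnj (g (cnj z + \<i> * of_real s)))"
  have \<Phi>v: "\<Phi> (Complex t \<eta>) = hline f \<eta> t * cnj (hline g (s - \<eta>) t)" for t \<eta>
  proof -
    have "cnj (Complex t \<eta>) + \<i> * of_real s = Complex t (s - \<eta>)" by (simp add: complex_eq_iff)
    thus ?thesis unfolding \<Phi>_def by simp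
  qed
  have holo: "\<Phi> holomorphic_on {z. 0 < Im z \<and> Im z < s}" (is "_ holomorphic_on ?S")
  proof -
    have "(\<lambda>z. g (z + \<i> * of_real s)) holomorphic_on cnj ` ?S"
      by (rule holomorphic_on_compose_gen[OF _ H2_holomorphic[OF g], unfolded o_def])
         (auto intro!: holomorphic_intros simp: upper_half_plane_def)
    hence "(cnj \<circ> (\<lambda>z. g (z + \<i> * of_real s)) \<circ> cnj) holomorphic_on ?S"
      by (rule holomorphic_on_compose_cnj_cnj) (simp add: open_Collect_conj open_halfspace_Im_gt open_halfspace_Im_lt)
    thus ?thesis unfolding \<Phi>_def o_def
      by (intro holomorphic_on_mult holomorphic_on_subset[OF H2_holomorphic[OF f]]) (auto simp: upper_half_plane_def)
  qed
  have shift: "(LINT t|lborel. \<Phi> (Complex t a)) = (LINT t|lborel. \<Phi> (Complex t b))"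
    if "0 < a" "a \<le> b" "b < s" for a b
  proof (rule line_integral_shift[OF holo _ _ that])
    fix y assume y: "0 < y" "y < s"
    have q: "sq_int (hline f y)" "sq_int (hline g (s - y))" using f g y by (auto intro: H2_sq_int)
    show "integrable lborel (\<lambda>t. \<Phi> (Complex t y))"
      unfolding \<Phi>v by (rule sq_int_mult_integrable[OF q])
    have "(LINT t|lborel. cmod (\<Phi> (Complex t y))) \<le> sqrt (l2sq (hline f y)) * sqrt (l2sq (hline g (s - y)))"
      unfolding \<Phi>v using sq_int_cauchy_schwarz[OF q] by (simp add: norm_mult)
    also have "\<dots> \<le> sqrt C * sqrt D"
      using C D y by (intro mult_mono) auto
    finally show "(LINT t|lborel. cmod (\<Phi> (Complex t y))) \<le> sqrt C * sqrt D" .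
  qed
  have e: "s - y1 = y2" "s - y1' = y2'" using y unfolding s_def by auto
  have lt: "y1 < s" "y1' < s" using y unfolding s_def by linarith+
  have "(LINT t|lborel. \<Phi> (Complex t y1)) = (LINT t|lborel. \<Phi> (Complex t y1'))"
  proof (cases "y1 \<le> y1'")
    case True show ?thesis by (rule shift[OF y(1) True lt(2)])
  next
    case False
    hence "y1' \<le> y1" by simp
    from shift[OF y(3) this lt(1)] show ?thesis by (rule sym)
  qed
  thus ?thesis unfolding l2ip_def \<Phi>v e .
qed

section \<open>Dependence of the norm on the height\<close>

lemma H2_l2ip_self:
  assumes "f \<in> H2" "y > 0" "y' > 0"
  shows "l2ip (hline f y) (hline f y') = of_real (l2sq (hline f ((y + y') / 2)))"
proof -
  have "l2ip (hline f y) (hline f y') = l2ip (hline f ((y + y') / 2)) (hline f ((y + y') / 2))"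
    using assms by (intro H2_l2ip_shift) auto
  thus ?thesis by (simp only: l2ip_self)
qed

text \<open>An increase from \<open>a\<close> to \<open>b\<close> would propagate: by midpoint
  convexity the increments along the points \<open>a + n (b - a)\<close> never drop below the first
  one, so \<open>M\<close> would grow at least linearly and pass the bound \<open>C\<close>.\<close>

lemma bounded_midpoint_convex_antimono:
  fixes M :: "real \<Rightarrow> real"
  assumes mid: "\<And>x y. x > 0 \<Longrightarrow> y > 0 \<Longrightarrow> M ((x + y) / 2) \<le> (M x + M y) / 2"
    and bd: "\<And>x. x > 0 \<Longrightarrow> M x \<le> C" and ab: "0 < a" "a \<le> b"
  shows "M b \<le> M a"
proof (rule ccontr)
  assume "\<not> M b \<le> M a"
  hence d: "M b - M a > 0" by simp
  define x where "x n = a + real n * (b - a)" for n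
  have x0: "x n > 0" for n unfolding x_def using ab by (simp add: add_pos_nonneg)
  have inc: "M (x (Suc n)) - M (x n) \<ge> M b - M a" for n
  proof (induction n)
    case 0 show ?case by (simp add: x_def)
  next
    case (Suc n)
    have "(x n + x (Suc (Suc n))) / 2 = x (Suc n)" unfolding x_def by (simp add: field_simps)
    with mid[OF x0[of n] x0[of "Suc (Suc n)"]] Suc show ?case by simp
  qed
  have "M (x n) \<ge> M a + real n * (M b - M a)" for n
  proof (induction n)
    case (Suc n) thus ?case using inc[of n] by (simp add: algebra_simps)
  qed (simp add: x_def)
  hence "real n * (M b - M a) \<le> C - M a" for n using bd[OF x0[of n]] by (smt (verit))
  moreover obtain n where "C - M a < real n * (M b - M a)" using reals_Archimedean3[OF d] by blast
  ultimately show False by (meson leD)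
qed

lemma H2_l2sq_antimono:
  assumes f: "f \<in> H2" and ab: "0 < a" "a \<le> b"
  shows "l2sq (hline f b) \<le> l2sq (hline f a)"
proof -
  obtain C where C: "\<And>y. y > 0 \<Longrightarrow> l2sq (hline f y) \<le> C" using H2_bounded[OF f] by metis
  show ?thesis
  proof (rule bounded_midpoint_convex_antimono[where M = "\<lambda>y. l2sq (hline f y)", OF _ C ab])
    fix x y :: real assume xy: "x > 0" "y > 0"
    let ?M = "\<lambda>y. l2sq (hline f y)"
    have "?M ((x + y) / 2) = cmod (l2ip (hline f x) (hline f y))"
      unfolding H2_l2ip_self[OF f xy] by simp
    also have "\<dots> \<le> sqrt (?M x) * sqrt (?M y)"
      using f xy by (intro cmod_l2ip_le H2_sq_int)
    also have "\<dots> \<le> (?M x + ?M y) / 2"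
      using sum_squares_bound[of "sqrt (?M x)" "sqrt (?M y)"] by simp
    finally show "?M ((x + y) / 2) \<le> (?M x + ?M y) / 2" .
  qed
qed

lemma H2_l2sq_limit:
  assumes f: "f \<in> H2"
  shows "\<exists>L. ((\<lambda>y. l2sq (hline f y)) \<longlongrightarrow> L) (at_right 0) \<and> (\<forall>y>0. l2sq (hline f y) \<le> L)
     \<and> (\<forall>\<delta>>0. \<exists>y>0. L - \<delta> < l2sq (hline f y))"
proof -
  define M where "M = (\<lambda>y. l2sq (hline f y))"
  define L where "L = (SUP y\<in>{0<..}. M y)"
  have bdd: "bdd_above (M ` {0<..})"
    using f unfolding H2_def M_def l2sq_def by auto
  have le: "M y \<le> L" if "y > 0" for y
    unfolding L_def using that by (intro cSUP_upper bdd) auto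
  have ap: "\<exists>y>0. L - \<delta> < M y" if "\<delta> > 0" for \<delta>
    using less_cSUP_iff[OF _ bdd, of "L - \<delta>"] that unfolding L_def by auto
  have "(M \<longlongrightarrow> L) (at_right 0)"
  proof (rule tendstoI)
    fix e :: real assume e: "e > 0"
    obtain y0 where y0: "y0 > 0" "L - e < M y0" using ap[OF e] by auto
    have "\<forall>\<^sub>F y in at_right 0. 0 < y \<and> y < y0"
      using y0(1) eventually_at_right[of 0 1] by (auto simp: eventually_at_right_field intro!: exI[of _ y0])
    thus "\<forall>\<^sub>F y in at_right 0. dist (M y) L < e"
    proof eventually_elim
      case (elim y)
      have "M y0 \<le> M y" using H2_l2sq_antimono[OF f, of y y0] elim unfolding M_def by simp
      with y0 le[of y] elim show ?case by (simp add: dist_real_def)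
    qed
  qed
  with le ap show ?thesis unfolding M_def by blast
qed

text \<open>Write \<open>M\<close> for the squared norm at a given height. Expanding the square
  gives \<open>M y + M y0 - 2 M ((y + y0) / 2)\<close>, which monotonicity bounds by
  \<open>M y - M y0\<close>, hence by \<open>L - M y0\<close>. So \<open>y0\<close> only has to
  bring \<open>M\<close> close to its supremum.\<close>

lemma H2_line_cauchy:
  assumes f: "f \<in> H2" and "\<delta> > 0"
  obtains y0 where "y0 > 0" "\<And>y. 0 < y \<Longrightarrow> y \<le> y0 \<Longrightarrow> l2sq (\<lambda>t. f (Complex t y) - f (Complex t y0)) < \<delta>"
proof -
  obtain L where L: "\<forall>y>0. l2sq (hline f y) \<le> L" "\<exists>y>0. L - \<delta> < l2sq (hline f y)"
    using H2_l2sq_limit[OF f] assms(2) by blast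
  then obtain y0 where y0: "y0 > 0" "L - \<delta> < l2sq (hline f y0)" by auto
  have "l2sq (\<lambda>t. f (Complex t y) - f (Complex t y0)) < \<delta>" if "0 < y" "y \<le> y0" for y
  proof -
    have "l2sq (\<lambda>t. hline f y t - hline f y0 t) = l2sq (hline f y) + l2sq (hline f y0) - 2 * l2sq (hline f ((y + y0) / 2))"
      using f that by (subst l2sq_diff) (auto simp: H2_sq_int H2_l2ip_self)
    moreover have "l2sq (hline f ((y + y0) / 2)) \<ge> l2sq (hline f y0)"
      using that by (intro H2_l2sq_antimono f) auto
    moreover have "l2sq (hline f y) \<le> L" using L(1) that by blast
    ultimately show ?thesis using y0(2) by linarith
  qed
  with y0 show ?thesis using that by blast
qed

section \<open>The inner product as a limit of line pairings\<close>

lemma h2_inner_eq: "h2_inner f g = Lim (at_right 0) (\<lambda>y. l2ip (hline f y) (hline g y))"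
  unfolding h2_inner_def l2ip_def ..

text \<open>\<open>h2_inner\<close> is a \<open>Lim\<close> and carries no information until
  convergence is known. Polarisation reduces the real part to the squared norms of \<open>f\<close>,
  \<open>g\<close> and \<open>f - g\<close>, which converge by monotonicity; the imaginary part is
  the real part of the pairing with \<open>\<i> * g\<close>.\<close>

lemma h2_inner_tendsto:
  assumes f: "f \<in> H2" and g: "g \<in> H2"
  shows "((\<lambda>y. l2ip (hline f y) (hline g y)) \<longlongrightarrow> h2_inner f g) (at_right 0)"
proof -
  have pos: "\<forall>\<^sub>F y in at_right 0. (y::real) > 0" by (simp add: eventually_at_right_less)
  have re: "\<exists>l. ((\<lambda>y. Re (l2ip (hline p y) (hline q y))) \<longlongrightarrow> l) (at_right 0)" if p: "p \<in> H2" and q: "q \<in> H2" for p q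
  proof -
    obtain P Q R where lim: "((\<lambda>y. l2sq (hline p y)) \<longlongrightarrow> P) (at_right 0)" "((\<lambda>y. l2sq (hline q y)) \<longlongrightarrow> Q) (at_right 0)"
      "((\<lambda>y. l2sq (hline (\<lambda>z. p z - q z) y)) \<longlongrightarrow> R) (at_right 0)"
      using H2_l2sq_limit[OF p] H2_l2sq_limit[OF q] H2_l2sq_limit[OF H2_diff[OF p q]] by blast
    have "((\<lambda>y. (l2sq (hline p y) + l2sq (hline q y) - l2sq (hline (\<lambda>z. p z - q z) y)) / 2) \<longlongrightarrow> (P + Q - R) / 2) (at_right 0)"
      by (intro tendsto_intros lim) simp
    moreover have "\<forall>\<^sub>F y in at_right 0. (l2sq (hline p y) + l2sq (hline q y) - l2sq (hline (\<lambda>z. p z - q z) y)) / 2 = Re (l2ip (hline p y) (hline q y))"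
      using pos by eventually_elim (simp add: l2sq_diff H2_sq_int p q)
    ultimately show ?thesis using tendsto_cong by fast
  qed
  obtain a where a: "((\<lambda>y. Re (l2ip (hline f y) (hline g y))) \<longlongrightarrow> a) (at_right 0)" using re[OF f g] by auto
  obtain b where b: "((\<lambda>y. Re (l2ip (hline f y) (hline (\<lambda>z. \<i> * g z) y))) \<longlongrightarrow> b) (at_right 0)" using re[OF f H2_scale[OF g]] by auto
  have "\<forall>\<^sub>F y in at_right 0. Re (l2ip (hline f y) (hline (\<lambda>z. \<i> * g z) y)) = Im (l2ip (hline f y) (hline g y))"
    using pos
  proof eventually_elim
    case (elim y)
    show ?case using l2ip_lin_right[OF H2_sq_int[OF g elim] H2_sq_int[OF g elim] H2_sq_int[OF f elim], of \<i> 0] by simp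
  qed
  hence b': "((\<lambda>y. Im (l2ip (hline f y) (hline g y))) \<longlongrightarrow> b) (at_right 0)"
    using b tendsto_cong by fast
  have "((\<lambda>y. l2ip (hline f y) (hline g y)) \<longlongrightarrow> Complex a b) (at_right 0)"
    using tendsto_Complex[OF a b'] by simp
  thus ?thesis unfolding h2_inner_eq using tendsto_Lim[of "at_right (0::real)"] by force
qed

lemma h2_inner_eqI:
  assumes "f \<in> H2" "g \<in> H2" "((\<lambda>y. l2ip (hline f y) (hline g y)) \<longlongrightarrow> l) (at_right 0)"
  shows "h2_inner f g = l"
  using tendsto_unique[OF _ h2_inner_tendsto[OF assms(1,2)] assms(3)] by simp

lemma h2_inner_lin_left:
  assumes "f \<in> H2" "g \<in> H2" "h \<in> H2"
  shows "h2_inner (\<lambda>z. a * f z + b * g z) h = a * h2_inner f h + b * h2_inner g h"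
proof (rule h2_inner_eqI[OF H2_lin[OF assms(1,2)] assms(3)])
  have "((\<lambda>y. a * l2ip (hline f y) (hline h y) + b * l2ip (hline g y) (hline h y)) \<longlongrightarrow> a * h2_inner f h + b * h2_inner g h) (at_right 0)"
    by (intro tendsto_intros h2_inner_tendsto assms)
  moreover have "\<forall>\<^sub>F y in at_right (0::real). y > 0" by (simp add: eventually_at_right_less)
  hence "\<forall>\<^sub>F y in at_right 0. a * l2ip (hline f y) (hline h y) + b * l2ip (hline g y) (hline h y)
      = l2ip (hline (\<lambda>z. a * f z + b * g z) y) (hline h y)"
    by eventually_elim (simp add: l2ip_lin_left H2_sq_int assms)
  ultimately show "((\<lambda>y. l2ip (hline (\<lambda>z. a * f z + b * g z) y) (hline h y)) \<longlongrightarrow> a * h2_inner f h + b * h2_inner g h) (at_right 0)"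
    using tendsto_cong by fast
qed

lemma h2_inner_cnj:
  assumes "f \<in> H2" "g \<in> H2" shows "h2_inner g f = cnj (h2_inner f g)"
  by (rule h2_inner_eqI[OF assms(2,1)]) (subst l2ip_cnj, intro tendsto_cnj h2_inner_tendsto assms)

lemma h2_inner_lin_right:
  assumes "f \<in> H2" "g \<in> H2" "h \<in> H2"
  shows "h2_inner h (\<lambda>z. a * f z + b * g z) = cnj a * h2_inner h f + cnj b * h2_inner h g"
proof -
  have "h2_inner h (\<lambda>z. a * f z + b * g z) = cnj (a * h2_inner f h + b * h2_inner g h)"
    unfolding h2_inner_cnj[OF H2_lin[OF assms(1,2)] assms(3)] h2_inner_lin_left[OF assms] ..
  thus ?thesis unfolding h2_inner_cnj[OF assms(1,3)] h2_inner_cnj[OF assms(2,3)] by simp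
qed

lemma h2_norm_facts:
  assumes f: "f \<in> H2"
  shows h2_inner_self: "h2_inner f f = of_real ((h2_norm f)\<^sup>2)"
    and l2sq_tendsto_h2_norm: "((\<lambda>y. l2sq (hline f y)) \<longlongrightarrow> (h2_norm f)\<^sup>2) (at_right 0)"
    and l2sq_le_h2_norm: "y > 0 \<Longrightarrow> l2sq (hline f y) \<le> (h2_norm f)\<^sup>2"
    and h2_norm_nonneg: "h2_norm f \<ge> 0"
proof -
  obtain L where L: "((\<lambda>y. l2sq (hline f y)) \<longlongrightarrow> L) (at_right 0)" "\<forall>y>0. l2sq (hline f y) \<le> L"
    using H2_l2sq_limit[OF f] by blast
  have "((\<lambda>y. l2ip (hline f y) (hline f y)) \<longlongrightarrow> of_real L) (at_right 0)"
    unfolding l2ip_self by (intro tendsto_of_real L)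
  hence i: "h2_inner f f = of_real L" by (rule h2_inner_eqI[OF f f])
  have "L \<ge> 0" using order_trans[OF l2sq_nonneg L(2)[rule_format, of 1]] by simp
  hence n: "(h2_norm f)\<^sup>2 = L" "h2_norm f \<ge> 0" unfolding h2_norm_def i by auto
  thus "h2_inner f f = of_real ((h2_norm f)\<^sup>2)" "((\<lambda>y. l2sq (hline f y)) \<longlongrightarrow> (h2_norm f)\<^sup>2) (at_right 0)"
    "h2_norm f \<ge> 0" "y > 0 \<Longrightarrow> l2sq (hline f y) \<le> (h2_norm f)\<^sup>2"
    using i L by auto
qed

lemma sqrt_l2sq_le_h2_norm: "f \<in> H2 \<Longrightarrow> y > 0 \<Longrightarrow> sqrt (l2sq (hline f y)) \<le> h2_norm f"
  using l2sq_le_h2_norm[of f y] h2_norm_nonneg[of f] by (simp add: real_le_lsqrt)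

lemma h2_cauchy_schwarz:
  assumes "f \<in> H2" "g \<in> H2" shows "cmod (h2_inner f g) \<le> h2_norm f * h2_norm g"
proof (rule tendsto_upperbound[OF tendsto_norm[OF h2_inner_tendsto[OF assms]]])
  have "\<forall>\<^sub>F y in at_right (0::real). y > 0" by (simp add: eventually_at_right_less)
  thus "\<forall>\<^sub>F y in at_right 0. cmod (l2ip (hline f y) (hline g y)) \<le> h2_norm f * h2_norm g"
  proof eventually_elim
    case (elim y)
    have "cmod (l2ip (hline f y) (hline g y)) \<le> sqrt (l2sq (hline f y)) * sqrt (l2sq (hline g y))"
      using assms elim by (intro cmod_l2ip_le H2_sq_int)
    also have "\<dots> \<le> h2_norm f * h2_norm g"
      using assms elim by (intro mult_mono sqrt_l2sq_le_h2_norm h2_norm_nonneg) auto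
    finally show ?case .
  qed
qed simp

lemma h2_norm_le:
  assumes "f \<in> H2" "\<And>y. y > 0 \<Longrightarrow> l2sq (hline f y) \<le> C"
  shows "(h2_norm f)\<^sup>2 \<le> C"
proof (rule tendsto_upperbound[OF l2sq_tendsto_h2_norm[OF assms(1)]])
  have "\<forall>\<^sub>F y in at_right (0::real). y > 0" by (simp add: eventually_at_right_less)
  thus "\<forall>\<^sub>F y in at_right 0. l2sq (hline f y) \<le> C" by eventually_elim (rule assms)
qed simp

lemma H2_eq_iff:
  assumes "f \<in> H2" "g \<in> H2" shows "f = g \<longleftrightarrow> (\<forall>z\<in>upper_half_plane. f z = g z)"
  using assms by (force simp: H2_vanish upper_half_plane_def not_less intro!: ext)

section \<open>Division and the Szego kernel\<close>

lemma holomorphic_bounded_on_compact: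
  assumes "h holomorphic_on S" "compact C" "C \<subseteq> S" obtains B where "\<And>z. z \<in> C \<Longrightarrow> cmod (h z) \<le> B"
proof -
  have "compact (h ` C)"
    using assms by (intro compact_continuous_image holomorphic_on_imp_continuous_on[OF holomorphic_on_subset])
  thus ?thesis using that by (meson compact_imp_bounded bounded_iff imageI)
qed

lemma eventually_at_right_le: "d > 0 \<Longrightarrow> \<forall>\<^sub>F y in at_right (0::real). 0 < y \<and> y \<le> d"
  by (rule eventually_at_rightI[of 0 d]) auto

lemma eventually_at_right_pos: "\<forall>\<^sub>F y in at_right (0::real). y > 0"
  by (simp add: eventually_at_right_less)

lemma H2_mult_bounded:
  assumes f: "f \<in> H2" and m: "m holomorphic_on upper_half_plane" "\<And>z. Im z > 0 \<Longrightarrow> cmod (m z) \<le> C"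
  shows "(\<lambda>z. m z * f z) \<in> H2"
proof -
  obtain B where B: "\<And>y. y > 0 \<Longrightarrow> l2sq (hline f y) \<le> B" using H2_bounded[OF f] by metis
  have q: "sq_int (hline (\<lambda>z. m z * f z) y)" "l2sq (hline (\<lambda>z. m z * f z) y) \<le> C\<^sup>2 * l2sq (hline f y)" if "y > 0" for y
    using that by (auto intro!: sq_int_mult_bounded H2_sq_int[OF f]
        borel_measurable_horizontal_line[OF m(1), simplified] m(2) simp: upper_half_plane_def)
  show ?thesis
  proof (rule H2I[where C = "C\<^sup>2 * B"])
    show "l2sq (hline (\<lambda>z. m z * f z) y) \<le> C\<^sup>2 * B" if "y > 0" for y
      using q(2)[OF that] B[OF that] by (meson mult_left_mono order_trans zero_le_power2)
  qed (use q f m H2_vanish H2_holomorphic in \<open>auto intro!: holomorphic_intros\<close>)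
qed

lemma H2_divide_lower:
  assumes g: "g \<in> H2" and p: "Im p < 0" shows "(\<lambda>z. 1 / (z - p) * g z) \<in> H2"
proof (rule H2_mult_bounded[OF g])
  have ne: "z - p \<noteq> 0" if "Im z > 0" for z using that p by (auto simp: complex_eq_iff)
  thus "(\<lambda>z. 1 / (z - p)) holomorphic_on upper_half_plane"
    by (intro holomorphic_intros) (auto simp: upper_half_plane_def)
  fix z assume z: "Im z > 0"
  have "- Im p \<le> Im (z - p)" using z by simp
  also have "\<dots> \<le> cmod (z - p)" using abs_Im_le_cmod abs_le_D1 by blast
  finally show "cmod (1 / (z - p)) \<le> 1 / - Im p" using p ne[OF z] by (simp add: norm_divide field_simps)
qed

lemma H2_dominated:
  assumes holo: "f holomorphic_on upper_half_plane" and van: "\<And>z. Im z \<le> 0 \<Longrightarrow> f z = 0"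
    and v: "integrable lborel v" and le: "\<And>t y. y > 0 \<Longrightarrow> msq f y t \<le> v t"
  shows "f \<in> H2" "(h2_norm f)\<^sup>2 \<le> integral\<^sup>L lborel v"
proof -
  have q: "sq_int (hline f y)" "l2sq (hline f y) \<le> integral\<^sup>L lborel v" if "y > 0" for y
    using that by (auto intro!: sq_int_dominated[OF v _ le]
        borel_measurable_horizontal_line[OF holo, simplified] simp: upper_half_plane_def)
  show *: "f \<in> H2" by (rule H2I[OF holo van q])
  show "(h2_norm f)\<^sup>2 \<le> integral\<^sup>L lborel v" by (rule h2_norm_le[OF * q(2)])
qed

text \<open>Meant for quotients \<open>u / (z - p)\<close>: away from \<open>p\<close> they are
  dominated by \<open>u / r\<close>, and the disc around \<open>p\<close>, where they only have to
  be bounded, meets every horizontal line in a set projecting into an interval of length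
  \<open>2 r\<close>. This serves interior zeros as well as real points.\<close>

lemma H2_local_bound:
  assumes u: "u \<in> H2" and holo: "v holomorphic_on upper_half_plane" and van: "\<And>z. Im z \<le> 0 \<Longrightarrow> v z = 0"
    and r: "r > 0" and near: "\<And>z. Im z > 0 \<Longrightarrow> cmod (z - p) \<le> r \<Longrightarrow> cmod (v z) \<le> B"
    and far: "\<And>z. Im z > 0 \<Longrightarrow> r < cmod (z - p) \<Longrightarrow> cmod (v z) \<le> cmod (u z) / r"
  shows "v \<in> H2"
proof -
  have le: "msq v y t \<le> msq u y t / r\<^sup>2 + B\<^sup>2 * indicator {Re p - r..Re p + r} t"
    if "y > 0" for t y
  proof (cases "cmod (Complex t y - p) \<le> r")
    case True
    have "\<bar>t - Re p\<bar> \<le> r"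
      using True abs_Re_le_cmod[of "Complex t y - p"] by simp
    moreover have "msq v y t \<le> B\<^sup>2" using near[of "Complex t y"] True that by (intro power_mono) auto
    ultimately show ?thesis by (auto simp: indicator_def add_increasing)
  next
    case False
    hence "cmod (v (Complex t y)) \<le> cmod (u (Complex t y)) / r" using that by (intro far) auto
    hence "msq v y t \<le> (cmod (u (Complex t y)) / r)\<^sup>2" by (intro power_mono) auto
    thus ?thesis by (simp add: power_divide add_increasing2)
  qed
  obtain C where C: "\<And>y. y > 0 \<Longrightarrow> l2sq (hline u y) \<le> C" using H2_bounded[OF u] by metis
  have ii: "integrable lborel (\<lambda>t. B\<^sup>2 * indicator {Re p - r..Re p + r} t)"
    by (intro integrable_mult_right integrable_real_indicator) (auto simp: emeasure_lborel_Icc_eq)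
  have iu: "integrable lborel (\<lambda>t. msq u y t / r\<^sup>2)" if "y > 0" for y
    using H2_sq_int[OF u that] unfolding sq_int_def by simp
  have q: "sq_int (hline v y)"
    "l2sq (hline v y) \<le> C / r\<^sup>2 + (LINT t|lborel. B\<^sup>2 * indicator {Re p - r..Re p + r} t)" if "y > 0" for y
  proof -
    have i: "integrable lborel (\<lambda>t. msq u y t / r\<^sup>2 + B\<^sup>2 * indicator {Re p - r..Re p + r} t)"
      using ii iu[OF that] by (rule Bochner_Integration.integrable_add[rotated])
    have m: "hline v y \<in> borel_measurable lborel"
      using that by (intro borel_measurable_horizontal_line[OF holo]) (simp add: upper_half_plane_def)
    show "sq_int (hline v y)" by (rule sq_int_dominated(1)[OF i m le[OF that]])
    have "l2sq (hline v y) \<le> l2sq (hline u y) / r\<^sup>2 + (LINT t|lborel. B\<^sup>2 * indicator {Re p - r..Re p + r} t)"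
      using sq_int_dominated(2)[OF i m le[OF that]]
      unfolding Bochner_Integration.integral_add[OF iu[OF that] ii] l2sq_def by simp
    thus "l2sq (hline v y) \<le> C / r\<^sup>2 + (LINT t|lborel. B\<^sup>2 * indicator {Re p - r..Re p + r} t)"
      using divide_right_mono[OF C[OF that], of "r\<^sup>2"] by simp
  qed
  show "v \<in> H2" by (rule H2I[OF holo van q])
qed

lemma H2_divide_upper:
  assumes u: "u \<in> H2" and p: "Im p > 0" and zero: "u p = 0"
  obtains v where "v \<in> H2" "\<And>z. Im z > 0 \<Longrightarrow> (z - p) * v z = u z"
proof -
  define w where "w = (\<lambda>z. if z = p then deriv u p else (u z - u p) / (z - p))"
  define v where "v = (\<lambda>z. if Im z > 0 then w z else 0)"
  have pU: "p \<in> upper_half_plane" using p by (simp add: upper_half_plane_def)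
  have "w holomorphic_on upper_half_plane"
    unfolding w_def by (rule pole_lemma[OF H2_holomorphic[OF u]]) (use pU in \<open>simp add: interior_open\<close>)
  hence holo: "v holomorphic_on upper_half_plane"
    by (rule holomorphic_transform) (simp add: v_def upper_half_plane_def)
  have vz: "v z = u z / (z - p)" if "Im z > 0" "z \<noteq> p" for z
    using that zero unfolding v_def w_def by simp
  have eq: "(z - p) * v z = u z" if "Im z > 0" for z
    using that vz zero by (cases "z = p") auto
  obtain r where r: "r > 0" "cball p r \<subseteq> upper_half_plane"
    using open_contains_cball pU open_upper_half_plane by blast
  obtain B where B: "\<And>z. z \<in> cball p r \<Longrightarrow> cmod (v z) \<le> B"
    by (rule holomorphic_bounded_on_compact[OF holo compact_cball r(2)]) (rule that; assumption)
  have "v \<in> H2"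
  proof (rule H2_local_bound[OF u holo _ r(1)])
    show "cmod (v z) \<le> B" if "cmod (z - p) \<le> r" for z
      using B[of z] that by (simp add: dist_norm norm_minus_commute)
    show "cmod (v z) \<le> cmod (u z) / r" if "Im z > 0" "r < cmod (z - p)" for z
    proof -
      have "z \<noteq> p" using that r(1) by auto
      thus ?thesis using that r(1) by (subst vz) (auto simp: norm_divide intro!: divide_left_mono)
    qed
  qed (simp add: v_def)
  with eq show ?thesis using that by blast
qed

lemma sq_int_cnj:
  assumes "sq_int u" shows "sq_int (\<lambda>t. cnj (u t))" "l2sq (\<lambda>t. cnj (u t)) = l2sq u"
  using assms unfolding sq_int_def l2sq_def by (auto intro: borel_measurable_cnj)

text \<open>Cauchy-Schwarz against \<open>1 / (z + \<i>)\<close>, whose norm on the line decays like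
  the inverse square root of the height. This decay lets line integrals be evaluated by pushing the
  line to infinity.\<close>

lemma integrable_bound_by_H2:
  assumes w: "w \<in> H2" and eq: "\<And>t. hline v y t = hline w y t * (1 / (Complex t y + \<i>))" and y: "y > 0"
  shows "integrable lborel (hline v y)" "(LINT t|lborel. cmod (hline v y t)) \<le> h2_norm w * sqrt (pi / (y + 1))"
proof -
  have s: "sq_int (\<lambda>t. 1 / (Complex t y - (-\<i>)))" "l2sq (\<lambda>t. 1 / (Complex t y - (-\<i>))) = pi / (y + 1)"
    using sq_int_inverse[of y "-\<i>"] y by auto
  let ?e = "\<lambda>t. cnj (1 / (Complex t y + \<i>))"
  have se: "sq_int ?e" "l2sq ?e = pi / (y + 1)"
    using sq_int_cnj[OF s(1)] unfolding s(2) by simp_all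
  have v: "hline v y t = hline w y t * cnj (?e t)" for t unfolding eq by simp
  show "integrable lborel (hline v y)"
    unfolding v by (rule sq_int_mult_integrable(1)[OF H2_sq_int[OF w y] se(1)])
  have "(LINT t|lborel. cmod (hline v y t)) \<le> sqrt (l2sq (hline w y)) * sqrt (pi / (y + 1))"
    using sq_int_cauchy_schwarz[OF H2_sq_int[OF w y] se(1)] unfolding v se(2) norm_mult complex_mod_cnj .
  also have "\<dots> \<le> h2_norm w * sqrt (pi / (y + 1))"
    using y by (intro mult_right_mono sqrt_l2sq_le_h2_norm w) auto
  finally show "(LINT t|lborel. cmod (hline v y t)) \<le> h2_norm w * sqrt (pi / (y + 1))" .
qed

text \<open>With \<open>w = (z + \<i>) v\<close> in \<open>H2\<close>, \<open>v\<close> is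
  integrable on every line. The integral does not depend on the height, and its modulus tends to 0
  as the height tends to infinity.\<close>

lemma H2_integral_zero:
  assumes v: "v \<in> H2" "(\<lambda>z. z * v z) \<in> H2" and y: "y > 0"
  shows "integrable lborel (hline v y)" "(LINT t|lborel. hline v y t) = 0"
proof -
  define w where "w = (\<lambda>z. 1 * (z * v z) + \<i> * v z)"
  have w: "w \<in> H2" unfolding w_def by (rule H2_lin[OF v(2,1)])
  have eq: "hline v y t = hline w y t * (1 / (Complex t y + \<i>))" if "y > 0" for t y
  proof -
    have "Complex t y + \<i> \<noteq> 0" using that by (auto simp: complex_eq_iff)
    moreover have "hline w y t = hline v y t * (Complex t y + \<i>)" unfolding w_def by (simp add: algebra_simps)
    ultimately show ?thesis by simp
  qed
  note b = integrable_bound_by_H2[OF w eq]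
  show "integrable lborel (hline v y)" using b y by blast
  have shift: "(LINT t|lborel. hline v y t) = (LINT t|lborel. hline v \<eta> t)" if "\<eta> \<ge> y" for \<eta>
  proof (rule line_integral_shift[where \<alpha> = 0 and \<beta> = "\<eta> + 1" and C = "h2_norm w * sqrt pi"])
    show "v holomorphic_on {z. 0 < Im z \<and> Im z < \<eta> + 1}"
      by (rule holomorphic_on_subset[OF H2_holomorphic[OF v(1)]]) (auto simp: upper_half_plane_def)
    show "(LINT t|lborel. cmod (hline v x t)) \<le> h2_norm w * sqrt pi" if "0 < x" "x < \<eta> + 1" for x
    proof -
      have "sqrt (pi / (x + 1)) \<le> sqrt pi" using that by (simp add: field_simps)
      hence "h2_norm w * sqrt (pi / (x + 1)) \<le> h2_norm w * sqrt pi"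
        by (intro mult_left_mono h2_norm_nonneg w)
      thus ?thesis by (rule order_trans[OF b(2)[OF that(1) that(1)]])
    qed
  qed (use b y that in auto)
  have "((\<lambda>\<eta>::real. h2_norm w * sqrt (pi / (\<eta> + 1))) \<longlongrightarrow> h2_norm w * sqrt 0) at_top"
    by (intro tendsto_intros tendsto_divide_0[OF tendsto_const] filterlim_at_top_imp_at_infinity
        filterlim_tendsto_add_at_top[OF tendsto_const, of _ _ 1, unfolded add.commute[of 1]] filterlim_ident)
  hence "cmod (LINT t|lborel. hline v y t) \<le> h2_norm w * sqrt 0"
  proof (rule tendsto_lowerbound)
    show "\<forall>\<^sub>F \<eta> in at_top. cmod (LINT t|lborel. hline v y t) \<le> h2_norm w * sqrt (pi / (\<eta> + 1))"
      using eventually_ge_at_top[of y]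
    proof eventually_elim
      case (elim \<eta>)
      have "cmod (LINT t|lborel. hline v \<eta> t) \<le> (LINT t|lborel. cmod (hline v \<eta> t))" by (rule integral_norm_bound)
      moreover have "0 < \<eta>" using elim y by simp
      ultimately show ?case unfolding shift[OF elim] using b(2)[of \<eta>] order_trans by blast
    qed
  qed simp
  thus "(LINT t|lborel. hline v y t) = 0" by simp
qed

section \<open>The Szego kernel and its reproducing property\<close>

definition szego :: "complex \<Rightarrow> complex \<Rightarrow> complex" where
  "szego w = (\<lambda>z. if Im z > 0 then (\<i> / (2 * pi)) / (z - cnj w) else 0)"

lemma szego_norm_line:
  assumes "y > 0"
  shows "(cmod (szego w (Complex t y)))\<^sup>2 = 1 / (4 * pi\<^sup>2) * (1 / ((t - Re w)\<^sup>2 + (y + Im w)\<^sup>2))"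
  using assms by (simp add: szego_def norm_divide norm_mult power_divide power_mult_distrib cmod_power2)

lemma szego_H2: assumes w: "Im w > 0" shows "szego w \<in> H2"
proof (rule H2_dominated)
  have "z \<noteq> cnj w" if "Im z > 0" for z using that w by auto
  hence "(\<lambda>z. (\<i> / (2 * pi)) / (z - cnj w)) holomorphic_on upper_half_plane"
    by (intro holomorphic_intros) (auto simp: upper_half_plane_def)
  thus "szego w holomorphic_on upper_half_plane"
    by (rule holomorphic_transform) (simp add: szego_def upper_half_plane_def)
  show "integrable lborel (\<lambda>t. 1 / (4 * pi\<^sup>2) * (1 / ((t - Re w)\<^sup>2 + (Im w)\<^sup>2)))"
    using integral_inverse_square_shift(1)[OF w] by (rule integrable_mult_right)
  fix t y :: real assume y: "y > 0"
  have "0 < (t - Re w)\<^sup>2 + (Im w)\<^sup>2" using w by (simp add: add_nonneg_pos)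
  moreover have "(Im w)\<^sup>2 \<le> (y + Im w)\<^sup>2" using w y by (intro power_mono) auto
  ultimately show "(cmod (szego w (Complex t y)))\<^sup>2 \<le> 1 / (4 * pi\<^sup>2) * (1 / ((t - Re w)\<^sup>2 + (Im w)\<^sup>2))"
    unfolding szego_norm_line[OF y] by (intro mult_left_mono divide_left_mono) auto
qed (simp add: szego_def)

lemma szego_self:
  assumes w: "Im w > 0"
  shows "szego w w = of_real (1 / (4 * pi * Im w))" "h2_inner (szego w) (szego w) = szego w w"
proof -
  have e: "w - cnj w = 2 * \<i> * of_real (Im w)" by (simp add: complex_eq_iff)
  have "szego w w = (\<i> / (2 * pi)) / (2 * \<i> * of_real (Im w))" unfolding szego_def e using w by simp
  thus 1: "szego w w = of_real (1 / (4 * pi * Im w))" using w by simp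
  have l: "l2sq (hline (szego w) y) = 1 / (4 * pi\<^sup>2) * (pi / (y + Im w))" if "y > 0" for y
    unfolding l2sq_def szego_norm_line[OF that]
    using integral_inverse_square_shift(2)[of "y + Im w" "Re w"] w that
    by (simp only: Bochner_Integration.integral_mult_right_zero add_pos_pos)
  have "((\<lambda>y. 1 / (4 * pi\<^sup>2) * (pi / (y + Im w))) \<longlongrightarrow> 1 / (4 * pi\<^sup>2) * (pi / (0 + Im w))) (at_right 0)"
    using w by (intro tendsto_intros) auto
  moreover have "\<forall>\<^sub>F y in at_right 0. 1 / (4 * pi\<^sup>2) * (pi / (y + Im w)) = l2sq (hline (szego w) y)"
    using eventually_at_right_pos by eventually_elim (simp add: l)
  ultimately have "((\<lambda>y. l2sq (hline (szego w) y)) \<longlongrightarrow> 1 / (4 * pi\<^sup>2) * (pi / (0 + Im w))) (at_right 0)"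
    using tendsto_cong by fast
  hence "(h2_norm (szego w))\<^sup>2 = 1 / (4 * pi\<^sup>2) * (pi / (0 + Im w))"
    using tendsto_unique[OF _ l2sq_tendsto_h2_norm[OF szego_H2[OF w]]] by simp
  also have "\<dots> = 1 / (4 * pi * Im w)" by (simp add: power2_eq_square)
  finally show "h2_inner (szego w) (szego w) = szego w w"
    unfolding 1 h2_inner_self[OF szego_H2[OF w]] by simp
qed

text \<open>Write \<open>u = (z - p) v\<close>. At height \<open>y\<close> one has
  \<open>z - p = (cnj z - p) + 2 \<i> y\<close>: the first summand cancels the denominator of the
  conjugated kernel and leaves a multiple of the integral of \<open>v\<close>, which is 0; the
  second carries the factor \<open>y\<close> and disappears in the limit.\<close>

lemma h2_inner_szego_zero:
  assumes u: "u \<in> H2" and p: "Im p > 0" and zero: "u p = 0"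
  shows "h2_inner u (szego p) = 0"
proof (rule h2_inner_eqI[OF u szego_H2[OF p]])
  obtain v where v: "v \<in> H2" "\<And>z. Im z > 0 \<Longrightarrow> (z - p) * v z = u z"
    using H2_divide_upper[OF u p zero] by metis
  have "(\<lambda>z. z * v z) = (\<lambda>z. 1 * u z + p * v z)"
  proof
    fix z show "z * v z = 1 * u z + p * v z"
      using v(2)[of z] H2_vanish[OF v(1), of z] H2_vanish[OF u, of z] by (cases "Im z > 0") (auto simp: algebra_simps)
  qed
  hence zv: "(\<lambda>z. z * v z) \<in> H2" using H2_lin[OF u v(1), of 1 p] by simp
  have e: "l2ip (hline u y) (hline (szego p) y) = 2 * \<i> * of_real y * l2ip (hline v y) (hline (szego p) y)" if y: "y > 0" for y
  proof -
    have "hline u y t * cnj (hline (szego p) y t) = (- \<i> / (2 * pi)) * hline v y t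
        + 2 * \<i> * of_real y * (hline v y t * cnj (hline (szego p) y t))" for t
    proof -
      let ?z = "Complex t y"
      have c: "cnj (szego p ?z) = (- \<i> / (2 * pi)) / (cnj ?z - p)" using y by (simp add: szego_def)
      have ne: "cnj ?z - p \<noteq> 0" using y p by (auto simp: complex_eq_iff)
      have zz: "?z - p = (cnj ?z - p) + 2 * \<i> * of_real y" by (simp add: complex_eq_iff)
      have "u ?z = ((cnj ?z - p) + 2 * \<i> * of_real y) * v ?z" using v(2)[of ?z] y zz by simp
      have alg: "(d + e) * x * (A / d) = A * x + e * (x * (A / d))" if "d \<noteq> 0" for d e x A :: complex
        using that by (simp add: field_simps)
      show ?thesis unfolding c \<open>u ?z = _\<close> by (rule alg[OF ne])
    qed
    hence "l2ip (hline u y) (hline (szego p) y) = (LINT t|lborel. (- \<i> / (2 * pi)) * hline v y t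
        + 2 * \<i> * of_real y * (hline v y t * cnj (hline (szego p) y t)))" unfolding l2ip_def by simp
    also have "\<dots> = (- \<i> / (2 * pi)) * (LINT t|lborel. hline v y t) + 2 * \<i> * of_real y * l2ip (hline v y) (hline (szego p) y)"
      unfolding l2ip_def using H2_integral_zero(1)[OF v(1) zv y]
        sq_int_mult_integrable(1)[OF H2_sq_int[OF v(1) y] H2_sq_int[OF szego_H2[OF p] y]]
      by (subst Bochner_Integration.integral_add) auto
    finally show ?thesis using H2_integral_zero(2)[OF v(1) zv y] by simp
  qed
  have "((\<lambda>y. 2 * \<i> * of_real y * l2ip (hline v y) (hline (szego p) y)) \<longlongrightarrow> 2 * \<i> * of_real 0 * h2_inner v (szego p)) (at_right 0)"
    by (intro tendsto_intros h2_inner_tendsto v szego_H2 p)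
  moreover have "\<forall>\<^sub>F y in at_right 0. 2 * \<i> * of_real y * l2ip (hline v y) (hline (szego p) y) = l2ip (hline u y) (hline (szego p) y)"
    using eventually_at_right_pos by eventually_elim (simp add: e)
  ultimately show "((\<lambda>y. l2ip (hline u y) (hline (szego p) y)) \<longlongrightarrow> 0) (at_right 0)"
    using tendsto_cong by force
qed

text \<open>Subtracting the multiple of \<open>szego p\<close> with the same value at
  \<open>p\<close> reduces the claim to functions vanishing at \<open>p\<close> and to the kernel
  itself, whose norm is explicit.\<close>

lemma szego_reproducing:
  assumes f: "f \<in> H2" and p: "Im p > 0" shows "h2_inner f (szego p) = f p"
proof -
  define c where "c = f p / szego p p"
  have s: "szego p p \<noteq> 0" using szego_self(1)[OF p] p by simp
  have "h2_inner (\<lambda>z. 1 * f z + (-c) * szego p z) (szego p) = 0"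
    by (rule h2_inner_szego_zero[OF H2_lin[OF f szego_H2[OF p]] p]) (use s in \<open>simp add: c_def\<close>)
  thus ?thesis
    unfolding h2_inner_lin_left[OF f szego_H2[OF p] szego_H2[OF p]] szego_self(2)[OF p] using s by (simp add: c_def)
qed

lemma h2_norm_zero_imp:
  assumes "f \<in> H2" "h2_norm f = 0" shows "f = (\<lambda>z. 0)"
proof -
  have "f z = 0" if "z \<in> upper_half_plane" for z
    using h2_cauchy_schwarz[OF assms(1) szego_H2[of z]] szego_reproducing[OF assms(1), of z] assms(2) that
    by (simp add: upper_half_plane_def)
  thus ?thesis using H2_eq_iff[OF assms(1) H2_zero] by simp
qed

section \<open>Limits at the boundary under a vanishing weight\<close>

lemma dominated_convergence_at_right:
  fixes s :: "real \<Rightarrow> real \<Rightarrow> real"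
  assumes meas: "\<And>y. y > 0 \<Longrightarrow> s y \<in> borel_measurable lborel" and w: "integrable lborel w"
    and lim: "AE t in lborel. ((\<lambda>y. s y t) \<longlongrightarrow> 0) (at_right 0)"
    and bd: "\<And>y t. y > 0 \<Longrightarrow> \<bar>s y t\<bar> \<le> w t"
  shows "((\<lambda>y. LINT t|lborel. s y t) \<longlongrightarrow> 0) (at_right 0)"
proof -
  \<comment> \<open>After the substitution \<open>y = inverse x\<close> measurability is required
    for every real \<open>x\<close>, so the family is extended by 0 to heights that are not
    positive.\<close>
  define s' where "s' y = (if y > 0 then s y else (\<lambda>_. 0))" for y :: real
  have "((\<lambda>x. LINT t|lborel. s' (inverse x) t) \<longlongrightarrow> (LINT (t::real)|lborel. (0::real))) at_top"
  proof (rule integral_dominated_convergence_at_top[where w = w])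
    show "AE t in lborel. ((\<lambda>x. s' (inverse x) t) \<longlongrightarrow> 0) at_top"
      using lim
    proof eventually_elim
      case (elim t)
      have "((\<lambda>y. s' y t) \<longlongrightarrow> 0) (at_right 0)"
        by (rule Lim_transform_eventually[OF elim])
          (use eventually_at_right_pos in \<open>eventually_elim, simp add: s'_def\<close>)
      thus ?case by (simp add: filterlim_at_right_to_top)
    qed
    show "\<forall>\<^sub>F x in at_top. AE t in lborel. norm (s' (inverse x) t) \<le> w t"
      using eventually_gt_at_top[of 0] by eventually_elim (auto simp: s'_def bd)
  qed (use meas w in \<open>auto simp: s'_def\<close>)
  hence "((\<lambda>y. LINT t|lborel. s' y t) \<longlongrightarrow> 0) (at_right 0)"
    by (simp add: filterlim_at_right_to_top)
  thus ?thesis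
    by (rule Lim_transform_eventually) (use eventually_at_right_pos in \<open>eventually_elim, simp add: s'_def\<close>)
qed

lemma weighted_line_tendsto_zero:
  fixes m :: "real \<Rightarrow> real \<Rightarrow> real"
  assumes f: "f \<in> H2" and y0: "y0 > 0"
    and m: "\<And>y. y > 0 \<Longrightarrow> m y \<in> borel_measurable lborel"
      "\<And>y t. y > 0 \<Longrightarrow> 0 \<le> m y t" "\<And>y t. y > 0 \<Longrightarrow> m y t \<le> 1"
    and lim: "AE t in lborel. ((\<lambda>y. m y t) \<longlongrightarrow> 0) (at_right 0)"
  shows "((\<lambda>y. LINT t|lborel. m y t * msq f y0 t) \<longlongrightarrow> 0) (at_right 0)"
proof (rule dominated_convergence_at_right)
  show "integrable lborel (msq f y0)" using H2_sq_int[OF f y0] by (simp add: sq_int_def)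
  show "AE t in lborel. ((\<lambda>y. m y t * msq f y0 t) \<longlongrightarrow> 0) (at_right 0)"
    using lim by eventually_elim (intro tendsto_mult_left_zero)
  show "\<bar>m y t * msq f y0 t\<bar> \<le> msq f y0 t" if "y > 0" for y t
    using m that by (auto simp: abs_mult intro!: mult_left_le_one_le)
  show "(\<lambda>t. m y t * msq f y0 t) \<in> borel_measurable lborel" if "y > 0" for y
    using m(1)[OF that] H2_sq_int[OF f y0] unfolding sq_int_def by auto
qed

text \<open>When the weight and the function both move with \<open>y\<close>, no dominating function
  is at hand. Replacing the function at height \<open>y\<close> by the one at a fixed height
  \<open>y0\<close> costs only \<open>2 * \<delta>\<close> and leaves an integral to which dominated
  convergence applies.\<close>

lemma weighted_norm_le:
  assumes f: "f \<in> H2" and m: "m \<in> borel_measurable lborel" "\<And>t. 0 \<le> m t" "\<And>t. m t \<le> 1" and y: "y > 0" "y0 > 0"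
    and d: "l2sq (\<lambda>t. f (Complex t y) - f (Complex t y0)) \<le> \<delta>"
  shows "(LINT t|lborel. m t * msq f y t)
      \<le> 2 * \<delta> + 2 * (LINT t|lborel. m t * msq f y0 t)"
proof -
  have i: "integrable lborel (\<lambda>t. m t * msq f x t)" if "x > 0" for x
    by (rule Bochner_Integration.integrable_bound[of _ "\<lambda>t. msq f x t"])
      (use H2_sq_int[OF f that] m in \<open>auto simp: sq_int_def abs_mult intro!: mult_left_le_one_le\<close>)
  have sd: "sq_int (\<lambda>t. 1 * f (Complex t y) + (-1) * f (Complex t y0))"
    by (intro sq_int_lin H2_sq_int f y)
  hence id: "integrable lborel (\<lambda>t. (cmod (f (Complex t y) - f (Complex t y0)))\<^sup>2)"
    by (simp add: sq_int_def)
  have "(LINT t|lborel. m t * msq f y t)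
     \<le> (LINT t|lborel. 2 * (cmod (f (Complex t y) - f (Complex t y0)))\<^sup>2 + 2 * (m t * msq f y0 t))"
  proof (rule integral_mono[OF i[OF y(1)]])
    fix t
    let ?a = "f (Complex t y)" and ?b = "f (Complex t y0)"
    have "m t * (cmod ?a)\<^sup>2 \<le> m t * (2 * (cmod (?a - ?b))\<^sup>2 + 2 * (cmod ?b)\<^sup>2)"
      using cmod_sum_squared_le[of "?a - ?b" ?b] m(2) by (intro mult_left_mono) auto
    also have "\<dots> \<le> 1 * (2 * (cmod (?a - ?b))\<^sup>2) + 2 * (m t * (cmod ?b)\<^sup>2)"
      unfolding distrib_left using mult_right_mono[OF m(3), of "2 * (cmod (?a - ?b))\<^sup>2" t] by simp
    finally show "m t * (cmod ?a)\<^sup>2 \<le> 2 * (cmod (?a - ?b))\<^sup>2 + 2 * (m t * (cmod ?b)\<^sup>2)" by simp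
  qed (use id i[OF y(2)] in auto)
  also have "\<dots> = 2 * l2sq (\<lambda>t. f (Complex t y) - f (Complex t y0)) + 2 * (LINT t|lborel. m t * msq f y0 t)"
    using id i[OF y(2)] by (simp add: l2sq_def)
  finally show ?thesis using d by simp
qed

lemma weighted_norm_tendsto_zero:
  assumes f: "f \<in> H2" and m: "\<And>y. y > 0 \<Longrightarrow> m y \<in> borel_measurable lborel"
      "\<And>y t. y > 0 \<Longrightarrow> 0 \<le> m y t" "\<And>y t. y > 0 \<Longrightarrow> m y t \<le> (1::real)"
    and lim: "\<And>t. ((\<lambda>y. m y t) \<longlongrightarrow> 0) (at_right 0)"
  shows "((\<lambda>y. LINT t|lborel. m y t * msq f y t) \<longlongrightarrow> 0) (at_right 0)"
proof (rule tendstoI)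
  fix e :: real assume e: "e > 0"
  obtain y0 where y0: "y0 > 0" "\<And>y. 0 < y \<Longrightarrow> y \<le> y0 \<Longrightarrow> l2sq (\<lambda>t. f (Complex t y) - f (Complex t y0)) < e / 4"
    using H2_line_cauchy[OF f, of "e / 4"] e by auto
  have "((\<lambda>y. LINT t|lborel. m y t * msq f y0 t) \<longlongrightarrow> 0) (at_right 0)"
    by (rule weighted_line_tendsto_zero[OF f y0(1) m]) (auto intro: lim)
  hence "\<forall>\<^sub>F y in at_right 0. (LINT t|lborel. m y t * msq f y0 t) < e / 4"
    using e by (intro order_tendstoD(2)) auto
  moreover have "\<forall>\<^sub>F y in at_right 0. y \<le> y0" using eventually_at_right_le[OF y0(1)] by (auto elim: eventually_mono)
  ultimately show "\<forall>\<^sub>F y in at_right 0. dist (LINT t|lborel. m y t * msq f y t) 0 < e"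
    using eventually_at_right_pos
  proof eventually_elim
    case (elim y)
    have "(LINT t|lborel. m y t * msq f y t) \<le> 2 * (e / 4) + 2 * (LINT t|lborel. m y t * msq f y0 t)"
      using elim y0(1) by (intro weighted_norm_le f m less_imp_le[OF y0(2)]) auto
    moreover have "0 \<le> (LINT t|lborel. m y t * msq f y t)"
      using m elim by (intro Bochner_Integration.integral_nonneg) auto
    ultimately show ?case using elim by (simp add: dist_real_def)
  qed
qed

text \<open>On the line at height \<open>y\<close> the factor \<open>z - cnj z\<close> is
  \<open>2 \<i> y\<close>, so the two pairings differ by a convergent quantity times
  \<open>y\<close>.\<close>

lemma mult_z_H2_symmetric:
  assumes f: "f \<in> H2" "mult_z f \<in> H2" and p: "p \<in> H2" "mult_z p \<in> H2"
  shows "h2_inner (mult_z f) p = h2_inner f (mult_z p)"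
proof -
  have e: "l2ip (hline (mult_z f) y) (hline p y) - l2ip (hline f y) (hline (mult_z p) y)
      = 2 * \<i> * of_real y * l2ip (hline f y) (hline p y)" if y: "y > 0" for y
  proof -
    have "l2ip (hline (mult_z f) y) (hline p y) - l2ip (hline f y) (hline (mult_z p) y)
      = (LINT t|lborel. hline (mult_z f) y t * cnj (hline p y t) - hline f y t * cnj (hline (mult_z p) y t))"
      unfolding l2ip_def using f p y by (intro Bochner_Integration.integral_diff[symmetric] sq_int_mult_integrable H2_sq_int)
    also have "\<dots> = (LINT t|lborel. 2 * \<i> * of_real y * (hline f y t * cnj (hline p y t)))"
    proof (intro Bochner_Integration.integral_cong refl)
      fix t
      have "Complex t y - cnj (Complex t y) = 2 * \<i> * of_real y" by (simp add: complex_eq_iff)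
      thus "hline (mult_z f) y t * cnj (hline p y t) - hline f y t * cnj (hline (mult_z p) y t)
          = 2 * \<i> * of_real y * (hline f y t * cnj (hline p y t))"
        unfolding mult_z_def by (metis (no_types, opaque_lifting) complex_cnj_mult left_diff_distrib mult.assoc mult.left_commute)
    qed
    finally show ?thesis unfolding l2ip_def by simp
  qed
  have lim: "((\<lambda>y. l2ip (hline (mult_z f) y) (hline p y) - l2ip (hline f y) (hline (mult_z p) y))
      \<longlongrightarrow> h2_inner (mult_z f) p - h2_inner f (mult_z p)) (at_right 0)"
    by (intro tendsto_diff h2_inner_tendsto f p)
  have "((\<lambda>y. 2 * \<i> * of_real y * l2ip (hline f y) (hline p y)) \<longlongrightarrow> 2 * \<i> * of_real 0 * h2_inner f p) (at_right 0)"
    by (intro tendsto_intros h2_inner_tendsto f p)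
  moreover have "\<forall>\<^sub>F y in at_right 0. 2 * \<i> * of_real y * l2ip (hline f y) (hline p y)
      = l2ip (hline (mult_z f) y) (hline p y) - l2ip (hline f y) (hline (mult_z p) y)"
    using eventually_at_right_pos by eventually_elim (simp add: e)
  ultimately have "((\<lambda>y. l2ip (hline (mult_z f) y) (hline p y) - l2ip (hline f y) (hline (mult_z p) y))
      \<longlongrightarrow> 2 * \<i> * of_real 0 * h2_inner f p) (at_right 0)"
    by (rule Lim_transform_eventually)
  from tendsto_unique[OF _ lim this] show ?thesis by simp
qed

text \<open>With \<open>g' = h / (z - c + \<i> \<epsilon>)\<close> one has
  \<open>h = (z - c) g' + \<i> \<epsilon> g'\<close>. Smallness of the last term says that
  \<open>h\<close> is a norm limit of multiples of \<open>z - c\<close>. Its squared modulus is at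
  most that of \<open>h\<close> times
  \<open>\<epsilon>^2 / ((t - c)^2 + \<epsilon>^2)\<close>.\<close>

lemma H2_approx_unit:
  assumes h: "h \<in> H2" and \<delta>: "\<delta> > 0"
  obtains \<epsilon> where "\<epsilon> > 0" "(h2_norm (\<lambda>z. (\<i> * of_real \<epsilon>) * (1 / (z - Complex c (- \<epsilon>)) * h z)))\<^sup>2 \<le> \<delta>"
proof -
  define w where "w \<epsilon> = (\<lambda>z. (\<i> * of_real \<epsilon>) * (1 / (z - Complex c (- \<epsilon>)) * h z))" for \<epsilon>
  have n: "(cmod (w \<epsilon> (Complex t y)))\<^sup>2 = \<epsilon>\<^sup>2 / ((t - c)\<^sup>2 + (y + \<epsilon>)\<^sup>2) * msq h y t" if "\<epsilon> > 0" for \<epsilon> t y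
    unfolding w_def norm_mult power_mult_distrib cmod_inverse_diff_squared by simp
  have wH: "w \<epsilon> \<in> H2" if "\<epsilon> > 0" for \<epsilon>
    unfolding w_def using that by (intro H2_scale H2_divide_lower h) simp
  obtain y0 where y0: "y0 > 0" "\<And>y. 0 < y \<Longrightarrow> y \<le> y0 \<Longrightarrow> l2sq (\<lambda>t. h (Complex t y) - h (Complex t y0)) < \<delta> / 4"
    using H2_line_cauchy[OF h, of "\<delta> / 4"] \<delta> by auto
  define m where "m \<epsilon> t = \<epsilon>\<^sup>2 / ((t - c)\<^sup>2 + \<epsilon>\<^sup>2)" for \<epsilon> t :: real
  have m01: "0 \<le> m \<epsilon> t" "m \<epsilon> t \<le> 1" for \<epsilon> t
  proof -
    show "0 \<le> m \<epsilon> t" unfolding m_def by (intro divide_nonneg_nonneg add_nonneg_nonneg) auto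
    have "(t - c)\<^sup>2 + \<epsilon>\<^sup>2 \<ge> 0" by (intro add_nonneg_nonneg) auto
    hence "(t - c)\<^sup>2 + \<epsilon>\<^sup>2 = 0 \<or> (t - c)\<^sup>2 + \<epsilon>\<^sup>2 > 0" by linarith
    thus "m \<epsilon> t \<le> 1" unfolding m_def by (auto simp: divide_le_eq_1)
  qed
  have mm [measurable]: "m \<epsilon> \<in> borel_measurable lborel" for \<epsilon> unfolding m_def by measurable
  have "((\<lambda>\<epsilon>. LINT t|lborel. m \<epsilon> t * msq h y0 t) \<longlongrightarrow> 0) (at_right 0)"
  proof (rule weighted_line_tendsto_zero[OF h y0(1) mm m01])
    \<comment> \<open>At \<open>t = c\<close> the weight is 1 for every positive
      \<open>\<epsilon>\<close>, which is why convergence is only almost everywhere.\<close>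
    have "((\<lambda>\<epsilon>. m \<epsilon> t) \<longlongrightarrow> 0) (at_right 0)" if "t \<noteq> c" for t
    proof -
      have "((\<lambda>\<epsilon>. m \<epsilon> t) \<longlongrightarrow> 0\<^sup>2 / ((t - c)\<^sup>2 + 0\<^sup>2)) (at_right 0)"
        unfolding m_def using that by (intro tendsto_intros) auto
      thus ?thesis by simp
    qed
    thus "AE t in lborel. ((\<lambda>\<epsilon>. m \<epsilon> t) \<longlongrightarrow> 0) (at_right 0)"
      using AE_lborel_singleton[of c] by (auto elim!: eventually_mono)
  qed
  hence "\<forall>\<^sub>F \<epsilon> in at_right 0. (LINT t|lborel. m \<epsilon> t * msq h y0 t) < \<delta> / 4"
    using \<delta> by (intro order_tendstoD(2)) auto
  hence "\<forall>\<^sub>F \<epsilon> in at_right 0. (LINT t|lborel. m \<epsilon> t * msq h y0 t) < \<delta> / 4 \<and> \<epsilon> > 0"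
    using eventually_at_right_pos by (rule eventually_conj)
  then obtain \<epsilon> where \<epsilon>: "(LINT t|lborel. m \<epsilon> t * msq h y0 t) < \<delta> / 4" "\<epsilon> > 0"
    using eventually_happens by (metis (no_types, lifting) trivial_limit_at_right_real)
  have "(h2_norm (w \<epsilon>))\<^sup>2 \<le> \<delta>"
  proof (rule tendsto_upperbound[OF l2sq_tendsto_h2_norm[OF wH[OF \<epsilon>(2)]]])
    have "\<forall>\<^sub>F y in at_right 0. y \<le> y0" using eventually_at_right_le[OF y0(1)] by (auto elim: eventually_mono)
    thus "\<forall>\<^sub>F y in at_right 0. l2sq (hline (w \<epsilon>) y) \<le> \<delta>"
      using eventually_at_right_pos
    proof eventually_elim
      case (elim y)
      have i: "integrable lborel (\<lambda>t. msq h y t)" using H2_sq_int[OF h elim(2)] by (simp add: sq_int_def)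
      have "l2sq (hline (w \<epsilon>) y) \<le> (LINT t|lborel. m \<epsilon> t * msq h y t)"
        unfolding l2sq_def
      proof (rule integral_mono)
        show "integrable lborel (\<lambda>t. (cmod (w \<epsilon> (Complex t y)))\<^sup>2)"
          using H2_sq_int[OF wH[OF \<epsilon>(2)] elim(2)] by (simp add: sq_int_def)
        show "integrable lborel (\<lambda>t. m \<epsilon> t * msq h y t)"
          by (rule Bochner_Integration.integrable_bound[OF i])
            (use H2_sq_int[OF h elim(2)] m01 in \<open>auto simp: sq_int_def abs_mult intro!: mult_left_le_one_le\<close>)
        show "(cmod (w \<epsilon> (Complex t y)))\<^sup>2 \<le> m \<epsilon> t * msq h y t" for t
        proof -
          have "0 < (t - c)\<^sup>2 + \<epsilon>\<^sup>2" using \<epsilon>(2) by (simp add: add_nonneg_pos)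
          moreover have "\<epsilon>\<^sup>2 \<le> (y + \<epsilon>)\<^sup>2" using \<epsilon>(2) elim by (intro power_mono) auto
          ultimately show ?thesis
            unfolding n[OF \<epsilon>(2)] m_def by (intro mult_right_mono divide_left_mono) auto
        qed
      qed
      also have "\<dots> \<le> 2 * (\<delta> / 4) + 2 * (LINT t|lborel. m \<epsilon> t * msq h y0 t)"
        using elim y0(1) m01 by (intro weighted_norm_le h mm less_imp_le[OF y0(2)]) auto
      finally show ?case using \<epsilon>(1) by simp
    qed
  qed simp
  with \<epsilon>(2) show ?thesis using that unfolding w_def by blast
qed

section \<open>The model space and Green's formula\<close>

text \<open>Both regimes are dominated, uniformly in the height, by
  \<open>2 A^2 r^2 / ((t - c)^2 + r^2)\<close>, whose integral is \<open>2 pi r A^2\<close>. The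
  norm bound is proportional to \<open>A\<close>, so Lipschitz estimates in supremum turn into
  Lipschitz estimates in norm.\<close>

lemma H2_decay_bound:
  fixes c r A :: real
  assumes holo: "f holomorphic_on upper_half_plane" and van: "\<And>z. Im z \<le> 0 \<Longrightarrow> f z = 0" and r: "r > 0" and A: "A \<ge> 0"
    and near: "\<And>z. Im z > 0 \<Longrightarrow> cmod (z - c) \<le> r \<Longrightarrow> cmod (f z) \<le> A"
    and far: "\<And>z. Im z > 0 \<Longrightarrow> r \<le> cmod (z - c) \<Longrightarrow> cmod (f z) \<le> A * r / cmod (z - c)"
  shows "f \<in> H2" "(h2_norm f)\<^sup>2 \<le> 2 * pi * r * A\<^sup>2"
proof -
  let ?v = "\<lambda>t. 2 * A\<^sup>2 * r\<^sup>2 * (1 / ((t - c)\<^sup>2 + r\<^sup>2))"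
  have v: "integrable lborel ?v" using integral_inverse_square_shift(1)[OF r] by (rule integrable_mult_right)
  have le: "msq f y t \<le> ?v t" if y: "y > 0" for t y
  proof -
    have pos: "(t - c)\<^sup>2 + r\<^sup>2 > 0" using r by (simp add: add_nonneg_pos)
    have d: "(cmod (Complex t y - c))\<^sup>2 = (t - c)\<^sup>2 + y\<^sup>2" by (simp add: cmod_power2)
    show ?thesis
    proof (cases "cmod (Complex t y - c) \<le> r")
      case True
      hence "(cmod (Complex t y - c))\<^sup>2 \<le> r\<^sup>2" by (intro power_mono) auto
      hence "(t - c)\<^sup>2 + r\<^sup>2 \<le> 2 * r\<^sup>2" unfolding d using zero_le_power2[of y] by linarith
      hence "A\<^sup>2 * ((t - c)\<^sup>2 + r\<^sup>2) \<le> A\<^sup>2 * (2 * r\<^sup>2)" by (intro mult_left_mono) auto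
      hence "A\<^sup>2 \<le> ?v t" using pos by (simp add: field_simps)
      moreover have "msq f y t \<le> A\<^sup>2" using near[of "Complex t y"] True y by (intro power_mono) auto
      ultimately show ?thesis by linarith
    next
      case False
      let ?m = "cmod (Complex t y - c)"
      have m: "?m > 0" "r \<le> ?m" using False r by linarith+
      have "r\<^sup>2 \<le> ?m\<^sup>2" using m r by (intro power_mono) auto
      hence r2: "r\<^sup>2 \<le> (t - c)\<^sup>2 + y\<^sup>2" unfolding d .
      have aux: "A + R \<le> 2 * (A + Y)" if "R \<le> A + Y" "0 \<le> Y" for A R Y :: real using that by simp
      have "(t - c)\<^sup>2 + r\<^sup>2 \<le> 2 * ?m\<^sup>2" unfolding d by (rule aux[OF r2]) simp
      hence "(A * r)\<^sup>2 * ((t - c)\<^sup>2 + r\<^sup>2) \<le> (A * r)\<^sup>2 * (2 * ?m\<^sup>2)" by (intro mult_left_mono) auto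
      hence "(A * r / ?m)\<^sup>2 \<le> ?v t" using pos m(1) by (simp add: field_simps power_mult_distrib power_divide)
      moreover have "msq f y t \<le> (A * r / ?m)\<^sup>2" using far[of "Complex t y"] m(2) y by (intro power_mono) auto
      ultimately show ?thesis by linarith
    qed
  qed
  note * = H2_dominated[OF holo van v le]
  show "f \<in> H2" by (rule *(1))
  have "(LINT t|lborel. ?v t) = 2 * A\<^sup>2 * r\<^sup>2 * (pi / r)"
    by (simp only: Bochner_Integration.integral_mult_right_zero integral_inverse_square_shift(2)[OF r])
  also have "\<dots> = 2 * pi * r * A\<^sup>2" using r by (simp add: power2_eq_square)
  finally show "(h2_norm f)\<^sup>2 \<le> 2 * pi * r * A\<^sup>2" using *(2) by simp
qed

lemma mult_z_eqI:
  assumes "f \<in> H2" "g \<in> H2" "h \<in> H2" "\<And>z. Im z > 0 \<Longrightarrow> z * f z = a * g z + b * h z"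
  shows "mult_z f = (\<lambda>z. a * g z + b * h z)" "mult_z f \<in> H2"
proof -
  show 1: "mult_z f = (\<lambda>z. a * g z + b * h z)"
  proof
    fix z show "mult_z f z = a * g z + b * h z"
      using assms(4)[of z] H2_vanish[OF assms(1), of z] H2_vanish[OF assms(2), of z] H2_vanish[OF assms(3), of z]
      by (cases "Im z > 0") (auto simp: mult_z_def)
  qed
  show "mult_z f \<in> H2" unfolding 1 by (rule H2_lin[OF assms(2,3)])
qed

section \<open>Multiplication by \<open>F\<close> and the reproducing kernels\<close>

locale mero_inner =
  fixes F :: "complex \<Rightarrow> complex"
  assumes inner: "meromorphic_inner F"
    and nonconst: "\<not> (\<exists>c. \<forall>z\<in>upper_half_plane. F z = c)"
begin

abbreviation K where "K \<equiv> model_space F"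
abbreviation mulF where "mulF \<equiv> mult_fun F"

lemma F_holomorphic: "F holomorphic_on upper_half_plane"
  using inner unfolding meromorphic_inner_def by blast

lemma F_le_1: "Im z > 0 \<Longrightarrow> cmod (F z) \<le> 1"
  using inner unfolding meromorphic_inner_def upper_half_plane_def by blast

lemma F_real: "cmod (F (of_real x)) = 1"
  using inner unfolding meromorphic_inner_def by blast

lemma F_analytic: "F analytic_on {of_real x}"
  using inner unfolding meromorphic_inner_def by (meson Reals_of_real analytic_on_subset empty_subsetI insert_subset)

lemma F_lt_1: assumes z: "Im z > 0" shows "cmod (F z) < 1"
proof (rule ccontr)
  assume "\<not> cmod (F z) < 1"
  hence "cmod (F w) \<le> cmod (F z)" if "w \<in> upper_half_plane" for w
    using F_le_1[of w] that by (auto simp: upper_half_plane_def)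
  hence "F constant_on upper_half_plane"
    using z by (intro maximum_modulus_principle[OF F_holomorphic, where U = upper_half_plane and \<xi> = z])
      (auto simp: upper_half_plane_def intro!: convex_connected convex_halfspace_Im_gt open_halfspace_Im_gt)
  thus False using nonconst unfolding constant_on_def by blast
qed

lemma two_values:
  obtains w v where "Im w > 0" "Im v > 0" "F w \<noteq> F v"
  using nonconst unfolding upper_half_plane_def by blast

lemma mulF_H2: assumes "g \<in> H2" shows "mulF g \<in> H2"
proof -
  have "(\<lambda>z. F z * g z) \<in> H2" by (rule H2_mult_bounded[OF assms F_holomorphic F_le_1])
  moreover have "(\<lambda>z. F z * g z) = mulF g" unfolding mult_fun_def using H2_vanish[OF assms] by (auto simp: fun_eq_iff)
  ultimately show ?thesis by simp
qed

text \<open>\<open>F\<close> has modulus 1 on the real axis only. At height \<open>y\<close> the two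
  pairings differ by the weight \<open>1 - |F|^2\<close>, which lies between 0 and 1 and tends to 0
  at every \<open>t\<close> because \<open>F\<close> is continuous up to the axis.\<close>

lemma mulF_isometry:
  assumes f: "f \<in> H2" and g: "g \<in> H2" shows "h2_inner (mulF f) (mulF g) = h2_inner f g"
proof (rule h2_inner_eqI[OF mulF_H2[OF f] mulF_H2[OF g]])
  define m where "m y t = 1 - msq F y t" for y t :: real
  have mm [measurable]: "m y \<in> borel_measurable lborel" if "y > 0" for y
    using borel_measurable_horizontal_line[OF F_holomorphic, of y] that
    unfolding m_def by (auto simp: upper_half_plane_def)
  have m01: "0 \<le> m y t" "m y t \<le> 1" if "y > 0" for y t
    using F_le_1[of "Complex t y"] that unfolding m_def by (auto simp: power_le_one)
  have mlim: "((\<lambda>y. m y t) \<longlongrightarrow> 0) (at_right 0)" for t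
  proof -
    have "((\<lambda>y. Complex t y) \<longlongrightarrow> Complex t 0) (at_right 0)" by (intro tendsto_intros)
    moreover have "isCont F (of_real t)" using F_analytic[of t] analytic_at_imp_isCont by blast
    ultimately have "((\<lambda>y. F (Complex t y)) \<longlongrightarrow> F (of_real t)) (at_right 0)"
      by (intro isCont_tendsto_compose[where g = F]) (auto simp: complex_of_real_def)
    hence "((\<lambda>y. m y t) \<longlongrightarrow> 1 - (cmod (F (of_real t)))\<^sup>2) (at_right 0)" unfolding m_def by (intro tendsto_intros)
    thus ?thesis by (simp add: F_real)
  qed
  define E where "E h y = (LINT t|lborel. m y t * msq h y t)" for h :: "complex \<Rightarrow> complex" and y
  have E: "((\<lambda>y. E h y) \<longlongrightarrow> 0) (at_right 0)" if "h \<in> H2" for h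
    unfolding E_def using that mm m01 mlim by (intro weighted_norm_tendsto_zero) auto
  have Ei: "integrable lborel (\<lambda>t. m y t * msq h y t)" if "h \<in> H2" "y > 0" for h y
    by (rule Bochner_Integration.integrable_bound[of _ "\<lambda>t. msq h y t"])
      (use H2_sq_int[OF that] mm m01 that in \<open>auto simp: sq_int_def abs_mult intro!: mult_left_le_one_le\<close>)
  have d: "cmod (l2ip (hline f y) (hline g y) - l2ip (hline (mulF f) y) (hline (mulF g) y)) \<le> (E f y + E g y) / 2" if y: "y > 0" for y
  proof -
    note q = sq_int_mult_integrable(1)[OF H2_sq_int[OF f y] H2_sq_int[OF g y]]
    note qF = sq_int_mult_integrable(1)[OF H2_sq_int[OF mulF_H2[OF f] y] H2_sq_int[OF mulF_H2[OF g] y]]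
    have eq: "hline f y t * cnj (hline g y t) - hline (mulF f) y t * cnj (hline (mulF g) y t)
       = of_real (m y t) * (hline f y t * cnj (hline g y t))" for t
    proof -
      have "of_real (m y t) = 1 - F (Complex t y) * cnj (F (Complex t y))"
        unfolding m_def by (simp only: of_real_diff complex_norm_square of_real_1)
      moreover have "a * b - (x * a) * (x' * b) = (1 - x * x') * (a * b)" for a b x x' :: complex by (simp add: algebra_simps)
      ultimately show ?thesis using y by (simp add: mult_fun_def)
    qed
    have "l2ip (hline f y) (hline g y) - l2ip (hline (mulF f) y) (hline (mulF g) y)
      = (LINT t|lborel. of_real (m y t) * (hline f y t * cnj (hline g y t)))"
      unfolding l2ip_def Bochner_Integration.integral_diff[OF q qF, symmetric] eq ..
    also have "cmod \<dots> \<le> (LINT t|lborel. cmod (of_real (m y t) * (hline f y t * cnj (hline g y t))))"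
      by (rule integral_norm_bound)
    also have "\<dots> \<le> (LINT t|lborel. (m y t * msq f y t + m y t * msq g y t) / 2)"
    proof (rule integral_mono)
      show "integrable lborel (\<lambda>t. cmod (of_real (m y t) * (hline f y t * cnj (hline g y t))))"
        unfolding eq[symmetric] using q qF by (intro integrable_norm Bochner_Integration.integrable_diff)
      show "integrable lborel (\<lambda>t. (m y t * msq f y t + m y t * msq g y t) / 2)"
        using Ei[OF f y] Ei[OF g y] by auto
      fix t
      have "cmod (f (Complex t y)) * cmod (g (Complex t y)) \<le> (msq f y t + msq g y t) / 2"
        using sum_squares_bound[of "cmod (f (Complex t y))" "cmod (g (Complex t y))"] by simp
      hence "m y t * (cmod (f (Complex t y)) * cmod (g (Complex t y))) \<le> m y t * ((msq f y t + msq g y t) / 2)"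
        using m01(1)[OF y] by (intro mult_left_mono)
      thus "cmod (of_real (m y t) * (hline f y t * cnj (hline g y t))) \<le> (m y t * msq f y t + m y t * msq g y t) / 2"
        using m01(1)[OF y, of t] by (simp add: norm_mult distrib_left)
    qed
    also have "\<dots> = (E f y + E g y) / 2" unfolding E_def using Ei[OF f y] Ei[OF g y] by simp
    finally show ?thesis .
  qed
  have z: "((\<lambda>y. (E f y + E g y) / 2) \<longlongrightarrow> 0) (at_right 0)"
    using tendsto_divide[OF tendsto_add[OF E[OF f] E[OF g]] tendsto_const, of 2] by simp
  have "((\<lambda>y. l2ip (hline f y) (hline g y) - l2ip (hline (mulF f) y) (hline (mulF g) y)) \<longlongrightarrow> 0) (at_right 0)"
    by (rule Lim_null_comparison[OF eventually_mono[OF eventually_at_right_pos d] z])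
  from tendsto_diff[OF h2_inner_tendsto[OF f g] this]
  show "((\<lambda>y. l2ip (hline (mulF f) y) (hline (mulF g) y)) \<longlongrightarrow> h2_inner f g) (at_right 0)" by simp
qed

lemma h2_norm_mulF: "f \<in> H2 \<Longrightarrow> h2_norm (mulF f) = h2_norm f"
  unfolding h2_norm_def by (simp add: mulF_isometry)

lemma mulF_lin: "mulF (\<lambda>z. a * f z + b * g z) = (\<lambda>z. a * mulF f z + b * mulF g z)"
  by (auto simp: mult_fun_def fun_eq_iff algebra_simps)

lemma K_H2: "f \<in> K \<Longrightarrow> f \<in> H2" by (simp add: model_space_def)

lemma K_orth: "f \<in> K \<Longrightarrow> g \<in> H2 \<Longrightarrow> h2_inner f (mulF g) = 0" by (simp add: model_space_def)

lemma K_lin: assumes "f \<in> K" "g \<in> K" shows "(\<lambda>z. a * f z + b * g z) \<in> K"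
  using assms by (auto simp: model_space_def H2_lin h2_inner_lin_left mulF_H2)

lemma K_zero: "(\<lambda>z. 0) \<in> K" if "f \<in> K" for f
  using K_lin[OF that that, of 0 0] by simp

text \<open>One formula for the kernels at points of the half-plane and, at real \<open>w\<close>,
  for \<open>repr_kernel\<close>; comparing the two is then a matter of moving
  \<open>w\<close>.\<close>

definition ker :: "complex \<Rightarrow> complex \<Rightarrow> complex" where
  "ker w = (\<lambda>z. if Im z > 0 then (\<i> / (2 * pi)) * (1 - cnj (F w) * F z) / (z - cnj w) else 0)"

lemma ker_repr: "ker (of_real x) = repr_kernel F x"
  unfolding ker_def repr_kernel_def complex_cnj_complex_of_real ..

lemma ker_szego: "ker w = (\<lambda>z. 1 * szego w z + (- cnj (F w)) * mulF (szego w) z)"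
  unfolding ker_def szego_def mult_fun_def by (auto simp: fun_eq_iff diff_divide_distrib algebra_simps)

text \<open>The second term of \<open>ker_szego\<close> is the component of \<open>szego w\<close>
  in the range of \<open>mulF\<close>: pairing \<open>szego w\<close> with \<open>mulF g\<close>
  gives \<open>cnj (F w * g w)\<close>, which the isometry cancels against the second term.\<close>

lemma ker_K: assumes w: "Im w > 0" shows "ker w \<in> K"
proof -
  note s = szego_H2[OF w]
  have "ker w \<in> H2" unfolding ker_szego by (rule H2_lin[OF s mulF_H2[OF s]])
  moreover have "h2_inner (ker w) (mulF g) = 0" if g: "g \<in> H2" for g
  proof -
    have "h2_inner (szego w) (mulF g) = cnj (F w * g w)"
      using h2_inner_cnj[OF mulF_H2[OF g] s] szego_reproducing[OF mulF_H2[OF g] w] w by (simp add: mult_fun_def)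
    moreover have "h2_inner (szego w) g = cnj (g w)"
      using h2_inner_cnj[OF g s] szego_reproducing[OF g w] by simp
    ultimately show ?thesis
      unfolding ker_szego h2_inner_lin_left[OF s mulF_H2[OF s] mulF_H2[OF g]] mulF_isometry[OF s g] by simp
  qed
  ultimately show ?thesis unfolding model_space_def by blast
qed

lemma ker_reproducing: assumes f: "f \<in> K" and w: "Im w > 0" shows "h2_inner f (ker w) = f w"
proof -
  note s = szego_H2[OF w]
  show ?thesis
    unfolding ker_szego h2_inner_lin_right[OF s mulF_H2[OF s] K_H2[OF f]] K_orth[OF f s] szego_reproducing[OF K_H2[OF f] w] by simp
qed

lemma ker_self: assumes w: "Im w > 0"
  shows "ker w w = of_real ((1 - (cmod (F w))\<^sup>2) / (4 * pi * Im w))" "(h2_norm (ker w))\<^sup>2 = (1 - (cmod (F w))\<^sup>2) / (4 * pi * Im w)"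
    "ker w w \<noteq> 0"
proof -
  have e: "w - cnj w = 2 * \<i> * of_real (Im w)" by (simp add: complex_eq_iff)
  have n: "1 - cnj (F w) * F w = of_real (1 - (cmod (F w))\<^sup>2)"
    by (simp only: of_real_diff complex_norm_square of_real_1 mult.commute)
  have "ker w w = (\<i> / (2 * pi)) * of_real (1 - (cmod (F w))\<^sup>2) / (2 * \<i> * of_real (Im w))"
    unfolding ker_def e n using w by simp
  moreover have "(\<i> / (2 * p)) * x / (2 * \<i> * m) = x / (4 * p * m)" for p m x :: complex by simp
  ultimately show 1: "ker w w = of_real ((1 - (cmod (F w))\<^sup>2) / (4 * pi * Im w))" by simp
  have "of_real ((h2_norm (ker w))\<^sup>2) = ker w w"
    using ker_reproducing[OF ker_K[OF w] w] h2_inner_self[OF K_H2[OF ker_K[OF w]]] by simp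
  thus "(h2_norm (ker w))\<^sup>2 = (1 - (cmod (F w))\<^sup>2) / (4 * pi * Im w)"
    unfolding 1 by (simp only: of_real_eq_iff)
  have "(cmod (F w))\<^sup>2 < 1" using F_lt_1[OF w] by (simp add: power_less_one_iff abs_square_less_1)
  thus "ker w w \<noteq> 0" unfolding 1 using w by (simp only: of_real_eq_0_iff) auto
qed

text \<open>The graph of the adjoint of \<open>M\<^sup>F\<close>, together with the two boundary coordinates \<open>(a, b)\<close> of its elements.\<close>

definition adjT :: "(complex \<Rightarrow> complex) \<Rightarrow> (complex \<Rightarrow> complex) \<Rightarrow> complex \<Rightarrow> complex \<Rightarrow> bool" where
  "adjT f g a b \<longleftrightarrow> f \<in> K \<and> g \<in> K \<and> (\<forall>z. Im z > 0 \<longrightarrow> z * f z - g z = a + b * F z)"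

lemma adjT_K: "adjT f g a b \<Longrightarrow> f \<in> K" "adjT f g a b \<Longrightarrow> g \<in> K"
  by (simp_all add: adjT_def)

lemma adjT_eq: "adjT f g a b \<Longrightarrow> Im z > 0 \<Longrightarrow> z * f z - g z = a + b * F z"
  by (simp add: adjT_def)

lemma adjT_lin:
  assumes "adjT f g a b" "adjT p q a' b'"
  shows "adjT (\<lambda>z. c * f z + d * p z) (\<lambda>z. c * g z + d * q z) (c * a + d * a') (c * b + d * b')"
proof -
  have "z * (c * f z + d * p z) - (c * g z + d * q z) = c * a + d * a' + (c * b + d * b') * F z" if "Im z > 0" for z
  proof -
    have "z * (c * f z + d * p z) - (c * g z + d * q z) = c * (z * f z - g z) + d * (z * p z - q z)"
      by (simp add: algebra_simps)
    thus ?thesis unfolding adjT_eq[OF assms(1) that] adjT_eq[OF assms(2) that] by (simp add: algebra_simps)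
  qed
  with assms show ?thesis by (auto simp: adjT_def intro: K_lin)
qed

text \<open>A non-constant \<open>F\<close> is linearly independent of the constant 1, so the
  boundary coordinates are well defined.\<close>

lemma adjT_unique:
  assumes "adjT f g a b" "adjT f g a' b'" shows "a = a'" "b = b'"
proof -
  obtain w v where wv: "Im w > 0" "Im v > 0" "F w \<noteq> F v" by (rule two_values)
  have e: "a + b * F w = a' + b' * F w" "a + b * F v = a' + b' * F v"
    using adjT_eq[OF assms(1)] adjT_eq[OF assms(2)] wv by metis+
  have "(b - b') * (F w - F v) = ((a + b * F w) - (a' + b' * F w)) - ((a + b * F v) - (a' + b' * F v))"
    by (simp add: algebra_simps)
  hence "(b - b') * (F w - F v) = 0" unfolding e by simp
  thus "b = b'" using wv by simp
  with e show "a = a'" by simp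
qed

lemma adjT_MF: "adjT f g 0 0 \<longleftrightarrow> f \<in> MF_domain F \<and> g = mult_z f"
proof
  assume *: "adjT f g 0 0"
  have "mult_z f = (\<lambda>z. 1 * g z + 0 * g z)"
    using * by (intro mult_z_eqI K_H2) (auto simp: adjT_def)
  thus "f \<in> MF_domain F \<and> g = mult_z f" using * by (simp add: MF_domain_def adjT_def)
qed (auto simp: adjT_def MF_domain_def mult_z_def)

lemma MF_adjT: "f \<in> MF_domain F \<Longrightarrow> adjT f (mult_z f) 0 0" by (simp add: adjT_MF)

section \<open>Boundary coordinates of the kernels\<close>

abbreviation "\<kappa>0 \<equiv> \<i> / (2 * complex_of_real pi)"

text \<open>Multiplying the kernel by its own denominator leaves
  \<open>\<kappa>0 * (1 - cnj (F w) * F z)\<close>. Membership in \<open>K\<close> is an assumption,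
  so that real \<open>w\<close> is covered once it has been established there.\<close>

lemma adjT_ker_gen:
  assumes "ker w \<in> K" "Im w \<ge> 0"
  shows "adjT (ker w) (\<lambda>z. cnj w * ker w z) \<kappa>0 (- \<kappa>0 * cnj (F w))"
proof -
  have "z * ker w z - cnj w * ker w z = \<kappa>0 + - \<kappa>0 * cnj (F w) * F z" if "Im z > 0" for z
  proof -
    have "z - cnj w \<noteq> 0" using that assms(2) by (auto simp: complex_eq_iff)
    hence "(z - cnj w) * ker w z = \<kappa>0 * (1 - cnj (F w) * F z)" using that unfolding ker_def by simp
    moreover have "k * (1 - x * y) = k + - k * x * y" for k x y :: complex by (simp add: algebra_simps)
    ultimately show ?thesis unfolding left_diff_distrib by simp
  qed
  moreover have "(\<lambda>z. cnj w * ker w z) \<in> K" using K_lin[OF assms(1,1), of "cnj w" 0] by simp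
  ultimately show ?thesis using assms(1) by (simp add: adjT_def)
qed

lemma adjT_ker: "Im w > 0 \<Longrightarrow> adjT (ker w) (\<lambda>z. cnj w * ker w z) \<kappa>0 (- \<kappa>0 * cnj (F w))"
  by (intro adjT_ker_gen ker_K) auto

text \<open>The coordinates of two kernels are linearly independent as soon as
  \<open>F w \<noteq> F v\<close>. Hence two kernels realise every pair: modulo
  \<open>M\<^sup>F\<close> the adjoint graph is two-dimensional, the concrete form of deficiency
  indices (1,1).\<close>

lemma adjT_span:
  assumes wv: "Im w > 0" "Im v > 0" "F w \<noteq> F v"
  obtains c d where "adjT (\<lambda>z. c * ker w z + d * ker v z) (\<lambda>z. c * (cnj w * ker w z) + d * (cnj v * ker v z)) a b"
proof -
  define A B where "A = a / \<kappa>0" and "B = - b / \<kappa>0"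
  \<comment> \<open>Solves \<open>c + d = A\<close> and
    \<open>c * cnj (F w) + d * cnj (F v) = B\<close>, the coordinate equations divided by
    \<open>\<kappa>0\<close> and \<open>- \<kappa>0\<close>.\<close>
  define d where "d = (B - A * cnj (F w)) / (cnj (F v) - cnj (F w))"
  define c where "c = A - d"
  have ne: "cnj (F v) - cnj (F w) \<noteq> 0" using wv by (metis complex_cnj_cancel_iff right_minus_eq)
  have k: "\<kappa>0 \<noteq> 0" by simp
  have aux: "x / k * k = x" if "k \<noteq> 0" for x k :: complex using that by simp
  have "c * \<kappa>0 + d * \<kappa>0 = (c + d) * \<kappa>0" by (rule distrib_right[symmetric])
  also have "c + d = A" unfolding c_def by simp
  also have "A * \<kappa>0 = a" unfolding A_def by (rule aux[OF k])
  finally have 1: "c * \<kappa>0 + d * \<kappa>0 = a" .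
  have "c * cnj (F w) + d * cnj (F v) = A * cnj (F w) + d * (cnj (F v) - cnj (F w))" unfolding c_def by (simp add: algebra_simps)
  also have "\<dots> = B" unfolding d_def using ne by simp
  finally have "- \<kappa>0 * (c * cnj (F w) + d * cnj (F v)) = b" unfolding B_def using k by simp
  moreover have "c * (k * x) + d * (k * y) = k * (c * x + d * y)" for k x y by (simp add: algebra_simps)
  ultimately have 2: "c * (- \<kappa>0 * cnj (F w)) + d * (- \<kappa>0 * cnj (F v)) = b" by (simp only:)
  show ?thesis
    by (rule that) (use adjT_lin[OF adjT_ker[OF wv(1)] adjT_ker[OF wv(2)], of c d] in \<open>unfold 1 2\<close>)
qed

lemma adjT_exists: obtains f g where "adjT f g a b"
  by (rule two_values, rule adjT_span)

text \<open>For \<open>(k\<^sub>w, cnj w k\<^sub>w)\<close> Green's formula is the reproducing property; as these elements and the graph of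
  \<open>M\<^sup>F\<close> span the adjoint graph, no integration is needed.\<close>

lemma green_ker:
  assumes T: "adjT p q a b" and w: "Im w > 0"
  shows "h2_inner (\<lambda>z. cnj w * ker w z) p - h2_inner (ker w) q = cnj (a + b * F w)"
proof -
  have k: "h2_inner (ker w) f = cnj (f w)" if "f \<in> K" for f
    using h2_inner_cnj[OF K_H2[OF that] K_H2[OF ker_K[OF w]]] ker_reproducing[OF that w] by simp
  have "h2_inner (\<lambda>z. cnj w * ker w z) p = cnj w * h2_inner (ker w) p"
    using h2_inner_lin_left[OF K_H2[OF ker_K[OF w]] K_H2[OF ker_K[OF w]] K_H2[OF adjT_K(1)[OF T]], of "cnj w" 0] by simp
  thus ?thesis
    unfolding k[OF adjT_K(1)[OF T]] k[OF adjT_K(2)[OF T]] using adjT_eq[OF T w] by (metis complex_cnj_diff complex_cnj_mult)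
qed

lemma green_lin:
  assumes "adjT f g a b" "adjT f' g' a' b'" "adjT p q a'' b''"
  shows "h2_inner (\<lambda>z. c * g z + d * g' z) p - h2_inner (\<lambda>z. c * f z + d * f' z) q
     = c * (h2_inner g p - h2_inner f q) + d * (h2_inner g' p - h2_inner f' q)"
  using assms[THEN adjT_K(1)] assms[THEN adjT_K(2)]
  by (simp add: h2_inner_lin_left K_H2 algebra_simps)

text \<open>Subtracting the combination of two kernels with the same coordinates leaves an element
  with coordinates 0, that is, of \<open>M\<^sup>F\<close>. The factors 1 keep the shape in which
  the linearity lemmas rewrite.\<close>

lemma adjT_decompose:
  assumes T: "adjT f g a b"
  obtains m w v c d where "m \<in> MF_domain F" "Im w > 0" "Im v > 0"
    "f = (\<lambda>z. 1 * m z + 1 * (c * ker w z + d * ker v z))"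
    "g = (\<lambda>z. 1 * mult_z m z + 1 * (c * (cnj w * ker w z) + d * (cnj v * ker v z)))"
    "a = c * \<kappa>0 + d * \<kappa>0" "b = c * (- \<kappa>0 * cnj (F w)) + d * (- \<kappa>0 * cnj (F v))"
proof -
  obtain w v where wv: "Im w > 0" "Im v > 0" "F w \<noteq> F v" by (rule two_values)
  obtain c d where S: "adjT (\<lambda>z. c * ker w z + d * ker v z) (\<lambda>z. c * (cnj w * ker w z) + d * (cnj v * ker v z)) a b"
    (is "adjT ?p ?q a b") using adjT_span[OF wv] by metis
  have "adjT (\<lambda>z. 1 * f z + (-1) * ?p z) (\<lambda>z. 1 * g z + (-1) * ?q z) 0 0"
    using adjT_lin[OF T S, of 1 "-1"] by simp
  hence m: "(\<lambda>z. 1 * f z + (-1) * ?p z) \<in> MF_domain F"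
    "(\<lambda>z. 1 * g z + (-1) * ?q z) = mult_z (\<lambda>z. 1 * f z + (-1) * ?p z)" unfolding adjT_MF by auto
  have ab: "a = c * \<kappa>0 + d * \<kappa>0" "b = c * (- \<kappa>0 * cnj (F w)) + d * (- \<kappa>0 * cnj (F v))"
    using adjT_unique[OF S adjT_lin[OF adjT_ker[OF wv(1)] adjT_ker[OF wv(2)]]] by auto
  show ?thesis
  proof (rule that[OF m(1) wv(1,2) _ _ ab])
    show "f = (\<lambda>z. 1 * (1 * f z + (-1) * ?p z) + 1 * ?p z)" by auto
    show "g = (\<lambda>z. 1 * mult_z (\<lambda>z. 1 * f z + (-1) * ?p z) z + 1 * ?q z)" unfolding m(2)[symmetric] by auto
  qed
qed

lemma green_swap:
  assumes "adjT f g a b" "adjT p q a' b'"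
  shows "h2_inner g p - h2_inner f q = - cnj (h2_inner q f - h2_inner p g)"
  using assms[THEN adjT_K(1)] assms[THEN adjT_K(2)]
  by (simp add: h2_inner_cnj[of p g] h2_inner_cnj[of q f] K_H2)

text \<open>Decompose the other element: its part in the domain pairs symmetrically by
  \<open>mult_z_H2_symmetric\<close>, and its kernel part contributes \<open>green_ker\<close> with
  both coordinates 0.\<close>

lemma green_MF:
  assumes m: "m \<in> MF_domain F" and T: "adjT p q a b"
  shows "h2_inner (mult_z m) p = h2_inner m q"
proof -
  obtain m' w v c d where D: "m' \<in> MF_domain F" "Im w > 0" "Im v > 0"
    "p = (\<lambda>z. 1 * m' z + 1 * (c * ker w z + d * ker v z))"
    "q = (\<lambda>z. 1 * mult_z m' z + 1 * (c * (cnj w * ker w z) + d * (cnj v * ker v z)))"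
    by (rule adjT_decompose[OF T]) (rule that; assumption)
  note M = MF_adjT[OF m] and M' = MF_adjT[OF D(1)]
  note W = adjT_ker[OF D(2)] and V = adjT_ker[OF D(3)]
  have "h2_inner (mult_z m') m - h2_inner m' (mult_z m) = 0"
    using m D(1) by (simp add: mult_z_H2_symmetric MF_domain_def K_H2)
  hence "h2_inner q m - h2_inner p (mult_z m) = 0"
    unfolding D(4,5) green_lin[OF M' adjT_lin[OF W V] M] green_lin[OF W V M] green_ker[OF M D(2)] green_ker[OF M D(3)]
    by simp
  thus ?thesis using green_swap[OF M T] by simp
qed

lemma green:
  assumes T: "adjT f g a b" and S: "adjT p q a' b'"
  shows "h2_inner g p - h2_inner f q = - (2 * pi * \<i>) * (a * cnj a' - b * cnj b')"
proof -
  obtain m w v c d where D: "m \<in> MF_domain F" "Im w > 0" "Im v > 0"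
    "f = (\<lambda>z. 1 * m z + 1 * (c * ker w z + d * ker v z))"
    "g = (\<lambda>z. 1 * mult_z m z + 1 * (c * (cnj w * ker w z) + d * (cnj v * ker v z)))"
    and ab: "a = c * \<kappa>0 + d * \<kappa>0" "b = c * (- \<kappa>0 * cnj (F w)) + d * (- \<kappa>0 * cnj (F v))"
    by (rule adjT_decompose[OF T]) (rule that; assumption)
  note M = MF_adjT[OF D(1)]
  note W = adjT_ker[OF D(2)] and V = adjT_ker[OF D(3)]
  have "h2_inner g p - h2_inner f q = c * cnj (a' + b' * F w) + d * cnj (a' + b' * F v)"
    unfolding D(4,5) green_lin[OF M adjT_lin[OF W V] S] green_lin[OF W V S] green_ker[OF S D(2)] green_ker[OF S D(3)]
      green_MF[OF D(1) S] by simp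
  \<comment> \<open>The factor is \<open>1 / \<kappa>0 = - 2 pi \<i>\<close>: by \<open>ab\<close>,
    \<open>c + d\<close> is \<open>a / \<kappa>0\<close> and
    \<open>c * cnj (F w) + d * cnj (F v)\<close> is \<open>- b / \<kappa>0\<close>.\<close>
  also have "\<dots> = - (2 * pi * \<i>) * (a * cnj a' - b * cnj b')"
    unfolding ab by (simp add: field_simps)
  finally show ?thesis .
qed

text \<open>On the real axis \<open>1 / (z - w)\<close> and \<open>1 / (z - cnj w)\<close> are conjugate, so the division moves to the other factor.\<close>

lemma divide_orthogonal:
  assumes u: "u \<in> K" and v: "v \<in> H2" "\<And>z. Im z > 0 \<Longrightarrow> (z - w) * v z = u z"
    and g: "g \<in> H2" "g' \<in> H2" "\<And>z. Im z > 0 \<Longrightarrow> g z = (z - cnj w) * g' z"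
  shows "h2_inner v (mulF g) = 0"
proof -
  have zv: "mult_z v = (\<lambda>z. 1 * u z + w * v z)" "mult_z v \<in> H2"
    using v(2) by (intro mult_z_eqI[OF v(1) K_H2[OF u] v(1), where a = 1 and b = w]; simp add: algebra_simps)+
  have zg: "mult_z g' = (\<lambda>z. 1 * g z + cnj w * g' z)" "mult_z g' \<in> H2"
    using g(3) by (intro mult_z_eqI[OF g(2,1,2), where a = 1 and b = "cnj w"]; simp add: algebra_simps)+
  have c: "mult_z (mulF g') = mulF (mult_z g')" by (auto simp: mult_z_def mult_fun_def fun_eq_iff)
  have Fg: "mulF g = (\<lambda>z. 1 * mult_z (mulF g') z + (- cnj w) * mulF g' z)"
    unfolding c zg(1) mulF_lin by auto
  have zF: "mult_z (mulF g') \<in> H2" unfolding c by (rule mulF_H2[OF zg(2)])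
  note F' = mulF_H2[OF g(2)]
  have "h2_inner v (mulF g) = h2_inner v (mult_z (mulF g')) - w * h2_inner v (mulF g')"
    unfolding Fg h2_inner_lin_right[OF zF F' v(1)] by simp
  also have "h2_inner v (mult_z (mulF g')) = h2_inner (mult_z v) (mulF g')"
    by (rule mult_z_H2_symmetric[OF v(1) zv(2) F' zF, symmetric])
  also have "\<dots> = w * h2_inner v (mulF g')"
    unfolding zv(1) h2_inner_lin_left[OF K_H2[OF u] v(1) F'] K_orth[OF u g(2)] by simp
  finally show ?thesis by simp
qed

text \<open>Every \<open>g\<close> in \<open>H2\<close> is a multiple of \<open>z - cnj w\<close>,
  which is bounded away from 0 on the half-plane; so \<open>divide_orthogonal\<close> reaches all
  test functions.\<close>

lemma K_divide_upper:
  assumes u: "u \<in> K" and w: "Im w > 0" and zero: "u w = 0"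
  obtains v where "v \<in> K" "\<And>z. Im z > 0 \<Longrightarrow> (z - w) * v z = u z"
proof -
  obtain v where v: "v \<in> H2" "\<And>z. Im z > 0 \<Longrightarrow> (z - w) * v z = u z"
    using H2_divide_upper[OF K_H2[OF u] w zero] by metis
  have "h2_inner v (mulF g) = 0" if g: "g \<in> H2" for g
  proof (rule divide_orthogonal[OF u v g])
    have ne: "z - cnj w \<noteq> 0" if "Im z > 0" for z using that w by (auto simp: complex_eq_iff)
    show "(\<lambda>z. 1 / (z - cnj w) * g z) \<in> H2" using w by (intro H2_divide_lower g) simp
    show "g z = (z - cnj w) * (1 / (z - cnj w) * g z)" if "Im z > 0" for z using ne[OF that] by simp
  qed
  with v have "v \<in> K" by (simp add: model_space_def)
  with v(2) show ?thesis using that by blast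
qed

text \<open>At a real point the multiples of \<open>z - c\<close> no longer exhaust
  \<open>H2\<close>, but they are dense by \<open>H2_approx_unit\<close>; orthogonality passes to
  the limit because multiplication by \<open>F\<close> preserves the norm.\<close>

lemma K_divide_real:
  assumes u: "u \<in> K" and v: "v \<in> H2" "\<And>z. Im z > 0 \<Longrightarrow> (z - of_real c) * v z = u z"
  shows "v \<in> K"
proof -
  have "h2_inner v (mulF g) = 0" if g: "g \<in> H2" for g
  proof -
    have b: "cmod (h2_inner v (mulF g)) \<le> h2_norm v * sqrt \<delta>" if \<delta>: "\<delta> > 0" for \<delta>
    proof -
      obtain \<epsilon> where \<epsilon>: "\<epsilon> > 0" "(h2_norm (\<lambda>z. (\<i> * of_real \<epsilon>) * (1 / (z - Complex c (- \<epsilon>)) * g z)))\<^sup>2 \<le> \<delta>"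
        using H2_approx_unit[OF g \<delta>] by metis
      define g' where "g' = (\<lambda>z. 1 / (z - Complex c (- \<epsilon>)) * g z)"
      have g': "g' \<in> H2" unfolding g'_def using \<epsilon>(1) by (intro H2_divide_lower g) simp
      define e where "e = (\<lambda>z. (\<i> * of_real \<epsilon>) * g' z)"
      have eH: "e \<in> H2" unfolding e_def by (rule H2_scale[OF g'])
      define g1 where "g1 = (\<lambda>z. 1 * g z + (-1) * e z)"
      have g1: "g1 \<in> H2" unfolding g1_def by (rule H2_lin[OF g eH])
      have g1eq: "g1 z = (z - cnj (of_real c)) * g' z" if "Im z > 0" for z
      proof -
        have "z - Complex c (- \<epsilon>) \<noteq> 0" using that \<epsilon>(1) by (auto simp: complex_eq_iff)
        hence "g z = (z - Complex c (- \<epsilon>)) * g' z" unfolding g'_def by simp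
        also have "Complex c (- \<epsilon>) = of_real c - \<i> * of_real \<epsilon>" by (simp add: complex_eq_iff)
        finally show ?thesis unfolding g1_def e_def by (simp add: algebra_simps)
      qed
      have 0: "h2_inner v (mulF g1) = 0"
        by (rule divide_orthogonal[where w = "of_real c", OF u v g1 g' g1eq])
      have "mulF g = (\<lambda>z. 1 * mulF g1 z + 1 * mulF e z)"
        unfolding mulF_lin[symmetric] g1_def by simp
      hence "h2_inner v (mulF g) = h2_inner v (mulF e)"
        using h2_inner_lin_right[OF mulF_H2[OF g1] mulF_H2[OF eH] v(1), of 1 1] 0 by simp
      also have "cmod \<dots> \<le> h2_norm v * h2_norm e"
        using h2_cauchy_schwarz[OF v(1) mulF_H2[OF eH]] by (simp add: h2_norm_mulF[OF eH])
      also have "\<dots> \<le> h2_norm v * sqrt \<delta>"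
        using \<epsilon>(2) unfolding e_def g'_def by (intro mult_left_mono h2_norm_nonneg v real_le_rsqrt)
      finally show ?thesis .
    qed
    have "((\<lambda>\<delta>. h2_norm v * sqrt \<delta>) \<longlongrightarrow> h2_norm v * sqrt 0) (at_right 0)" by (intro tendsto_intros)
    hence "cmod (h2_inner v (mulF g)) \<le> h2_norm v * sqrt 0"
      by (rule tendsto_lowerbound) (use eventually_at_right_pos in \<open>auto elim!: eventually_mono intro: b\<close>)
    thus ?thesis by simp
  qed
  with v show ?thesis by (simp add: model_space_def)
qed

text \<open>The test functions reached by \<open>divide_orthogonal\<close> are the multiples of
  \<open>z - w\<close>, that is, those vanishing at \<open>w\<close>. They have codimension one,
  with \<open>szego w\<close> as complement, whence exactly one extra condition
  \<open>orth\<close>.\<close>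

lemma K_divide_lower:
  assumes u: "u \<in> K" and w: "Im w > 0" and v: "v \<in> H2" "\<And>z. Im z > 0 \<Longrightarrow> (z - cnj w) * v z = u z"
    and orth: "h2_inner v (mulF (szego w)) = 0"
  shows "v \<in> K"
proof -
  have "h2_inner v (mulF g) = 0" if g: "g \<in> H2" for g
  proof -
    note s = szego_H2[OF w]
    have s0: "szego w w \<noteq> 0" using szego_self(1)[OF w] w by simp
    define g1 where "g1 = (\<lambda>z. 1 * g z + (- (g w / szego w w)) * szego w z)"
    have g1: "g1 \<in> H2" unfolding g1_def by (rule H2_lin[OF g s])
    have "g1 w = 0" unfolding g1_def using s0 by simp
    then obtain g' where g': "g' \<in> H2" "\<And>z. Im z > 0 \<Longrightarrow> (z - w) * g' z = g1 z"
      using H2_divide_upper[OF g1 w] by metis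
    have g1eq: "g1 z = (z - cnj (cnj w)) * g' z" if "Im z > 0" for z
      unfolding complex_cnj_cnj g'(2)[OF that] ..
    have 0: "h2_inner v (mulF g1) = 0"
      by (rule divide_orthogonal[OF u v g1 g'(1) g1eq])
    have "mulF g = (\<lambda>z. 1 * mulF g1 z + (g w / szego w w) * mulF (szego w) z)"
      unfolding mulF_lin[symmetric] g1_def by simp
    thus ?thesis using h2_inner_lin_right[OF mulF_H2[OF g1] mulF_H2[OF s] v(1), of 1 "g w / szego w w"] 0 orth by simp
  qed
  with v show ?thesis by (simp add: model_space_def)
qed

end

context mero_inner begin

section \<open>Kernels at real points and surjectivity\<close>

text \<open>The identity holds on the real diameter of a disc around \<open>c\<close>, where
  \<open>|F| = 1\<close>, and both sides continue analytically: \<open>cnj (F (cnj z))\<close> is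
  holomorphic on the symmetric disc.\<close>

lemma reflection:
  obtains R where "R > 0" "F holomorphic_on ball (of_real c) R"
    "\<And>z. z \<in> ball (of_real c) R \<Longrightarrow> cnj (F z) * F (cnj z) = 1"
proof -
  obtain R where R: "R > 0" "F holomorphic_on ball (of_real c) R"
    using F_analytic[of c] unfolding analytic_at_ball by auto
  let ?B = "ball (of_real c) R :: complex set"
  have cnjB: "cnj z \<in> ?B" if "z \<in> ?B" for z
    using that complex_mod_cnj[of "of_real c - z"] by (simp add: dist_norm)
  have "cnj ` ?B = ?B"
  proof
    show "?B \<subseteq> cnj ` ?B" using cnjB by (metis complex_cnj_cnj image_iff subsetI)
  qed (use cnjB in auto)
  hence "(cnj \<circ> F \<circ> cnj) holomorphic_on ?B"
    using R(2) by (intro holomorphic_on_compose_cnj_cnj) auto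
  hence holo: "(\<lambda>z. cnj (F (cnj z)) * F z - 1) holomorphic_on ?B"
    using R(2) unfolding o_def by (intro holomorphic_intros)
  let ?X = "{z \<in> ?B. Im z = 0}"
  have zero: "cnj (F (cnj z)) * F z - 1 = 0" if "z \<in> ?B" for z
  proof (rule analytic_continuation[OF holo _ _ _ _ _ _ that, where U = ?X and \<xi> = "of_real c"])
    show "of_real c islimpt ?X"
      unfolding islimpt_approachable
    proof (intro allI impI)
      fix e :: real assume e: "e > 0"
      define x where "x = c + min e R / 2"
      have "min e R > 0" using e R(1) by simp
      hence "x \<noteq> c" "\<bar>x - c\<bar> < e" "\<bar>x - c\<bar> < R" unfolding x_def by auto
      moreover have "dist (complex_of_real x) (of_real c) = \<bar>x - c\<bar>" by (simp add: dist_norm flip: of_real_diff)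
      ultimately show "\<exists>x'\<in>?X. x' \<noteq> of_real c \<and> dist x' (of_real c) < e"
        by (intro bexI[of _ "of_real x"]) (auto simp: dist_commute)
    qed
    fix z assume "z \<in> ?X"
    then obtain x where "z = of_real x" by (metis (mono_tags, lifting) complex_is_Real_iff mem_Collect_eq Reals_cases)
    thus "cnj (F (cnj z)) * F z - 1 = 0"
      using F_real[of x] complex_norm_square[of "F (of_real x)"] by (simp add: mult.commute)
  qed (use R(1) in auto)
  have "cnj (F z) * F (cnj z) = 1" if "z \<in> ?B" for z
    using zero[OF cnjB[OF that]] by simp
  with R show ?thesis using that by blast
qed

text \<open>To be read with \<open>fz = cnj (F z)\<close>, \<open>fc = cnj (F c)\<close>,
  \<open>x = F \<zeta>\<close> and \<open>z' = cnj z\<close>. Over a common denominator the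
  numerator is linear in the two increments \<open>z' - c'\<close> and \<open>fz - fc\<close>, both
  of order \<open>\<delta>\<close>, while the denominator is at least half the square of
  \<open>cmod (\<zeta> - c')\<close>.\<close>

lemma kernel_diff_bound:
  fixes c' \<zeta> x z' fz fc :: complex
  assumes "cmod x \<le> M" "cmod fc = 1" "cmod (fz - fc) \<le> L * \<delta>" "cmod (z' - c') = \<delta>" "r > 0" "\<delta> \<le> r / 2"
    "r \<le> cmod (\<zeta> - c')" "L \<ge> 0" "M \<ge> 0"
  shows "cmod ((1 - fz * x) / (\<zeta> - z') - (1 - fc * x) / (\<zeta> - c')) \<le> 2 * ((1 + M) / r + M * L) * \<delta> / cmod (\<zeta> - c')"
proof -
  define \<rho> where "\<rho> = cmod (\<zeta> - c')"
  have \<rho>: "\<rho> \<ge> r" "\<rho> > 0" using assms unfolding \<rho>_def by auto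
  have \<delta>: "\<delta> \<ge> 0" using assms(4) by (metis norm_ge_zero)
  have "\<rho> \<le> cmod (\<zeta> - z') + cmod (z' - c')" unfolding \<rho>_def using norm_triangle_ineq[of "\<zeta> - z'" "z' - c'"] by simp
  hence d: "\<rho> / 2 \<le> cmod (\<zeta> - z')" using assms(4,6) \<rho>(1) by simp
  have ne: "\<zeta> - z' \<noteq> 0" "\<zeta> - c' \<noteq> 0" using d \<rho> unfolding \<rho>_def by auto
  let ?N = "(z' - c') - x * ((fz - fc) * (\<zeta> - c') + fc * (z' - c'))"
  have eq: "(1 - fz * x) / (\<zeta> - z') - (1 - fc * x) / (\<zeta> - c') = ?N / ((\<zeta> - z') * (\<zeta> - c'))"
    using ne by (simp add: diff_frac_eq) (simp add: algebra_simps)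
  have "cmod ?N \<le> \<delta> + M * (L * \<delta> * \<rho> + \<delta>)"
  proof -
    have "cmod ((fz - fc) * (\<zeta> - c') + fc * (z' - c')) \<le> cmod ((fz - fc) * (\<zeta> - c')) + cmod (fc * (z' - c'))"
      by (rule norm_triangle_ineq)
    also have "\<dots> \<le> L * \<delta> * \<rho> + \<delta>" unfolding norm_mult \<rho>_def[symmetric] assms(2,4)
      using mult_right_mono[OF assms(3), of \<rho>] \<rho>(2) by simp
    finally have *: "cmod (x * ((fz - fc) * (\<zeta> - c') + fc * (z' - c'))) \<le> M * (L * \<delta> * \<rho> + \<delta>)"
      unfolding norm_mult using assms(1,9) by (intro mult_mono) auto
    show ?thesis using norm_triangle_ineq4[of "z' - c'"] * assms(4) by (smt (verit, best))
  qed
  moreover from this have "0 \<le> \<delta> + M * (L * \<delta> * \<rho> + \<delta>)" by (rule order_trans[OF norm_ge_zero])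
  moreover have "\<rho> / 2 * \<rho> \<le> cmod ((\<zeta> - z') * (\<zeta> - c'))"
    unfolding norm_mult \<rho>_def[symmetric] using d \<rho>(2) by (intro mult_right_mono) auto
  ultimately have "cmod (?N / ((\<zeta> - z') * (\<zeta> - c'))) \<le> (\<delta> + M * (L * \<delta> * \<rho> + \<delta>)) / (\<rho> / 2 * \<rho>)"
    unfolding norm_divide using \<rho> by (intro frac_le) auto
  also have "\<dots> = 2 * ((1 + M) / \<rho> + M * L) * \<delta> / \<rho>" using \<rho>(2) by (simp add: field_simps)
  also have "\<dots> \<le> 2 * ((1 + M) / r + M * L) * \<delta> / \<rho>"
    using \<rho> \<delta> assms(5,8,9) by (intro divide_right_mono mult_right_mono mult_left_mono add_right_mono divide_left_mono) auto
  finally show ?thesis unfolding eq \<rho>_def .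
qed

text \<open>The difference of two kernels is estimated directly on and outside a circle around \<open>c\<close>, and inside by the
  maximum principle: reflection makes the singularities at \<open>cnj z\<close> and \<open>c\<close> removable.\<close>

lemma ker_real_estimates:
  obtains r C where "r > 0" "C \<ge> 0" "ker (of_real c) \<in> H2"
    "\<And>z. Im z > 0 \<Longrightarrow> cmod (z - of_real c) \<le> r \<Longrightarrow> h2_norm (\<lambda>\<zeta>. ker z \<zeta> - ker (of_real c) \<zeta>) \<le> C * cmod (z - of_real c)"
proof -
  let ?c = "of_real c :: complex"
  obtain R where R: "R > 0" "F holomorphic_on ball ?c R"
    "\<And>z. z \<in> ball ?c R \<Longrightarrow> cnj (F z) * F (cnj z) = 1" by (rule reflection[of c]) (rule that; assumption)
  let ?B = "ball ?c R"
  define r where "r = R / 2"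
  have r: "r > 0" "cball ?c r \<subseteq> ?B" using R(1) unfolding r_def by auto
  have cB: "?c \<in> ?B" using R(1) by simp
  have cnjB: "cnj z \<in> ?B" if "z \<in> ?B" for z
    using that complex_mod_cnj[of "?c - z"] by (simp add: dist_norm)
  have bounded: "\<exists>B. \<forall>z\<in>cball ?c r. cmod (h z) \<le> B" if "h holomorphic_on ?B" for h
    by (rule holomorphic_bounded_on_compact[OF that compact_cball r(2)]) blast
  obtain M0 where M0: "\<And>z. z \<in> cball ?c r \<Longrightarrow> cmod (F z) \<le> M0" using bounded[OF R(2)] by blast
  \<comment> \<open>One bound for \<open>|F|\<close> on the whole disc, its lower half included, and
    on the upper half-plane, where \<open>|F|\<close> is at most 1.\<close>
  define M where "M = max 1 M0"
  have M: "M \<ge> 0" "M \<ge> 1" "\<And>z. z \<in> cball ?c r \<Longrightarrow> cmod (F z) \<le> M"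
    unfolding M_def using M0 by (force simp: max_def)+
  define q where "q = (\<lambda>z. if z = ?c then deriv F ?c else (F z - F ?c) / (z - ?c))"
  have "q holomorphic_on ?B" unfolding q_def by (rule pole_lemma[OF R(2)]) (use R(1) in \<open>simp add: interior_open\<close>)
  then obtain L where L: "\<And>z. z \<in> cball ?c r \<Longrightarrow> cmod (q z) \<le> L" using bounded by blast
  have L0: "L \<ge> 0" using L[of ?c] r(1) by (smt (verit) centre_in_cball norm_ge_zero)
  have lip: "cmod (F z - F ?c) \<le> L * cmod (z - ?c)" if "z \<in> cball ?c r" for z
    using L[OF that] unfolding q_def by (cases "z = ?c") (auto simp: norm_divide field_simps)
  \<comment> \<open>The kernel without its constant, continued over the lower half of the disc: by
    reflection the numerator vanishes at \<open>cnj w\<close>, so the singularity there is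
    removable.\<close>
  define Q where "Q w = (\<lambda>\<zeta>. if \<zeta> = cnj w then deriv (\<lambda>x. 1 - cnj (F w) * F x) (cnj w)
      else ((1 - cnj (F w) * F \<zeta>) - (1 - cnj (F w) * F (cnj w))) / (\<zeta> - cnj w))" for w
  have Qholo: "Q w holomorphic_on ?B" if "w \<in> ?B" for w
    unfolding Q_def by (rule pole_lemma) (use R(2) cnjB[OF that] in \<open>auto intro!: holomorphic_intros simp: interior_open\<close>)
  have Qv: "Q w \<zeta> = (1 - cnj (F w) * F \<zeta>) / (\<zeta> - cnj w)" if "w \<in> ?B" "\<zeta> \<noteq> cnj w" for w \<zeta>
    unfolding Q_def using R(3)[OF that(1)] that(2) by simp
  have kQ: "ker w \<zeta> = \<kappa>0 * Q w \<zeta>" if "w \<in> ?B" "Im w \<ge> 0" "Im \<zeta> > 0" for w \<zeta>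
  proof -
    have "\<zeta> \<noteq> cnj w" using that by auto
    thus ?thesis using Qv[OF that(1)] that unfolding ker_def by simp
  qed
  have nk: "cmod \<kappa>0 = 1 / (2 * pi)" by (simp add: norm_divide norm_mult)
  have kholo: "ker w holomorphic_on upper_half_plane" if "Im w \<ge> 0" for w
  proof -
    have "(\<lambda>z. (\<i> / (2 * pi)) * (1 - cnj (F w) * F z) / (z - cnj w)) holomorphic_on upper_half_plane"
      using that by (intro holomorphic_intros F_holomorphic) (auto simp: upper_half_plane_def)
    thus ?thesis by (rule holomorphic_transform) (simp add: ker_def upper_half_plane_def)
  qed
  have kvan: "ker w z = 0" if "Im z \<le> 0" for w z using that by (simp add: ker_def)
  obtain B where B: "\<And>z. z \<in> cball ?c r \<Longrightarrow> cmod (Q ?c z) \<le> B" using bounded[OF Qholo[OF cB]] by blast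
  have cball: "z \<in> cball ?c r \<longleftrightarrow> cmod (z - ?c) \<le> r" for z by (simp add: dist_norm norm_minus_commute)
  \<comment> \<open>\<open>B\<close> takes care of the disc; \<open>2 / r\<close> comes from
    bounding the numerator of the kernel by 2 outside it.\<close>
  define A where "A = max B (2 / r) / (2 * pi)"
  have kc: "ker ?c \<in> H2"
  proof (rule H2_decay_bound(1)[where A = A and r = r and c = c])
    have "2 / r > 0" using r(1) by simp
    hence "0 \<le> max B (2 / r)" by (intro max.coboundedI2) simp
    thus "A \<ge> 0" unfolding A_def by simp
    show "cmod (ker ?c z) \<le> A" if "Im z > 0" "cmod (z - ?c) \<le> r" for z
    proof -
      have "cmod (ker ?c z) = cmod (Q ?c z) / (2 * pi)" using kQ[OF cB, of z] that by (simp add: norm_mult norm_divide)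
      also have "\<dots> \<le> A" unfolding A_def using B[of z] that cball[of z]
        by (intro divide_right_mono max.coboundedI1) auto
      finally show ?thesis .
    qed
    show "cmod (ker ?c z) \<le> A * r / cmod (z - ?c)" if "Im z > 0" "r \<le> cmod (z - ?c)" for z
    proof -
      have "cmod (1 - cnj (F ?c) * F z) \<le> 2"
        using norm_triangle_ineq4[of 1 "cnj (F ?c) * F z"] F_real[of c] F_le_1[OF that(1)] by (simp add: norm_mult)
      moreover have "2 / r \<le> A * (2 * pi)" unfolding A_def by simp
      hence "2 \<le> A * r * (2 * pi)" using r(1) by (simp add: field_simps)
      ultimately have "cmod (1 - cnj (F ?c) * F z) / (2 * pi) \<le> A * r" by (simp add: pos_divide_le_eq)
      hence "cmod (1 - cnj (F ?c) * F z) / (2 * pi) / cmod (z - ?c) \<le> A * r / cmod (z - ?c)"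
        by (rule divide_right_mono) simp
      thus ?thesis unfolding ker_def using that(1) by (simp add: norm_mult norm_divide)
    qed
  qed (use kholo[of ?c] kvan r in auto)
  define E where "E = 2 * ((1 + M) / r + M * L) / (2 * pi)"
  have E0: "E \<ge> 0" unfolding E_def using M L0 r(1) by simp
  have main: "h2_norm (\<lambda>\<zeta>. ker z \<zeta> - ker ?c \<zeta>) \<le> sqrt (2 * pi * r) * (E / r) * cmod (z - ?c)"
    if z: "Im z > 0" "cmod (z - ?c) \<le> r / 2" for z
  proof -
    define \<delta> where "\<delta> = cmod (z - ?c)"
    have \<delta>: "\<delta> \<ge> 0" "\<delta> \<le> r / 2" unfolding \<delta>_def using z by auto
    have zb: "z \<in> cball ?c r" "z \<in> ?B" using z r cball[of z] by auto
    have est: "cmod (\<kappa>0 * ((1 - cnj (F z) * F \<zeta>) / (\<zeta> - cnj z) - (1 - cnj (F ?c) * F \<zeta>) / (\<zeta> - ?c))) \<le> E * \<delta> / cmod (\<zeta> - ?c)"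
      if "cmod (F \<zeta>) \<le> M" "r \<le> cmod (\<zeta> - ?c)" for \<zeta>
    proof -
      have "cmod (cnj (F z) - cnj (F ?c)) \<le> L * \<delta>"
        using lip[OF zb(1)] unfolding \<delta>_def by (metis complex_cnj_diff complex_mod_cnj)
      moreover have "cmod (cnj z - ?c) = \<delta>" unfolding \<delta>_def
        by (metis complex_cnj_complex_of_real complex_cnj_diff complex_mod_cnj)
      moreover have "cmod (cnj (F ?c)) = 1" using F_real by simp
      ultimately have "cmod ((1 - cnj (F z) * F \<zeta>) / (\<zeta> - cnj z) - (1 - cnj (F ?c) * F \<zeta>) / (\<zeta> - ?c))
          \<le> 2 * ((1 + M) / r + M * L) * \<delta> / cmod (\<zeta> - ?c)"
        using that r(1) \<delta>(2) L0 M(1) by (intro kernel_diff_bound)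
      from divide_right_mono[OF this, of "2 * pi"]
      show ?thesis unfolding norm_mult nk E_def by (simp add: mult.commute)
    qed
    let ?D = "\<lambda>\<zeta>. ker z \<zeta> - ker ?c \<zeta>"
    have inside: "cmod (\<kappa>0 * (Q z \<zeta> - Q ?c \<zeta>)) \<le> E * \<delta> / r" if "\<zeta> \<in> cball ?c r" for \<zeta>
    proof (rule maximum_modulus_frontier[where S = "cball ?c r" and f = "\<lambda>\<zeta>. \<kappa>0 * (Q z \<zeta> - Q ?c \<zeta>)"])
      have h: "(\<lambda>\<zeta>. \<kappa>0 * (Q z \<zeta> - Q ?c \<zeta>)) holomorphic_on ?B"
        by (intro holomorphic_intros Qholo zb cB)
      show "(\<lambda>\<zeta>. \<kappa>0 * (Q z \<zeta> - Q ?c \<zeta>)) holomorphic_on interior (cball ?c r)"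
        using r(2) interior_subset by (intro holomorphic_on_subset[OF h]) blast
      show "continuous_on (closure (cball ?c r)) (\<lambda>\<zeta>. \<kappa>0 * (Q z \<zeta> - Q ?c \<zeta>))"
        using r(2) by (intro holomorphic_on_imp_continuous_on holomorphic_on_subset[OF h]) auto
      fix x assume "x \<in> frontier (cball ?c r)"
      hence x: "cmod (x - ?c) = r" "x \<in> cball ?c r" using r(1) by (auto simp: dist_norm norm_minus_commute)
      have "x \<noteq> cnj z" "x \<noteq> cnj ?c"
      proof -
        have "cmod (cnj z - ?c) = \<delta>" unfolding \<delta>_def
          by (metis complex_cnj_complex_of_real complex_cnj_diff complex_mod_cnj)
        thus "x \<noteq> cnj z" using x(1) \<delta> r(1) by auto
        show "x \<noteq> cnj ?c" using x(1) r(1) by auto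
      qed
      thus "cmod (\<kappa>0 * (Q z x - Q ?c x)) \<le> E * \<delta> / r"
        using est[OF M(3)[OF x(2)]] Qv[OF zb(2)] Qv[OF cB] x(1) by simp
    qed (use that in auto)
    have near: "cmod (?D x) \<le> E * \<delta> / r" if "Im x > 0" "cmod (x - ?c) \<le> r" for x
      using inside[of x] that cball[of x] kQ[OF zb(2), of x] kQ[OF cB, of x] z(1) by (simp add: right_diff_distrib)
    have far: "cmod (?D x) \<le> (E * \<delta> / r) * r / cmod (x - ?c)" if "Im x > 0" "r \<le> cmod (x - ?c)" for x
    proof -
      have "cmod (F x) \<le> M" using F_le_1[OF that(1)] M(2) by simp
      from est[OF this that(2)] show ?thesis using that(1) r(1) unfolding ker_def by (simp add: right_diff_distrib)
    qed
    have *: "(h2_norm ?D)\<^sup>2 \<le> 2 * pi * r * (E * \<delta> / r)\<^sup>2"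
      by (rule H2_decay_bound(2)[OF _ _ r(1) _ near far])
        (use kholo[of z] kholo[of ?c] kvan z r E0 \<delta> in \<open>auto intro!: holomorphic_intros\<close>)
    have "h2_norm ?D \<le> sqrt (2 * pi * r * (E * \<delta> / r)\<^sup>2)" using * by (intro real_le_rsqrt) auto
    also have "\<dots> = sqrt (2 * pi * r) * \<bar>E * \<delta> / r\<bar>" by (simp only: real_sqrt_mult real_sqrt_abs)
    also have "\<dots> = sqrt (2 * pi * r) * (E / r) * \<delta>" using E0 \<delta>(1) r(1) by (simp add: abs_mult)
    finally show ?thesis unfolding \<delta>_def .
  qed
  \<comment> \<open>The radius is halved because \<open>kernel_diff_bound\<close> needs
    \<open>cmod (z - c)\<close> at most \<open>r / 2\<close>. The constant is the factor
    \<open>sqrt (2 * pi * r)\<close> of \<open>H2_decay_bound\<close> times the supremum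
    \<open>E / r\<close> per unit of distance.\<close>
  show ?thesis
  proof (rule that[of "r / 2" "sqrt (2 * pi * r) * (E / r)"])
    show "sqrt (2 * pi * r) * (E / r) \<ge> 0" using E0 r(1) by simp
  qed (use r kc main in auto)
qed

lemma ker_real_H2: "ker (of_real c) \<in> H2"
  by (rule ker_real_estimates)

text \<open>Take an adjoint pair with the boundary coordinates that the kernel ought to have. The
  difference of the kernel and its first component then satisfies an equation
  \<open>(z - c) v = u\<close> with \<open>u\<close> in \<open>K\<close>, and
  \<open>K_divide_real\<close> puts it into \<open>K\<close>.\<close>

lemma ker_real_K: "ker (of_real c) \<in> K"
proof -
  let ?c = "of_real c :: complex"
  obtain \<kappa> \<kappa>' where T: "adjT \<kappa> \<kappa>' \<kappa>0 (- \<kappa>0 * cnj (F ?c))" by (rule adjT_exists)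
  note k = adjT_K[OF T]
  define v where "v = (\<lambda>z. 1 * ker ?c z + (-1) * \<kappa> z)"
  have "v \<in> K"
  proof (rule K_divide_real[where u = "\<lambda>z. ?c * \<kappa> z + (-1) * \<kappa>' z" and c = c])
    show "v \<in> H2" unfolding v_def by (rule H2_lin[OF ker_real_H2 K_H2[OF k(1)]])
    fix z assume z: "Im z > 0"
    have "(z - ?c) * ker ?c z = \<kappa>0 * (1 - cnj (F ?c) * F z)"
      using z unfolding ker_def by (auto simp: complex_eq_iff)
    also have "\<dots> = \<kappa>0 + (- \<kappa>0 * cnj (F ?c)) * F z"
    proof -
      have "k * (1 - x * y) = k + (- k * x) * y" for k x y :: complex by (simp add: algebra_simps)
      thus ?thesis .
    qed
    also have "\<dots> = z * \<kappa> z - \<kappa>' z" by (rule adjT_eq[OF T z, symmetric])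
    finally show "(z - ?c) * v z = ?c * \<kappa> z + (-1) * \<kappa>' z"
      unfolding v_def by (simp add: algebra_simps)
  qed (rule K_lin[OF k])
  moreover have "ker ?c = (\<lambda>z. 1 * v z + 1 * \<kappa> z)" unfolding v_def by simp
  ultimately show ?thesis using K_lin[OF _ k(1), of v 1 1] by simp
qed

lemma adjT_ker_real: "adjT (ker (of_real c)) (\<lambda>z. of_real c * ker (of_real c) z) \<kappa>0 (- \<kappa>0 * cnj (F (of_real c)))"
  using adjT_ker_gen[OF ker_real_K, of c] by simp

text \<open>Orthogonality turns \<open>u z\<close> into the pairing of \<open>u\<close> with
  \<open>ker z - ker c\<close>, which is of order \<open>|z - c|\<close> by the Lipschitz estimate.
  So the quotient stays bounded near \<open>c\<close>, and \<open>H2_local_bound\<close>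
  applies.\<close>

lemma K_divide_at_real:
  assumes u: "u \<in> K" and orth: "h2_inner u (ker (of_real c)) = 0"
  obtains v where "v \<in> K" "\<And>z. Im z > 0 \<Longrightarrow> (z - of_real c) * v z = u z"
proof -
  let ?c = "of_real c :: complex"
  obtain r C where r: "r > 0" "C \<ge> 0"
    "\<And>z. Im z > 0 \<Longrightarrow> cmod (z - ?c) \<le> r \<Longrightarrow> h2_norm (\<lambda>\<zeta>. ker z \<zeta> - ker ?c \<zeta>) \<le> C * cmod (z - ?c)"
    by (rule ker_real_estimates) (rule that; assumption)
  define v where "v = (\<lambda>z. u z / (z - ?c))"
  have ne: "z - ?c \<noteq> 0" if "Im z > 0" for z using that by (auto simp: complex_eq_iff)
  have v: "(z - ?c) * v z = u z" if "Im z > 0" for z unfolding v_def using ne[OF that] by simp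
  note uH = K_H2[OF u]
  have "v \<in> H2"
  proof (rule H2_local_bound[OF uH, where p = ?c and r = r and B = "h2_norm u * C"])
    show "v holomorphic_on upper_half_plane"
      unfolding v_def using ne by (intro holomorphic_intros H2_holomorphic[OF uH]) (auto simp: upper_half_plane_def)
    show "cmod (v z) \<le> h2_norm u * C" if z: "Im z > 0" "cmod (z - ?c) \<le> r" for z
    proof -
      have e: "u z = h2_inner u (\<lambda>\<zeta>. 1 * ker z \<zeta> + (-1) * ker ?c \<zeta>)"
        unfolding h2_inner_lin_right[OF K_H2[OF ker_K[OF z(1)]] ker_real_H2 uH] ker_reproducing[OF u z(1)] orth by simp
      have "cmod (u z) \<le> h2_norm u * h2_norm (\<lambda>\<zeta>. 1 * ker z \<zeta> + (-1) * ker ?c \<zeta>)"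
        unfolding e by (intro h2_cauchy_schwarz uH H2_lin K_H2[OF ker_K[OF z(1)]] ker_real_H2)
      also have "\<dots> \<le> h2_norm u * (C * cmod (z - ?c))"
        using r(3)[OF z] by (intro mult_left_mono h2_norm_nonneg uH) simp
      finally show ?thesis unfolding v_def using ne[OF z(1)] by (simp add: norm_divide field_simps)
    qed
    show "cmod (v z) \<le> cmod (u z) / r" if "Im z > 0" "r < cmod (z - ?c)" for z
    proof -
      have "cmod (z - ?c) > 0" using that r(1) by linarith
      thus ?thesis unfolding v_def norm_divide using that r(1) by (intro divide_left_mono mult_pos_pos) auto
    qed
  qed (use r H2_vanish[OF uH] in \<open>auto simp: v_def\<close>)
  from K_divide_real[OF u this v] v show ?thesis using that by blast
qed

text \<open>The values of the real kernel on the vertical half-line above \<open>c\<close> have two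
  limits: the squared norm, by the reproducing property and the Lipschitz estimate, and the stated
  derivative, by the formula of the kernel. The latter uses \<open>cnj (F c) * F c = 1\<close> to
  exhibit a difference quotient of \<open>F\<close>.\<close>

lemma ker_real_norm:
  "of_real ((h2_norm (ker (of_real c)))\<^sup>2) = - \<kappa>0 * cnj (F (of_real c)) * deriv F (of_real c)"
proof -
  let ?c = "of_real c :: complex"
  obtain r C where r: "r > 0" "C \<ge> 0"
    "\<And>z. Im z > 0 \<Longrightarrow> cmod (z - ?c) \<le> r \<Longrightarrow> h2_norm (\<lambda>\<zeta>. ker z \<zeta> - ker ?c \<zeta>) \<le> C * cmod (z - ?c)"
    by (rule ker_real_estimates) (rule that; assumption)
  define z where "z \<eta> = ?c + \<i> * of_real \<eta>" for \<eta> :: real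
  let ?n = "of_real ((h2_norm (ker ?c))\<^sup>2) :: complex"
  have zi: "Im (z \<eta>) > 0" "cmod (z \<eta> - ?c) = \<eta>" if "\<eta> > 0" for \<eta>
    using that unfolding z_def by (auto simp: norm_mult)
  have "cmod (ker ?c (z \<eta>) - ?n) \<le> h2_norm (ker ?c) * C * \<eta>" if \<eta>: "\<eta> > 0" "\<eta> \<le> r" for \<eta>
  proof -
    note k = K_H2[OF ker_K[OF zi(1)[OF \<eta>(1)]]]
    have e: "ker ?c (z \<eta>) - ?n = h2_inner (ker ?c) (\<lambda>\<zeta>. 1 * ker (z \<eta>) \<zeta> + (-1) * ker ?c \<zeta>)"
      unfolding h2_inner_lin_right[OF k ker_real_H2 ker_real_H2] ker_reproducing[OF ker_real_K zi(1)[OF \<eta>(1)]]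
        h2_inner_self[OF ker_real_H2] by simp
    have "cmod (ker ?c (z \<eta>) - ?n) \<le> h2_norm (ker ?c) * h2_norm (\<lambda>\<zeta>. 1 * ker (z \<eta>) \<zeta> + (-1) * ker ?c \<zeta>)"
      unfolding e by (intro h2_cauchy_schwarz H2_lin k ker_real_H2)
    also have "\<dots> \<le> h2_norm (ker ?c) * (C * \<eta>)"
      using r(3)[of "z \<eta>"] zi[OF \<eta>(1)] \<eta>(2) by (intro mult_left_mono h2_norm_nonneg ker_real_H2) simp
    finally show ?thesis by simp
  qed
  hence bd: "\<forall>\<^sub>F \<eta> in at_right 0. norm (ker ?c (z \<eta>) - ?n) \<le> h2_norm (ker ?c) * C * \<eta>"
    using r(1) eventually_at_right_field by (metis (no_types, lifting) less_eq_real_def)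
  have "((\<lambda>\<eta>. h2_norm (ker ?c) * C * \<eta>) \<longlongrightarrow> h2_norm (ker ?c) * C * 0) (at_right 0)" by (intro tendsto_intros)
  hence "((\<lambda>\<eta>. h2_norm (ker ?c) * C * \<eta>) \<longlongrightarrow> 0) (at_right 0)" by simp
  from Lim_null_comparison[OF bd this]
  have l1: "((\<lambda>\<eta>. ker ?c (z \<eta>)) \<longlongrightarrow> ?n) (at_right 0)" by (rule LIM_zero_cancel)
  have "(F has_field_derivative deriv F ?c) (at ?c)"
    using F_analytic[of c] analytic_on_imp_differentiable_at DERIV_deriv_iff_field_differentiable by blast
  hence D: "((\<lambda>w. (F w - F ?c) / (w - ?c)) \<longlongrightarrow> deriv F ?c) (at ?c)" by (simp add: has_field_derivative_iff)
  have fl: "filterlim z (at ?c) (at_right 0)"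
  proof (rule filterlim_atI)
    have "(z \<longlongrightarrow> ?c + \<i> * of_real 0) (at_right 0)" unfolding z_def by (intro tendsto_intros)
    thus "(z \<longlongrightarrow> ?c) (at_right 0)" by simp
    show "\<forall>\<^sub>F \<eta> in at_right 0. z \<eta> \<noteq> ?c"
      using eventually_at_right_pos by eventually_elim (simp add: z_def)
  qed
  have "((\<lambda>\<eta>. - \<kappa>0 * cnj (F ?c) * ((F (z \<eta>) - F ?c) / (z \<eta> - ?c))) \<longlongrightarrow> - \<kappa>0 * cnj (F ?c) * deriv F ?c) (at_right 0)"
    by (intro tendsto_mult tendsto_const filterlim_compose[OF D fl])
  moreover have "\<forall>\<^sub>F \<eta> in at_right 0. - \<kappa>0 * cnj (F ?c) * ((F (z \<eta>) - F ?c) / (z \<eta> - ?c)) = ker ?c (z \<eta>)"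
    using eventually_at_right_pos
  proof eventually_elim
    case (elim \<eta>)
    have "cnj (F ?c) * F ?c = 1" using F_real[of c] complex_norm_square[of "F ?c"] by (simp add: mult.commute)
    hence "1 - cnj (F ?c) * F (z \<eta>) = - cnj (F ?c) * (F (z \<eta>) - F ?c)" by (simp add: algebra_simps)
    moreover have "- k * x * (y / d) = k * (- x * y) / d" for k x y d :: complex by simp
    ultimately show ?case using zi[OF elim] unfolding ker_def by simp
  qed
  ultimately have l2: "((\<lambda>\<eta>. ker ?c (z \<eta>)) \<longlongrightarrow> - \<kappa>0 * cnj (F ?c) * deriv F ?c) (at_right 0)"
    by (rule Lim_transform_eventually)
  show ?thesis by (rule tendsto_unique[OF _ l1 l2]) simp
qed

lemma h2_inner_zero_left: "f \<in> H2 \<Longrightarrow> h2_inner (\<lambda>z. 0) f = 0"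
  using h2_inner_lin_left[of f f f 0 0] by simp

text \<open>A vanishing kernel would have boundary coordinates 0, but its first coordinate is
  \<open>\<kappa>0\<close>.\<close>

lemma ker_real_norm_pos: "h2_norm (ker (of_real c)) > 0"
proof (rule ccontr)
  let ?c = "of_real c :: complex"
  assume "\<not> h2_norm (ker ?c) > 0"
  hence "h2_norm (ker ?c) = 0" using h2_norm_nonneg[OF ker_real_H2, of c] by simp
  hence z: "ker ?c = (\<lambda>z. 0)" by (rule h2_norm_zero_imp[OF ker_real_H2])
  have "adjT (ker ?c) (\<lambda>z. 0 * ker ?c z + 0 * ker ?c z) 0 0"
    unfolding adjT_def z using ker_real_K[of c, unfolded z] by simp
  moreover have "(\<lambda>z'. 0 * ker ?c z' + 0 * ker ?c z') = (\<lambda>z. ?c * ker ?c z)" unfolding z by simp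
  ultimately have "adjT (ker ?c) (\<lambda>z. ?c * ker ?c z) 0 0" by simp
  from adjT_unique(1)[OF this adjT_ker_real] show False by simp
qed

text \<open>Pick an adjoint pair \<open>\<kappa>\<close>, \<open>\<kappa>'\<close> with coordinates
  1 and \<open>- cnj \<alpha>\<close> and put \<open>p = c \<kappa> - \<kappa>'\<close>. If
  \<open>v\<close> in \<open>K\<close> is the quotient of \<open>g + a p\<close> by
  \<open>z - c\<close>, then \<open>f = a \<kappa> + v\<close> is the solution. Divisibility is one
  linear condition, met by a suitable \<open>a\<close> because the functional does not vanish at
  \<open>p\<close>: off the axis since \<open>|F| < 1\<close> at \<open>c\<close> or
  \<open>cnj c\<close>, on it since \<open>F c \<noteq> \<alpha>\<close>.\<close>

lemma shifted_surjective:
  assumes \<alpha>: "cmod \<alpha> = 1" and c: "Im c \<noteq> 0 \<or> F c \<noteq> \<alpha>" and g: "g \<in> K"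
  obtains f a where "f \<in> K" "\<And>z. Im z > 0 \<Longrightarrow> (z - c) * f z = g z + a * (1 - cnj \<alpha> * F z)"
proof -
  obtain \<kappa> \<kappa>' where T: "adjT \<kappa> \<kappa>' 1 (- cnj \<alpha>)" by (rule adjT_exists)
  note k = adjT_K[OF T]
  have Te: "z * \<kappa> z - \<kappa>' z = 1 - cnj \<alpha> * F z" if "Im z > 0" for z using adjT_eq[OF T that] by simp
  define p where "p = (\<lambda>z. c * \<kappa> z + (-1) * \<kappa>' z)"
  have p: "p \<in> K" unfolding p_def by (rule K_lin[OF k])
  define u where "u a = (\<lambda>z. 1 * g z + a * p z)" for a
  have u: "u a \<in> K" for a unfolding u_def by (rule K_lin[OF g p])
  have "\<exists>a v. v \<in> K \<and> (\<forall>z. Im z > 0 \<longrightarrow> (z - c) * v z = u a z)"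
  proof -
    consider (up) "Im c > 0" | (re) "Im c = 0" "F c \<noteq> \<alpha>" | (lo) "Im c < 0" using c by linarith
    thus ?thesis
    proof cases
      case up
      have "cmod (cnj \<alpha> * F c) < 1" using F_lt_1[OF up] \<alpha> by (simp add: norm_mult)
      hence "p c \<noteq> 0" using Te[OF up] unfolding p_def by auto
      hence "u (- g c / p c) c = 0" unfolding u_def by simp
      from K_divide_upper[OF u up this] show ?thesis by metis
    next
      case re
      define x where "x = Re c"
      have cx: "c = of_real x" unfolding x_def using re(1) by (simp add: complex_eq_iff)
      have e2: "h2_inner \<kappa> (\<lambda>z. c * ker c z) = c * h2_inner \<kappa> (ker c)"
        using h2_inner_lin_right[OF ker_real_H2[of x] ker_real_H2[of x] K_H2[OF k(1)], of c 0] unfolding cx by simp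
      have e1: "h2_inner \<kappa>' (ker c) - h2_inner \<kappa> (\<lambda>z. c * ker c z) = - (2 * pi * \<i>) * (1 * cnj \<kappa>0 - (- cnj \<alpha>) * cnj (- \<kappa>0 * cnj (F c)))"
        unfolding cx by (rule green[OF T adjT_ker_real])
      \<comment> \<open>As \<open>c\<close> is real, this pairing is a Green form and can be read
        off from the boundary coordinates of \<open>\<kappa>\<close> and
        \<open>ker c\<close>.\<close>
      have "h2_inner p (ker c) = - (h2_inner \<kappa>' (ker c) - h2_inner \<kappa> (\<lambda>z. c * ker c z))"
        unfolding e2 unfolding p_def cx h2_inner_lin_left[OF K_H2[OF k(1)] K_H2[OF k(2)] ker_real_H2] by simp
      also have "\<dots> = (2 * pi * \<i>) * (1 * cnj \<kappa>0 - (- cnj \<alpha>) * cnj (- \<kappa>0 * cnj (F c)))"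
        unfolding e1 by simp
      also have "\<dots> = (2 * pi * \<i>) * cnj \<kappa>0 * (1 - cnj \<alpha> * F c)" by (simp add: algebra_simps)
      finally have e: "h2_inner p (ker c) = (2 * pi * \<i>) * cnj \<kappa>0 * (1 - cnj \<alpha> * F c)" .
      have "1 - cnj \<alpha> * F c \<noteq> 0"
      proof
        assume "1 - cnj \<alpha> * F c = 0"
        hence "\<alpha> * (cnj \<alpha> * F c) = \<alpha>" by simp
        moreover have "\<alpha> * cnj \<alpha> = 1" using complex_norm_square[of \<alpha>] \<alpha> by simp
        ultimately show False using re(2) by (simp add: mult.assoc[symmetric])
      qed
      hence ne: "h2_inner p (ker c) \<noteq> 0" unfolding e by simp
      define a where "a = - h2_inner g (ker c) / h2_inner p (ker c)"
      have "h2_inner (u a) (ker c) = 0"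
        unfolding u_def cx h2_inner_lin_left[OF K_H2[OF g] K_H2[OF p] ker_real_H2] using ne unfolding a_def cx by simp
      from K_divide_at_real[OF u this[unfolded cx]] show ?thesis unfolding cx by metis
    next
      case lo
      define w where "w = cnj c"
      have w: "Im w > 0" "c = cnj w" unfolding w_def using lo by auto
      note s = szego_H2[OF w(1)]
      have ne: "z - c \<noteq> 0" if "Im z > 0" for z using that lo by (auto simp: complex_eq_iff)
      \<comment> \<open>Below the axis the quotient always lies in \<open>H2\<close>; what remains
        is the single relation \<open>l = 0\<close> demanded by
        \<open>K_divide_lower\<close>.\<close>
      define q where "q h = (\<lambda>z. 1 / (z - c) * h z)" for h :: "complex \<Rightarrow> complex"
      have q: "q h \<in> H2" if "h \<in> K" for h unfolding q_def by (rule H2_divide_lower[OF K_H2[OF that] lo])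
      define l where "l h = h2_inner h (mulF (szego w))" for h
      \<comment> \<open>This is \<open>(1 - cnj \<alpha> * F z) / (z - c)\<close>, written through
        the Szego kernel at \<open>w = cnj c\<close> so that its pairing with
        \<open>mulF (szego w)\<close> becomes explicit.\<close>
      let ?m = "\<lambda>z. (1 / \<kappa>0) * szego w z + (- cnj \<alpha> / \<kappa>0) * mulF (szego w) z"
      have mH: "?m \<in> H2" by (rule H2_lin[OF s mulF_H2[OF s]])
      have qp: "q p = (\<lambda>z. 1 * ?m z + (-1) * \<kappa> z)"
      proof
        fix z show "q p z = 1 * ?m z + (-1) * \<kappa> z"
        proof (cases "Im z > 0")
          case True
          have "p z = (1 - cnj \<alpha> * F z) - (z - c) * \<kappa> z" unfolding p_def Te[OF True, symmetric] by (simp add: algebra_simps)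
          hence "q p z = (1 - cnj \<alpha> * F z) / (z - c) - \<kappa> z" unfolding q_def using ne[OF True] by (simp add: diff_divide_distrib)
          moreover have "(1 / k) * (k / d) + (- a / k) * (x * (k / d)) = (1 - a * x) / d" if "k \<noteq> 0" for a k d x :: complex
            using that by (simp add: diff_divide_distrib)
          from this[of \<kappa>0 "z - c" "cnj \<alpha>" "F z"]
          have "?m z = (1 - cnj \<alpha> * F z) / (z - c)"
            using True unfolding szego_def mult_fun_def w(2)[symmetric] by simp
          ultimately show ?thesis by simp
        qed (use H2_vanish[OF K_H2[OF p]] H2_vanish[OF K_H2[OF k(1)]] in \<open>auto simp: q_def szego_def mult_fun_def\<close>)
      qed
      have sF: "h2_inner (szego w) (mulF (szego w)) = cnj (F w * szego w w)"
        using h2_inner_cnj[OF mulF_H2[OF s] s] szego_reproducing[OF mulF_H2[OF s] w(1)] w(1) by (simp add: mult_fun_def)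
      have "l (q p) = h2_inner ?m (mulF (szego w))"
        unfolding l_def qp h2_inner_lin_left[OF mH K_H2[OF k(1)] mulF_H2[OF s]] K_orth[OF k(1) s] by simp
      also have "\<dots> = (1 / \<kappa>0) * cnj (F w * szego w w) + (- cnj \<alpha> / \<kappa>0) * szego w w"
        unfolding h2_inner_lin_left[OF s mulF_H2[OF s] mulF_H2[OF s]] mulF_isometry[OF s s] sF szego_self(2)[OF w(1)] ..
      also have "\<dots> = (1 / \<kappa>0) * szego w w * (cnj (F w) - cnj \<alpha>)"
      proof -
        have "cnj (szego w w) = szego w w" unfolding szego_self(1)[OF w(1)] by simp
        moreover have "(1 / k) * (x * y) + (- a / k) * y = (1 / k) * y * (x - a)" if "k \<noteq> 0" for a k x y :: complex
          using that by (simp add: field_simps)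
        from this[of \<kappa>0 "cnj (F w)" "szego w w" "cnj \<alpha>"]
        have "(1 / \<kappa>0) * (cnj (F w) * szego w w) + (- cnj \<alpha> / \<kappa>0) * szego w w = (1 / \<kappa>0) * szego w w * (cnj (F w) - cnj \<alpha>)"
          by simp
        ultimately show ?thesis unfolding complex_cnj_mult by (simp only:)
      qed
      finally have lp: "l (q p) = (1 / \<kappa>0) * szego w w * (cnj (F w) - cnj \<alpha>)" .
      have "F w \<noteq> \<alpha>" using F_lt_1[OF w(1)] \<alpha> by auto
      hence "cnj (F w) - cnj \<alpha> \<noteq> 0" by (metis complex_cnj_cancel_iff right_minus_eq)
      hence ne': "l (q p) \<noteq> 0" unfolding lp szego_self(1)[OF w(1)] using w(1) by simp
      define a where "a = - l (q g) / l (q p)"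
      have "q (u a) = (\<lambda>z. 1 * q g z + a * q p z)" unfolding q_def u_def by (auto simp: algebra_simps)
      hence "l (q (u a)) = l (q g) + a * l (q p)"
        unfolding l_def using h2_inner_lin_left[OF q[OF g] q[OF p] mulF_H2[OF s], of 1 a] by simp
      also have "\<dots> = 0" unfolding a_def using ne' by simp
      finally have "h2_inner (q (u a)) (mulF (szego w)) = 0" unfolding l_def .
      moreover have e: "(z - c) * q (u a) z = u a z" if "Im z > 0" for z unfolding q_def using ne[OF that] by simp
      ultimately have "q (u a) \<in> K" by (intro K_divide_lower[OF u w(1) q[OF u]]) (auto simp: w(2)[symmetric])
      with e show ?thesis by blast
    qed
  qed
  then obtain a v where v: "v \<in> K" "\<And>z. Im z > 0 \<Longrightarrow> (z - c) * v z = u a z" by blast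
  show ?thesis
  proof (rule that[of "\<lambda>z. a * \<kappa> z + 1 * v z" a, OF K_lin[OF k(1) v(1)]])
    fix z assume z: "Im z > 0"
    have "(z - c) * (a * \<kappa> z + 1 * v z) = a * ((z - c) * \<kappa> z) + (g z + a * (c * \<kappa> z - \<kappa>' z))"
      using v(2)[OF z] unfolding u_def p_def by (simp add: algebra_simps)
    also have "\<dots> = g z + a * (z * \<kappa> z - \<kappa>' z)" by (simp add: algebra_simps)
    finally show "(z - c) * (a * \<kappa> z + 1 * v z) = g z + a * (1 - cnj \<alpha> * F z)" unfolding Te[OF z] .
  qed
qed

text \<open>By surjectivity below the axis there is an adjoint pair \<open>p\<close>,
  \<open>q\<close> with \<open>q - cnj w p = g - cnj w f\<close>. Then the adjoint sends
  \<open>\<phi> = f - p\<close> to \<open>cnj w \<phi>\<close>, so \<open>\<phi>\<close> is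
  orthogonal to the range of \<open>M\<^sup>F - w\<close> and has to be a multiple of
  \<open>ker w\<close>; hence the pair \<open>f\<close>, \<open>g\<close> is a sum of known adjoint
  pairs.\<close>

lemma adjoint_adjT:
  assumes f: "f \<in> K" and g: "g \<in> K"
    and adj: "\<And>h. h \<in> MF_domain F \<Longrightarrow> h2_inner (mult_z h) f = h2_inner h g"
  obtains a b where "adjT f g a b"
proof -
  define w where "w = \<i>"
  have w: "Im w > 0" unfolding w_def by simp
  define u where "u = (\<lambda>z. 1 * g z + (- cnj w) * f z)"
  have u: "u \<in> K" unfolding u_def by (rule K_lin[OF g f])
  obtain p a where p: "p \<in> K" "\<And>z. Im z > 0 \<Longrightarrow> (z - cnj w) * p z = u z + a * (1 - cnj 1 * F z)"
    using shifted_surjective[of 1 "cnj w" u] u w by auto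
  define q where "q = (\<lambda>z. 1 * u z + cnj w * p z)"
  have q: "q \<in> K" unfolding q_def by (rule K_lin[OF u p(1)])
  have T: "adjT p q a (- a)"
    unfolding adjT_def using p q by (auto simp: q_def algebra_simps)
  define \<phi> where "\<phi> = (\<lambda>z. 1 * f z + (-1) * p z)"
  have \<phi>: "\<phi> \<in> K" unfolding \<phi>_def by (rule K_lin[OF f p(1)])
  \<comment> \<open>By \<open>K_divide_upper\<close> the elements vanishing at \<open>w\<close> are
    of the form \<open>(z - w) h\<close> with \<open>h\<close> in the domain of
    \<open>M\<^sup>F\<close>.\<close>
  have orth: "h2_inner v \<phi> = 0" if v: "v \<in> K" "v w = 0" for v
  proof -
    obtain h where h: "h \<in> K" "\<And>z. Im z > 0 \<Longrightarrow> (z - w) * h z = v z" using K_divide_upper[OF v(1) w v(2)] by metis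
    have "adjT h (\<lambda>z. 1 * v z + w * h z) 0 0"
      unfolding adjT_def using h v K_lin[OF v(1) h(1), of 1 w] by (auto simp: algebra_simps)
    hence m: "h \<in> MF_domain F" "mult_z h = (\<lambda>z. 1 * v z + w * h z)" unfolding adjT_MF by auto
    have mH: "mult_z h \<in> H2" using m by (simp add: MF_domain_def K_H2)
    note H = K_H2[OF h(1)]
    have "h2_inner (mult_z h) \<phi> = h2_inner h g - h2_inner h q"
      unfolding \<phi>_def h2_inner_lin_right[OF K_H2[OF f] K_H2[OF p(1)] mH] adj[OF m(1)] green_MF[OF m(1) T] by simp
    also have "\<dots> = w * h2_inner h \<phi>"
    proof -
      have "(\<lambda>z. 1 * g z + (-1) * q z) = (\<lambda>z. cnj w * \<phi> z + 0 * \<phi> z)"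
        unfolding q_def u_def \<phi>_def by (auto simp: algebra_simps)
      hence "h2_inner h (\<lambda>z. 1 * g z + (-1) * q z) = h2_inner h (\<lambda>z. cnj w * \<phi> z + 0 * \<phi> z)" by simp
      thus ?thesis
        unfolding h2_inner_lin_right[OF K_H2[OF g] K_H2[OF q] H] h2_inner_lin_right[OF K_H2[OF \<phi>] K_H2[OF \<phi>] H] by simp
    qed
    finally show ?thesis
      unfolding m(2) h2_inner_lin_left[OF K_H2[OF v(1)] H K_H2[OF \<phi>]] by simp
  qed
  define c where "c = \<phi> w / ker w w"
  define v where "v = (\<lambda>z. 1 * \<phi> z + (- c) * ker w z)"
  note kw = ker_K[OF w]
  have v: "v \<in> K" unfolding v_def by (rule K_lin[OF \<phi> kw])
  have vw: "v w = 0" unfolding v_def c_def using ker_self(3)[OF w] by simp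
  have "h2_inner v v = h2_inner v \<phi> - cnj c * h2_inner v (ker w)"
    by (subst (2) v_def, subst h2_inner_lin_right) (auto intro: K_H2 \<phi> kw v)
  also have "\<dots> = 0" using orth[OF v vw] ker_reproducing[OF v w] vw by simp
  finally have "h2_norm v = 0" using h2_inner_self[OF K_H2[OF v]] by simp
  hence v0: "v = (\<lambda>z. 0)" by (rule h2_norm_zero_imp[OF K_H2[OF v]])
  have \<phi>e: "\<phi> z = c * ker w z" for z using fun_cong[OF v0, of z] unfolding v_def by simp
  have "adjT (\<lambda>z. 1 * p z + c * ker w z) (\<lambda>z. 1 * q z + c * (cnj w * ker w z)) (1 * a + c * \<kappa>0) (1 * (- a) + c * (- \<kappa>0 * cnj (F w)))"
    by (rule adjT_lin[OF T adjT_ker[OF w]])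
  moreover have "(\<lambda>z. 1 * p z + c * ker w z) = f" unfolding \<phi>e[symmetric] \<phi>_def by simp
  moreover have "(\<lambda>z. 1 * q z + c * (cnj w * ker w z)) = g"
  proof
    fix z
    have "1 * q z + c * (cnj w * ker w z) = q z + cnj w * \<phi> z" unfolding \<phi>e by simp
    thus "1 * q z + c * (cnj w * ker w z) = g z" unfolding q_def u_def \<phi>_def by (simp add: algebra_simps)
  qed
  ultimately show ?thesis using that by simp
qed

end

context mero_inner begin

section \<open>Self-adjoint extensions\<close>

text \<open>Symmetry of \<open>M\<^sup>F\<close> makes the pairing of \<open>z f\<close> with
  \<open>f\<close> real, whereas for \<open>f = ker w\<close> Green's formula evaluates it to
  \<open>w\<close> times a nonzero real number.\<close>

lemma ker_not_MF: assumes w: "Im w > 0" shows "ker w \<notin> MF_domain F"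
proof
  assume m: "ker w \<in> MF_domain F"
  note k = K_H2[OF ker_K[OF w]]
  have mH: "mult_z (ker w) \<in> H2" using m by (simp add: MF_domain_def K_H2)
  have "h2_inner (mult_z (ker w)) (ker w) = h2_inner (ker w) (\<lambda>z. cnj w * ker w z)"
    by (rule green_MF[OF m adjT_ker[OF w]])
  also have "\<dots> = w * ker w w"
    using h2_inner_lin_right[OF k k k, of "cnj w" 0] ker_reproducing[OF ker_K[OF w] w] by simp
  finally have 1: "h2_inner (mult_z (ker w)) (ker w) = w * ker w w" .
  have "h2_inner (mult_z (ker w)) (ker w) = cnj (h2_inner (mult_z (ker w)) (ker w))"
    using green_MF[OF m MF_adjT[OF m]] h2_inner_cnj[OF mH k] by simp
  hence "w * ker w w = cnj (w * ker w w)" unfolding 1 .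
  moreover have "cnj (ker w w) = ker w w" unfolding ker_self(1)[OF w] by simp
  ultimately have "w = cnj w" using ker_self(3)[OF w] by simp
  thus False using w by (simp add: complex_eq_iff)
qed

text \<open>Quantifying over pairs \<open>f\<close>, \<open>g\<close> makes the graph of
  \<open>A\<close> on \<open>D\<close> equal to the whole part of the adjoint graph on the line
  \<open>b = - cnj \<alpha> * a\<close>; single-valuedness of that part is included.\<close>

definition boundary_extension :: "complex \<Rightarrow> (complex \<Rightarrow> complex) set \<Rightarrow> ((complex \<Rightarrow> complex) \<Rightarrow> (complex \<Rightarrow> complex)) \<Rightarrow> bool" where
  "boundary_extension \<alpha> D A \<longleftrightarrow> cmod \<alpha> = 1 \<and> (\<forall>f g. (\<exists>a. adjT f g a (- cnj \<alpha> * a)) \<longleftrightarrow> f \<in> D \<and> g = A f)"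

lemma unimodular_eq: "cmod \<alpha> = 1 \<Longrightarrow> \<alpha> * cnj \<alpha> = 1"
  using complex_norm_square[of \<alpha>] by simp

lemma green_same_condition:
  assumes "cmod \<alpha> = 1" "adjT f g a (- cnj \<alpha> * a)" "adjT p q b (- cnj \<alpha> * b)"
  shows "h2_inner g p = h2_inner f q"
proof -
  have "a * cnj b - (- cnj \<alpha> * a) * cnj (- cnj \<alpha> * b) = a * cnj b * (1 - \<alpha> * cnj \<alpha>)" by (simp add: algebra_simps)
  hence "a * cnj b - (- cnj \<alpha> * a) * cnj (- cnj \<alpha> * b) = 0" unfolding unimodular_eq[OF assms(1)] by simp
  have "h2_inner g p - h2_inner f q = 0"
    unfolding green[OF assms(2,3)] \<open>_ = 0\<close> by simp
  thus ?thesis by simp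
qed

text \<open>If \<open>c\<close> is real and \<open>F c = \<alpha>\<close>, the coordinates of
  \<open>ker c\<close> lie on the line of the extension, so \<open>ker c\<close> is an eigenvector.
  For all other \<open>c\<close> surjectivity is \<open>shifted_surjective\<close>, and injectivity
  reduces to the absence of eigenvectors.\<close>

lemma boundary_extension_spectrum:
  assumes E: "boundary_extension \<alpha> D A"
  shows "op_spectrum F D A = {c. Im c = 0 \<and> F c = \<alpha>}"
proof -
  have \<alpha>: "cmod \<alpha> = 1" and G: "\<And>f g. (\<exists>a. adjT f g a (- cnj \<alpha> * a)) \<longleftrightarrow> f \<in> D \<and> g = A f"
    using E unfolding boundary_extension_def by auto
  let ?S = "\<lambda>c f z. A f z - c * f z"
  have "\<not> bij_betw (?S c) D K" if c: "Im c = 0" "F c = \<alpha>" for c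
  proof
    assume b: "bij_betw (?S c) D K"
    have cx: "c = of_real (Re c)" using c(1) by (simp add: complex_eq_iff)
    have "adjT (ker c) (\<lambda>z. c * ker c z) \<kappa>0 (- \<kappa>0 * cnj (F c))" by (subst (1 2 3 4) cx) (rule adjT_ker_real)
    hence "adjT (ker c) (\<lambda>z. c * ker c z) \<kappa>0 (- cnj \<alpha> * \<kappa>0)" unfolding c(2) by (simp add: mult.commute)
    hence k: "ker c \<in> D" "A (ker c) = (\<lambda>z. c * ker c z)" using G by metis+
    have "(\<lambda>z. 0) \<in> K" using K_zero[OF ker_real_K] .
    hence "adjT (\<lambda>z. 0) (\<lambda>z. 0) 0 (- cnj \<alpha> * 0)" by (simp add: adjT_def)
    hence z: "(\<lambda>z. 0) \<in> D" "A (\<lambda>z. 0) = (\<lambda>z. 0)" using G by metis+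
    have "?S c (ker c) = ?S c (\<lambda>z. 0)" unfolding k z by simp
    with b k z have "ker c = (\<lambda>z. 0)" unfolding bij_betw_def by (meson inj_onD)
    moreover have "h2_norm (ker c) > 0" by (subst cx) (rule ker_real_norm_pos)
    ultimately show False using h2_inner_zero_left[OF H2_zero] unfolding h2_norm_def by simp
  qed
  moreover have "bij_betw (?S c) D K" if c: "Im c \<noteq> 0 \<or> F c \<noteq> \<alpha>" for c
  proof -
    \<comment> \<open>A non-real eigenvalue contradicts symmetry. For real \<open>c\<close>, Green's
      formula with \<open>ker c\<close> gives \<open>a * (1 - cnj \<alpha> * F c) = 0\<close>, so
      the coordinates vanish and \<open>(z - c) * d z = 0\<close>.\<close>
    have ker0: "d = (\<lambda>z. 0)" if T: "adjT d (\<lambda>z. c * d z) a (- cnj \<alpha> * a)" for d a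
    proof -
      note d = adjT_K[OF T]
      note dH = K_H2[OF d(1)]
      show ?thesis
      proof (cases "Im c = 0")
        case False
        have "h2_inner (\<lambda>z. c * d z) d = h2_inner d (\<lambda>z. c * d z)" by (rule green_same_condition[OF \<alpha> T T])
        hence "c * h2_inner d d = cnj c * h2_inner d d"
          using h2_inner_lin_left[OF dH dH dH, of c 0] h2_inner_lin_right[OF dH dH dH, of c 0] by simp
        moreover have "c \<noteq> cnj c" using False by (simp add: complex_eq_iff)
        ultimately have "h2_inner d d = 0" by simp
        hence "h2_norm d = 0" using h2_inner_self[OF dH] by simp
        thus ?thesis by (rule h2_norm_zero_imp[OF dH])
      next
        case True
        hence Fc: "F c \<noteq> \<alpha>" using c by simp
        define x where "x = Re c"
        have cx: "c = of_real x" using True unfolding x_def by (simp add: complex_eq_iff)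
        note k = ker_real_H2[of x]
        have "h2_inner (\<lambda>z. c * d z) (ker x) - h2_inner d (\<lambda>z. x * ker x z)
            = - (2 * pi * \<i>) * (a * cnj \<kappa>0 - (- cnj \<alpha> * a) * cnj (- \<kappa>0 * cnj (F x)))"
          by (rule green[OF T adjT_ker_real])
        moreover have "h2_inner (\<lambda>z. c * d z) (ker x) - h2_inner d (\<lambda>z. x * ker x z) = 0"
          using h2_inner_lin_left[OF dH dH k, of c 0] h2_inner_lin_right[OF k k dH, of x 0] unfolding cx by simp
        moreover have "a * cnj k - (- x * a) * cnj (- k * cnj y) = a * cnj k * (1 - x * y)" for k x y by (simp add: algebra_simps)
        ultimately have "(2 * pi * \<i>) * (a * cnj \<kappa>0 * (1 - cnj \<alpha> * F x)) = 0" by simp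
        hence "a = 0 \<or> cnj \<alpha> * F x = 1" by simp
        moreover have "F x = \<alpha>" if "cnj \<alpha> * F x = 1"
        proof -
          have "F x = (\<alpha> * cnj \<alpha>) * F x" unfolding unimodular_eq[OF \<alpha>] by simp
          also have "\<dots> = \<alpha> * (cnj \<alpha> * F x)" by simp
          finally show ?thesis unfolding that by simp
        qed
        ultimately have "a = 0" using Fc unfolding cx by blast
        have "d z = 0" if z: "z \<in> upper_half_plane" for z
        proof -
          have iz: "Im z > 0" using z by (simp add: upper_half_plane_def)
          have "(z - c) * d z = 0" using adjT_eq[OF T iz] \<open>a = 0\<close> by (simp add: left_diff_distrib)
          moreover have "z \<noteq> c" using iz True by auto
          ultimately show ?thesis by simp
        qed
        thus ?thesis using H2_eq_iff[OF dH H2_zero] by simp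
      qed
    qed
    show ?thesis
    proof (rule bij_betw_imageI)
      show "inj_on (?S c) D"
      proof (rule inj_onI)
        fix f f' assume f: "f \<in> D" "f' \<in> D" and eq: "?S c f = ?S c f'"
        obtain a where a: "adjT f (A f) a (- cnj \<alpha> * a)" using G f(1) by blast
        obtain b where b: "adjT f' (A f') b (- cnj \<alpha> * b)" using G f(2) by blast
        have "A f z - A f' z = c * (f z - f' z)" for z using fun_cong[OF eq, of z] by (simp add: algebra_simps)
        hence "(\<lambda>z. 1 * A f z + (-1) * A f' z) = (\<lambda>z. c * (1 * f z + (-1) * f' z))" by simp
        with adjT_lin[OF a b, of 1 "-1"] have "adjT (\<lambda>z. 1 * f z + (-1) * f' z) (\<lambda>z. c * (1 * f z + (-1) * f' z)) (a - b) (- cnj \<alpha> * (a - b))"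
          by (simp add: algebra_simps)
        from ker0[OF this] show "f = f'" by (auto simp: fun_eq_iff)
      qed
      show "?S c ` D = K"
      proof
        show "?S c ` D \<subseteq> K"
        proof
          fix h assume "h \<in> ?S c ` D"
          then obtain f where f: "f \<in> D" "h = ?S c f" by auto
          then obtain a where a: "adjT f (A f) a (- cnj \<alpha> * a)" using G by blast
          show "h \<in> K" using K_lin[OF adjT_K(2,1)[OF a], of 1 "- c"] unfolding f(2) by simp
        qed
        show "K \<subseteq> ?S c ` D"
        proof
          fix g assume g: "g \<in> K"
          obtain f a where f: "f \<in> K" "\<And>z. Im z > 0 \<Longrightarrow> (z - c) * f z = g z + a * (1 - cnj \<alpha> * F z)"
            using shifted_surjective[OF \<alpha> c g] by metis
          have "adjT f (\<lambda>z. 1 * g z + c * f z) a (- cnj \<alpha> * a)"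
            unfolding adjT_def using f K_lin[OF g f(1), of 1 c] by (auto simp: algebra_simps)
          hence "f \<in> D" "A f = (\<lambda>z. 1 * g z + c * f z)" using G by metis+
          thus "g \<in> ?S c ` D" by (intro image_eqI[of _ _ f]) auto
        qed
      qed
    qed
  qed
  ultimately show ?thesis unfolding op_spectrum_def by blast
qed

end

section \<open>Classification of the self-adjoint extensions under density\<close>

locale dense_mero_inner = mero_inner +
  assumes dense: "MF_densely_defined F"
begin

lemma MF_orthogonal_zero:
  assumes f: "f \<in> K" and orth: "\<And>m. m \<in> MF_domain F \<Longrightarrow> h2_inner m f = 0"
  shows "f = (\<lambda>z. 0)"
proof -
  note fH = K_H2[OF f]
  have "h2_norm f \<le> 0"
  proof (rule field_le_epsilon)
    fix e :: real assume e: "e > 0"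
    obtain m where m: "m \<in> MF_domain F" "h2_norm (\<lambda>z. f z - m z) < e"
      using dense f e unfolding MF_densely_defined_def by blast
    have mH: "m \<in> H2" using m(1) by (simp add: MF_domain_def K_H2)
    have "h2_inner (\<lambda>z. 1 * f z + (-1) * m z) f = of_real ((h2_norm f)\<^sup>2)"
      unfolding h2_inner_lin_left[OF fH mH fH] orth[OF m(1)] h2_inner_self[OF fH] by simp
    moreover have "cmod (h2_inner (\<lambda>z. 1 * f z + (-1) * m z) f) \<le> h2_norm (\<lambda>z. 1 * f z + (-1) * m z) * h2_norm f"
      by (intro h2_cauchy_schwarz H2_lin fH mH)
    ultimately have "(h2_norm f)\<^sup>2 \<le> h2_norm (\<lambda>z. f z - m z) * h2_norm f" by (simp add: norm_power)
    also have "\<dots> \<le> e * h2_norm f" using m(2) h2_norm_nonneg[OF fH] by (intro mult_right_mono) auto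
    finally have "h2_norm f * h2_norm f \<le> e * h2_norm f" by (simp add: power2_eq_square)
    thus "h2_norm f \<le> 0 + e" using e h2_norm_nonneg[OF fH]
      by (cases "h2_norm f = 0") (auto simp: mult_le_cancel_right)
  qed
  hence "h2_norm f = 0" using h2_norm_nonneg[OF fH] by simp
  thus ?thesis by (rule h2_norm_zero_imp[OF fH])
qed

text \<open>The difference is an adjoint pair with first component 0; by \<open>green_MF\<close> its
  second component is orthogonal to the dense domain.\<close>

lemma adjT_single_valued:
  assumes "adjT f g a b" "adjT f g' a' b'" shows "g = g'"
proof -
  have T: "adjT (\<lambda>z. 1 * f z + (-1) * f z) (\<lambda>z. 1 * g z + (-1) * g' z) (1 * a + (-1) * a') (1 * b + (-1) * b')"
    by (rule adjT_lin[OF assms])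
  have "(\<lambda>z. 1 * g z + (-1) * g' z) = (\<lambda>z. 0)"
  proof (rule MF_orthogonal_zero[OF adjT_K(2)[OF T]])
    fix m assume m: "m \<in> MF_domain F"
    have mH: "mult_z m \<in> H2" using m by (simp add: MF_domain_def K_H2)
    have "h2_inner m (\<lambda>z. 1 * g z + (-1) * g' z) = h2_inner (mult_z m) (\<lambda>z. 1 * f z + (-1) * f z)"
      by (rule green_MF[OF m T, symmetric])
    thus "h2_inner m (\<lambda>z. 1 * g z + (-1) * g' z) = 0"
      using h2_inner_cnj[OF H2_zero mH] h2_inner_zero_left[OF mH] by simp
  qed
  thus ?thesis by (auto simp: fun_eq_iff)
qed

text \<open>Symmetry makes the set of boundary values isotropic for
  \<open>a cnj a' - b cnj b'\<close>, and maximality forbids it to be trivial. A nontrivial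
  isotropic set lies on one line \<open>b = - cnj \<alpha> a\<close>, and maximality again fills the
  whole line.\<close>

lemma selfadjoint_extension_boundary:
  assumes sa: "selfadjoint_extension F D A"
  obtains \<alpha> where "boundary_extension \<alpha> D A"
proof -
  have DK: "D \<subseteq> K" and AK: "\<And>f. f \<in> D \<Longrightarrow> A f \<in> K"
    and MF: "MF_domain F \<subseteq> D" "\<And>f. f \<in> MF_domain F \<Longrightarrow> A f = mult_z f"
    and sym: "\<And>f g. f \<in> D \<Longrightarrow> g \<in> D \<Longrightarrow> h2_inner (A f) g = h2_inner f (A g)"
    using sa unfolding selfadjoint_extension_def by blast+
  have max: "g \<in> D" if "g \<in> K" "h \<in> K" "\<And>f. f \<in> D \<Longrightarrow> h2_inner (A f) g = h2_inner f h" for g h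
    using sa that unfolding selfadjoint_extension_def by blast
  have T: "\<exists>a b. adjT f (A f) a b" if f: "f \<in> D" for f
  proof -
    have fK: "f \<in> K" using DK f by blast
    have adj: "h2_inner (mult_z h) f = h2_inner h (A f)" if "h \<in> MF_domain F" for h
      using sym[of h f] MF that f by auto
    obtain a b where "adjT f (A f) a b" by (rule adjoint_adjT[OF fK AK[OF f] adj])
    thus ?thesis by blast
  qed
  have iso: "a * cnj a' = b * cnj b'" if "f \<in> D" "p \<in> D" "adjT f (A f) a b" "adjT p (A p) a' b'" for f p a b a' b'
    using green[OF that(3,4)] sym[OF that(1,2)] by simp
  \<comment> \<open>Otherwise isotropy makes \<open>b\<close> vanish together with \<open>a\<close>,
    so \<open>D\<close> is the domain of \<open>M\<^sup>F\<close>; but then \<open>ker \<i>\<close>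
    satisfies the adjoint condition without belonging to it.\<close>
  have "\<exists>f0 a0 b0. f0 \<in> D \<and> adjT f0 (A f0) a0 b0 \<and> a0 \<noteq> 0"
  proof (rule ccontr)
    assume no: "\<not> ?thesis"
    have in_MF: "f \<in> MF_domain F" if f: "f \<in> D" for f
    proof -
      obtain a b where ab: "adjT f (A f) a b" using T[OF f] by blast
      with no f have "a = 0" by blast
      moreover have "b = 0" using iso[OF f f ab ab] \<open>a = 0\<close> by simp
      ultimately show ?thesis using ab by (simp add: adjT_MF)
    qed
    have i: "Im \<i> > 0" by simp
    have "ker \<i> \<in> D"
    proof (rule max[of _ "\<lambda>z. cnj \<i> * ker \<i> z"])
      show "ker \<i> \<in> K" "(\<lambda>z. cnj \<i> * ker \<i> z) \<in> K" using adjT_K[OF adjT_ker[OF i]] by blast+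
      show "h2_inner (A f) (ker \<i>) = h2_inner f (\<lambda>z. cnj \<i> * ker \<i> z)" if "f \<in> D" for f
        using green_MF[OF in_MF[OF that] adjT_ker[OF i]] MF(2)[OF in_MF[OF that]] by simp
    qed
    thus False using in_MF ker_not_MF[OF i] by blast
  qed
  then obtain f0 a0 b0 where f0: "f0 \<in> D" "adjT f0 (A f0) a0 b0" "a0 \<noteq> 0" by blast
  have n0: "a0 * cnj a0 = b0 * cnj b0" by (rule iso[OF f0(1,1,2,2)])
  hence b0: "b0 \<noteq> 0" using f0(3) by auto
  \<comment> \<open>Solves \<open>b0 = - cnj \<alpha> * a0\<close>; isotropy of this pair gives
    \<open>cmod a0 = cmod b0\<close>, hence modulus 1.\<close>
  define \<alpha> where "\<alpha> = - cnj (b0 / a0)"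
  have "complex_of_real ((cmod a0)\<^sup>2) = complex_of_real ((cmod b0)\<^sup>2)" using n0 by (simp only: complex_norm_square)
  hence "(cmod a0)\<^sup>2 = (cmod b0)\<^sup>2" by (simp only: of_real_eq_iff)
  hence "cmod a0 = cmod b0" by (rule power2_eq_imp_eq) auto
  hence \<alpha>: "cmod \<alpha> = 1" unfolding \<alpha>_def using b0 by (simp add: norm_divide)
  have bc: "b = - cnj \<alpha> * a" if "f \<in> D" "adjT f (A f) a b" for f a b
  proof -
    have "a * cnj a0 = b * cnj b0" by (rule iso[OF that(1) f0(1) that(2) f0(2)])
    hence "b = a * (cnj a0 / cnj b0)" using b0 by (simp add: field_simps)
    also have "cnj a0 / cnj b0 = b0 / a0" using n0 b0 f0(3) by (simp add: field_simps)
    finally show ?thesis unfolding \<alpha>_def by simp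
  qed
  have "f \<in> D \<and> g = A f" if E: "adjT f g a (- cnj \<alpha> * a)" for f g a
  proof -
    have f: "f \<in> D"
    proof (rule max[OF adjT_K[OF E]])
      fix p assume p: "p \<in> D"
      obtain c d where "adjT p (A p) c d" using T[OF p] by blast
      with bc[OF p] have "adjT p (A p) c (- cnj \<alpha> * c)" by metis
      thus "h2_inner (A p) f = h2_inner p g" by (rule green_same_condition[OF \<alpha> _ E])
    qed
    obtain c d where "adjT f (A f) c d" using T[OF f] by blast
    with f adjT_single_valued[OF E] show ?thesis by blast
  qed
  moreover have "\<exists>a. adjT f (A f) a (- cnj \<alpha> * a)" if "f \<in> D" for f
    using T[OF that] bc[OF that] by metis
  ultimately have "boundary_extension \<alpha> D A" unfolding boundary_extension_def using \<alpha> by blast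
  thus ?thesis by (rule that)
qed

text \<open>The extension for \<open>\<alpha> = 1\<close>, that is \<open>b = - a\<close>. For its
  maximality one test element with coordinates 1 and -1 suffices: Green's formula with it already
  forces the boundary condition.\<close>

lemma selfadjoint_extension_exists: "\<exists>D A. selfadjoint_extension F D A"
proof -
  define D where "D = {f. \<exists>g a. adjT f g a (- a)}"
  define A where "A f = (SOME g. \<exists>a. adjT f g a (- a))" for f
  have A: "A f = g" if "adjT f g a (- a)" for f g a
  proof -
    have "\<exists>a. adjT f (A f) a (- a)" unfolding A_def by (rule someI[of "\<lambda>g. \<exists>a. adjT f g a (- a)"]) (use that in blast)
    thus ?thesis using adjT_single_valued[OF _ that] by blast
  qed
  have DA: "\<exists>a. adjT f (A f) a (- a)" if "f \<in> D" for f using that A unfolding D_def by blast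
  have in_D: "f \<in> D" if "adjT f g a (- a)" for f g a using that unfolding D_def by blast
  have lin: "(\<lambda>z. a * f z + b * g z) \<in> D \<and> A (\<lambda>z. a * f z + b * g z) = (\<lambda>z. a * A f z + b * A g z)"
    if fg: "f \<in> D" "g \<in> D" for f g a b
  proof -
    obtain c d where c: "adjT f (A f) c (- c)" and d: "adjT g (A g) d (- d)" using DA fg by blast
    have "adjT (\<lambda>z. a * f z + b * g z) (\<lambda>z. a * A f z + b * A g z) (a * c + b * d) (- (a * c + b * d))"
      using adjT_lin[OF c d, of a b] by simp
    thus ?thesis using in_D A by blast
  qed
  have MF: "f \<in> D \<and> A f = mult_z f" if "f \<in> MF_domain F" for f
  proof -
    have "adjT f (mult_z f) 0 (- 0)" using MF_adjT[OF that] by simp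
    thus ?thesis using in_D A by blast
  qed
  have sym: "h2_inner (A f) g = h2_inner f (A g)" if fg: "f \<in> D" "g \<in> D" for f g
  proof -
    obtain c d where c: "adjT f (A f) c (- cnj 1 * c)" and d: "adjT g (A g) d (- cnj 1 * d)" using DA fg by fastforce
    show ?thesis by (rule green_same_condition[OF _ c d]) simp
  qed
  have max: "g \<in> D" if g: "g \<in> K" "h \<in> K" and adj: "\<And>f. f \<in> D \<Longrightarrow> h2_inner (A f) g = h2_inner f h" for g h
  proof -
    have ad: "h2_inner (mult_z m) g = h2_inner m h" if "m \<in> MF_domain F" for m using adj[of m] MF[OF that] by simp
    obtain a b where T: "adjT g h a b" by (rule adjoint_adjT[OF g ad])
    obtain \<kappa> \<kappa>' where S: "adjT \<kappa> \<kappa>' 1 (- 1)" by (rule adjT_exists)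
    have "h2_inner \<kappa>' g = h2_inner \<kappa> h" using adj[OF in_D[OF S]] A[OF S] by simp
    hence "cnj a + cnj b = 0" using green[OF S T] by simp
    hence "b = - a" by (metis add.commute complex_cnj_add complex_cnj_zero_iff eq_neg_iff_add_eq_0)
    with T show ?thesis using in_D by blast
  qed
  have "(\<lambda>z. 0) \<in> D"   proof -
    obtain \<kappa> \<kappa>' where S: "adjT \<kappa> \<kappa>' 1 (- 1)" by (rule adjT_exists)
    show ?thesis using lin[OF in_D[OF S] in_D[OF S], of 0 0] by simp
  qed
  moreover have "D \<subseteq> K" unfolding D_def using adjT_K(1) by blast
  moreover have "A f \<in> K" if "f \<in> D" for f using DA[OF that] adjT_K(2) by blast
  moreover have "\<forall>g\<in>K. (\<exists>h\<in>K. \<forall>f\<in>D. h2_inner (A f) g = h2_inner f h) \<longrightarrow> g \<in> D"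
    using max by blast
  moreover have "\<forall>f\<in>D. \<forall>g\<in>D. h2_inner (A f) g = h2_inner f (A g)" using sym by blast
  moreover have "\<forall>f\<in>D. \<forall>g\<in>D. \<forall>a b. (\<lambda>z. a * f z + b * g z) \<in> D
            \<and> A (\<lambda>z. a * f z + b * g z) = (\<lambda>z. a * A f z + b * A g z)" using lin by blast
  moreover have "MF_domain F \<subseteq> D" "\<forall>f\<in>MF_domain F. A f = mult_z f" using MF by blast+
  ultimately have "selfadjoint_extension F D A"
    unfolding selfadjoint_extension_def by (intro conjI) blast+
  thus ?thesis by blast
qed

end

section \<open>The phase\<close>

text \<open>\<open>R0\<close> is independent of the height: the mass outside the interval at all
  small heights is controlled by that at the single height \<open>y0\<close>, at most
  \<open>2 * (e / 8) + 2 * (e / 8) = e / 2\<close>. The other half of \<open>e\<close> pays for the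
  convergence of the norms.\<close>

lemma H2_mass_on_interval:
  assumes f: "f \<in> H2" and e: "e > 0"
  obtains R0 where "\<And>R. R \<ge> R0 \<Longrightarrow>
    \<forall>\<^sub>F y in at_right 0. (h2_norm f)\<^sup>2 - e \<le> (LINT t|lborel. indicator {-R..R} t * msq f y t)"
proof -
  obtain y0 where y0: "y0 > 0" "\<And>y. 0 < y \<Longrightarrow> y \<le> y0 \<Longrightarrow> l2sq (\<lambda>t. f (Complex t y) - f (Complex t y0)) < e / 8"
    using H2_line_cauchy[OF f, of "e / 8"] e by auto
  define m where "m R t = (1 - indicator {-R..R} t :: real)" for R t :: real
  have sq: "integrable lborel (\<lambda>t. msq f y t)" if "y > 0" for y
    using H2_sq_int[OF f that] by (simp add: sq_int_def)
  have m01: "0 \<le> m R t" "m R t \<le> 1" for R t unfolding m_def by (auto simp: indicator_def)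
  have mm [measurable]: "m R \<in> borel_measurable lborel" for R unfolding m_def by measurable
  have "((\<lambda>R. LINT t|lborel. m R t * msq f y0 t) \<longlongrightarrow> (LINT (t::real)|lborel. (0::real))) at_top"
  proof (rule integral_dominated_convergence_at_top[where w = "\<lambda>t. msq f y0 t"])
    show "AE t in lborel. ((\<lambda>R. m R t * msq f y0 t) \<longlongrightarrow> 0) at_top"
    proof (rule AE_I2)
      fix t
      have "\<forall>\<^sub>F R in at_top. m R t * msq f y0 t = 0"
        using eventually_ge_at_top[of "\<bar>t\<bar>"] by eventually_elim (auto simp: m_def indicator_def)
      thus "((\<lambda>R. m R t * msq f y0 t) \<longlongrightarrow> 0) at_top" by (rule tendsto_eventually)
    qed
    show "\<forall>\<^sub>F R in at_top. AE t in lborel. norm (m R t * msq f y0 t) \<le> msq f y0 t"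
      using m01 by (intro always_eventually allI AE_I2) (auto simp: abs_mult intro!: mult_left_le_one_le)
    show "(\<lambda>t. m R t * msq f y0 t) \<in> borel_measurable lborel" for R
      using mm[of R] borel_measurable_integrable[OF sq[OF y0(1)]] by (intro borel_measurable_times)
  qed (use sq[OF y0(1)] in auto)
  hence "\<forall>\<^sub>F R in at_top. (LINT t|lborel. m R t * msq f y0 t) < e / 8"
    using e by (intro order_tendstoD(2)) auto
  then obtain R0 where R0: "\<And>R. R \<ge> R0 \<Longrightarrow> (LINT t|lborel. m R t * msq f y0 t) < e / 8"
    by (auto simp: eventually_at_top_linorder)
  show ?thesis
  proof (rule that[of R0])
    fix R assume R: "R \<ge> R0"
    have "\<forall>\<^sub>F y in at_right 0. (h2_norm f)\<^sup>2 - e / 2 < l2sq (hline f y)"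
      using e by (intro order_tendstoD(1)[OF l2sq_tendsto_h2_norm[OF f]]) simp
    moreover have "\<forall>\<^sub>F y in at_right 0. y \<le> y0" using eventually_at_right_le[OF y0(1)] by (auto elim: eventually_mono)
    ultimately show "\<forall>\<^sub>F y in at_right 0. (h2_norm f)\<^sup>2 - e \<le> (LINT t|lborel. indicator {-R..R} t * msq f y t)"
      using eventually_at_right_pos
    proof eventually_elim
      case (elim y)
      have i: "integrable lborel (\<lambda>t. indicator {-R..R} t * msq f y t)"
        using integrable_mult_indicator[OF _ sq[OF elim(3)], of "{-R..R}"] by simp
      have "(LINT t|lborel. m R t * msq f y t) \<le> 2 * (e / 8) + 2 * (LINT t|lborel. m R t * msq f y0 t)"
        using elim y0(1) m01 by (intro weighted_norm_le f mm less_imp_le[OF y0(2)]) auto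
      hence "(LINT t|lborel. m R t * msq f y t) \<le> e / 2" using R0[OF R] by simp
      moreover have "(LINT t|lborel. m R t * msq f y t) = l2sq (hline f y) - (LINT t|lborel. indicator {-R..R} t * msq f y t)"
        unfolding m_def l2sq_def left_diff_distrib using Bochner_Integration.integral_diff[OF sq[OF elim(3)] i] by simp
      ultimately show ?case using elim(1) by simp
    qed
  qed
qed

section \<open>The kernel on the diagonal near the real axis\<close>

context mero_inner begin

text \<open>The quotient is the squared norm of the kernel at \<open>t + \<i> y\<close>. Expanding
  \<open>|F z|^2\<close> around the boundary value leaves a term linear in the increment of
  \<open>F\<close>, which after division by \<open>y\<close> gives the derivative in
  \<open>ker_real_norm\<close>, and a quadratic term, which disappears.\<close>

lemma kernel_diagonal_limit:
  "((\<lambda>y. (1 - msq F y t) / (4 * pi * y)) \<longlongrightarrow> (h2_norm (ker (of_real t)))\<^sup>2) (at_right 0)"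
proof -
  let ?t = "of_real t :: complex"
  define z where "z y = ?t + \<i> * of_real y" for y :: real
  have zc: "Complex t y = z y" for y unfolding z_def by (simp add: Complex_eq)
  have "(F has_field_derivative deriv F ?t) (at ?t)"
    using F_analytic[of t] analytic_on_imp_differentiable_at DERIV_deriv_iff_field_differentiable by blast
  hence D: "((\<lambda>w. (F w - F ?t) / (w - ?t)) \<longlongrightarrow> deriv F ?t) (at ?t)" by (simp add: has_field_derivative_iff)
  have "(z \<longlongrightarrow> ?t + \<i> * of_real 0) (at_right 0)" unfolding z_def by (intro tendsto_intros)
  hence zl: "(z \<longlongrightarrow> ?t) (at_right 0)" by simp
  have fl: "filterlim z (at ?t) (at_right 0)"
  proof (rule filterlim_atI[OF zl])
    show "\<forall>\<^sub>F y in at_right 0. z y \<noteq> ?t"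
      using eventually_at_right_pos by eventually_elim (simp add: z_def)
  qed
  define q where "q y = (F (z y) - F ?t) / (z y - ?t)" for y
  have q: "(q \<longlongrightarrow> deriv F ?t) (at_right 0)" unfolding q_def by (rule filterlim_compose[OF D fl])
  have "isCont F ?t" using F_analytic[of t] analytic_at_imp_isCont by blast
  hence d: "((\<lambda>y. F (z y) - F ?t) \<longlongrightarrow> F ?t - F ?t) (at_right 0)"
    by (intro tendsto_intros isCont_tendsto_compose[OF _ zl])
  have L: "((\<lambda>y. - (cmod (F (z y) - F ?t) * cmod (q y) + 2 * Re (cnj (F ?t) * (\<i> * q y))) / (4 * pi))
      \<longlongrightarrow> - (cmod (F ?t - F ?t) * cmod (deriv F ?t) + 2 * Re (cnj (F ?t) * (\<i> * deriv F ?t))) / (4 * pi)) (at_right 0)"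
    by (intro tendsto_intros d q) simp
  have V: "- (cmod (F ?t - F ?t) * cmod (deriv F ?t) + 2 * Re (cnj (F ?t) * (\<i> * deriv F ?t))) / (4 * pi) = (h2_norm (ker ?t))\<^sup>2"
  proof -
    have "(h2_norm (ker ?t))\<^sup>2 = Re (- \<kappa>0 * cnj (F ?t) * deriv F ?t)"
      using arg_cong[OF ker_real_norm[of t], of Re] by (simp only: Re_complex_of_real)
    also have "- \<kappa>0 * cnj (F ?t) * deriv F ?t = of_real (- (1 / (2 * pi))) * (cnj (F ?t) * (\<i> * deriv F ?t))" by simp
    also have "Re (of_real r * X) = r * Re X" for r X by simp
    finally have h: "(h2_norm (ker ?t))\<^sup>2 = - (1 / (2 * pi)) * Re (cnj (F ?t) * (\<i> * deriv F ?t))" .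
    have "- (cmod (b - b) * q + 2 * r) / (4 * pi) = - (1 / (2 * pi)) * r" for b q r by simp
    thus ?thesis unfolding h .
  qed
  have "\<forall>\<^sub>F y in at_right 0. - (cmod (F (z y) - F ?t) * cmod (q y) + 2 * Re (cnj (F ?t) * (\<i> * q y))) / (4 * pi)
      = (1 - msq F y t) / (4 * pi * y)"
    using eventually_at_right_pos
  proof eventually_elim
    case (elim y)
    let ?a = "F (z y)" and ?b = "F ?t"
    have zy: "z y - ?t = \<i> * of_real y" unfolding z_def by simp
    have iq: "\<i> * q y = (?a - ?b) / of_real y" unfolding q_def zy using elim by (simp add: field_simps)
    have cq: "cmod (q y) = cmod (?a - ?b) / y" unfolding q_def zy using elim by (simp add: norm_divide norm_mult)
    have "(cmod ?a)\<^sup>2 = (cmod (?a - ?b))\<^sup>2 + 2 * Re (cnj ?b * (?a - ?b)) + (cmod ?b)\<^sup>2"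
      unfolding cmod_power2 by (simp add: power2_eq_square algebra_simps)
    hence e: "1 - (cmod ?a)\<^sup>2 = - ((cmod (?a - ?b))\<^sup>2 + 2 * Re (cnj ?b * (?a - ?b)))" by (simp add: F_real)
    have re: "Re (cnj ?b * ((?a - ?b) / of_real y)) = Re (cnj ?b * (?a - ?b)) / y"
      unfolding times_divide_eq_right by (rule Re_divide_of_real)
    have alg: "- (d * (d / y) + 2 * (r / y)) / (4 * pi) = - (d\<^sup>2 + 2 * r) / (4 * pi * y)" for d r
      using elim by (simp add: field_simps power2_eq_square)
    show ?case unfolding zc e iq cq re by (rule alg)
  qed
  thus ?thesis by (rule Lim_transform_eventually[OF L[unfolded V]])
qed

text \<open>Supplies the dominating constant on a bounded interval: \<open>F\<close> is holomorphic
  around a compact rectangle on that interval, and the mean value inequality bounds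
  \<open>1 - |F|\<close> by a multiple of the height.\<close>

lemma kernel_diagonal_bounded:
  obtains C e where "e > 0" "\<And>t y. \<bar>t\<bar> \<le> R \<Longrightarrow> 0 < y \<Longrightarrow> y \<le> e \<Longrightarrow> (1 - msq F y t) / (4 * pi * y) \<le> C"
proof -
  have "F analytic_on \<real>" using inner unfolding meromorphic_inner_def by blast
  then obtain V where V: "open V" "\<real> \<subseteq> V" "F holomorphic_on V" unfolding analytic_on_holomorphic by blast
  let ?S = "of_real ` {-R..R} :: complex set"
  have "compact ?S" by (intro compact_continuous_image continuous_intros) auto
  moreover have "?S \<subseteq> V" using V(2) by auto
  ultimately obtain e where e: "e > 0" "(\<Union>x\<in>?S. cball x e) \<subseteq> V"
    using compact_subset_open_imp_cball_epsilon_subset[OF _ V(1)] by blast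
  let ?Q = "cbox (Complex (-R) 0) (Complex R e)"
  have Q: "Complex t y \<in> ?Q" if "\<bar>t\<bar> \<le> R" "0 \<le> y" "y \<le> e" for t y using that by (auto simp: in_cbox_complex_iff)
  have QV: "?Q \<subseteq> V"
  proof
    fix z assume z: "z \<in> ?Q"
    hence "Re z \<in> {-R..R}" "cmod (z - of_real (Re z)) \<le> e"
      by (auto simp: in_cbox_complex_iff cmod_eq_Im)
    hence "of_real (Re z) \<in> ?S" "z \<in> cball (of_real (Re z)) e" by (simp_all add: dist_norm norm_minus_commute)
    thus "z \<in> V" using e(2) by blast
  qed
  obtain B where B: "\<And>z. z \<in> ?Q \<Longrightarrow> cmod (deriv F z) \<le> B"
    by (rule holomorphic_bounded_on_compact[OF holomorphic_deriv[OF V(3,1)] compact_cbox QV]) (rule that; assumption)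
  show ?thesis
  proof (rule that[OF e(1)])
    fix t y :: real assume ty: "\<bar>t\<bar> \<le> R" "0 < y" "y \<le> e"
    let ?a = "F (Complex t y)"
    have "cmod (F (Complex t 0) - ?a) \<le> B * cmod (Complex t 0 - Complex t y)"
    proof (rule field_differentiable_bound[where S = ?Q and f' = "deriv F"])
      show "(F has_field_derivative deriv F z) (at z within ?Q)" if "z \<in> ?Q" for z
        using holomorphic_derivI[OF V(3,1)] QV that has_field_derivative_at_within by blast
    qed (use B Q ty e(1) in auto)
    also have "cmod (Complex t 0 - Complex t y) = y" using ty(2) by (simp add: cmod_def)
    also have "Complex t 0 = of_real t" by (simp add: complex_of_real_def)
    finally have d: "cmod (F (of_real t) - ?a) \<le> B * y" .
    have le1: "cmod ?a \<le> 1" using F_le_1[of "Complex t y"] ty by simp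
    have "1 \<le> cmod (F (of_real t) - ?a) + cmod ?a"
      using norm_triangle_ineq[of "F (of_real t) - ?a" ?a] by (simp add: F_real)
    hence "1 - cmod ?a \<le> B * y" using d by simp
    moreover have "1 - (cmod ?a)\<^sup>2 = (1 - cmod ?a) * (1 + cmod ?a)" by (simp add: power2_eq_square algebra_simps)
    moreover have "(1 - cmod ?a) * (1 + cmod ?a) \<le> (1 - cmod ?a) * 2" using le1 by (intro mult_left_mono) auto
    ultimately have "1 - (cmod ?a)\<^sup>2 \<le> 2 * B * y" by simp
    hence "(1 - (cmod ?a)\<^sup>2) / (4 * pi * y) \<le> (2 * B * y) / (4 * pi * y)" using ty by (intro divide_right_mono) auto
    also have "\<dots> = B / (2 * pi)" using ty by simp
    finally show "(1 - (cmod ?a)\<^sup>2) / (4 * pi * y) \<le> B / (2 * pi)" .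
  qed
qed

section \<open>Orthonormal systems and Bessel's inequality\<close>

lemma K_sum:
  assumes "finite I" "\<And>i. i \<in> I \<Longrightarrow> f i \<in> K" shows "(\<lambda>z. \<Sum>i\<in>I. c i * f i z) \<in> K"
  using assms
proof (induction I rule: finite_induct)
  case empty show ?case using K_zero[OF ker_real_K] by simp
next
  case (insert i I)
  thus ?case using K_lin[of "f i" "\<lambda>z. \<Sum>i\<in>I. c i * f i z" "c i" 1] by simp
qed

lemma h2_inner_sum_left:
  assumes "finite I" "\<And>i. i \<in> I \<Longrightarrow> f i \<in> K" "h \<in> H2"
  shows "h2_inner (\<lambda>z. \<Sum>i\<in>I. c i * f i z) h = (\<Sum>i\<in>I. c i * h2_inner (f i) h)"
  using assms
proof (induction I rule: finite_induct)
  case empty thus ?case by (simp add: h2_inner_zero_left)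
next
  case (insert i I)
  thus ?case using h2_inner_lin_left[of "f i" "\<lambda>z. \<Sum>i\<in>I. c i * f i z" h "c i" 1] K_sum[of I f c] by (simp add: K_H2)
qed

lemma h2_inner_sum_right:
  assumes "finite I" "\<And>i. i \<in> I \<Longrightarrow> f i \<in> K" "h \<in> H2"
  shows "h2_inner h (\<lambda>z. \<Sum>i\<in>I. c i * f i z) = (\<Sum>i\<in>I. cnj (c i) * h2_inner h (f i))"
proof -
  have "h2_inner h (\<lambda>z. \<Sum>i\<in>I. c i * f i z) = cnj (\<Sum>i\<in>I. c i * h2_inner (f i) h)"
    using h2_inner_cnj[OF K_H2[OF K_sum[of I f c]] assms(3)] h2_inner_sum_left[OF assms] assms by simp
  also have "\<dots> = (\<Sum>i\<in>I. cnj (c i) * h2_inner h (f i))"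
    using assms by (auto simp: h2_inner_cnj[of h] K_H2 intro!: sum.cong)
  finally show ?thesis .
qed

definition orthonormal :: "nat \<Rightarrow> (nat \<Rightarrow> complex \<Rightarrow> complex) \<Rightarrow> bool" where
  "orthonormal n e \<longleftrightarrow> (\<forall>i<n. \<forall>j<n. h2_inner (e i) (e j) = (if i = j then 1 else 0))"

text \<open>\<open>p\<close> is the projection of \<open>ker w\<close> onto the span of the system.
  Its value at \<open>w\<close> and its squared norm both equal the sum, so Cauchy-Schwarz against
  \<open>ker w\<close> gives the bound.\<close>

lemma bessel_kernel:
  assumes e: "\<And>i. i < n \<Longrightarrow> e i \<in> K" "orthonormal n e" and w: "Im w > 0"
  shows "(\<Sum>i<n. (cmod (e i w))\<^sup>2) \<le> (1 - (cmod (F w))\<^sup>2) / (4 * pi * Im w)"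
proof -
  define p where "p = (\<lambda>z. \<Sum>i<n. cnj (e i w) * e i z)"
  define S where "S = (\<Sum>i<n. (cmod (e i w))\<^sup>2)"
  have p: "p \<in> K" unfolding p_def using e(1) by (intro K_sum) auto
  have pw: "p w = of_real S" unfolding p_def S_def of_real_sum
    by (intro sum.cong refl) (simp only: complex_norm_square mult.commute)
  have "h2_inner p (e i) = cnj (e i w)" if "i < n" for i
  proof -
    have "h2_inner p (e i) = (\<Sum>j<n. cnj (e j w) * h2_inner (e j) (e i))"
      unfolding p_def using e(1) that by (intro h2_inner_sum_left) (auto intro: K_H2)
    also have "\<dots> = (\<Sum>j<n. if j = i then cnj (e j w) else 0)"
      using e(2) that unfolding orthonormal_def by (intro sum.cong) auto
    finally show ?thesis using that by simp
  qed
  hence "h2_inner p p = (\<Sum>i<n. e i w * cnj (e i w))"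
    by (subst (2) p_def, subst h2_inner_sum_right) (use e(1) p in \<open>auto intro: K_H2\<close>)
  also have "\<dots> = of_real S" unfolding S_def of_real_sum by (simp only: complex_norm_square)
  finally have "(h2_norm p)\<^sup>2 = S" unfolding h2_inner_self[OF K_H2[OF p]] by (simp only: of_real_eq_iff)
  moreover have "S \<ge> 0" unfolding S_def by (intro sum_nonneg) auto
  moreover have "cmod (h2_inner p (ker w)) \<le> h2_norm p * h2_norm (ker w)"
    by (intro h2_cauchy_schwarz K_H2 p ker_K w)
  ultimately have "(h2_norm p)\<^sup>2 \<le> h2_norm p * h2_norm (ker w)"
    unfolding ker_reproducing[OF p w] pw by simp
  hence "h2_norm p \<le> h2_norm (ker w)"
    using h2_norm_nonneg[OF K_H2[OF p]] h2_norm_nonneg[OF K_H2[OF ker_K[OF w]]]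
    by (cases "h2_norm p = 0") (auto simp: power2_eq_square)
  hence "(h2_norm p)\<^sup>2 \<le> (h2_norm (ker w))\<^sup>2" using h2_norm_nonneg[OF K_H2[OF p]] by (intro power_mono)
  thus ?thesis unfolding \<open>(h2_norm p)\<^sup>2 = S\<close> ker_self(2)[OF w] S_def .
qed

end

section \<open>The phase as a local logarithm of \<open>F\<close>\<close>

locale mero_inner_phase = mero_inner +
  fixes \<tau> :: "real \<Rightarrow> real"
  assumes cont: "continuous_on UNIV \<tau>" and phase: "\<And>x. F (of_real x) = exp (\<i> * of_real (\<tau> x))"
begin

text \<open>\<open>g\<close> is \<open>\<tau> x - \<i> * Ln (F z / F x)\<close>. Close to
  \<open>x\<close> the quotient has positive real part, so the principal logarithm is holomorphic;
  and \<open>\<tau>\<close> moves by less than \<open>pi\<close>, so the logarithm returns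
  \<open>\<tau> t - \<tau> x\<close> without a multiple of \<open>2 * pi\<close>.\<close>

lemma local_extension:
  obtains r g where "r > 0" "g holomorphic_on ball (of_real x) r"
    "\<And>t. \<bar>t - x\<bar> < r \<Longrightarrow> g (of_real t) = of_real (\<tau> t)" "\<And>z. z \<in> ball (of_real x) r \<Longrightarrow> F z = exp (\<i> * g z)"
proof -
  let ?x = "of_real x :: complex"
  obtain R where R: "R > 0" "F holomorphic_on ball ?x R" using F_analytic[of x] unfolding analytic_at_ball by auto
  have Fx: "F ?x \<noteq> 0" using F_real[of x] by auto
  define q where "q z = F z / F ?x" for z
  have q: "q holomorphic_on ball ?x R" unfolding q_def using R(2) Fx by (intro holomorphic_intros) auto
  have "isCont q ?x" using q R(1) by (metis centre_in_ball continuous_on_interior holomorphic_on_imp_continuous_on interior_ball)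
  moreover have "q ?x = 1" unfolding q_def using Fx by simp
  ultimately obtain d where d: "d > 0" "\<And>z. dist z ?x < d \<Longrightarrow> dist (q z) 1 < 1"
    unfolding continuous_at_eps_delta using zero_less_one by metis
  have "isCont \<tau> x" using cont by (simp add: continuous_on_eq_continuous_at)
  then obtain d' where d': "d' > 0" "\<And>t. dist t x < d' \<Longrightarrow> dist (\<tau> t) (\<tau> x) < pi"
    unfolding continuous_at_eps_delta using pi_gt_zero by metis
  define r where "r = min R (min d d')"
  have r: "r > 0" "r \<le> R" "r \<le> d" "r \<le> d'" unfolding r_def using R d d' by auto
  define g where "g z = of_real (\<tau> x) - \<i> * Ln (q z)" for z
  have nn: "q z \<notin> \<real>\<^sub>\<le>\<^sub>0" "q z \<noteq> 0" if "z \<in> ball ?x r" for z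
  proof -
    have "dist (q z) 1 < 1" using that d(2)[of z] r by (simp add: dist_commute)
    hence "cmod (1 - q z) < 1" by (simp add: dist_norm norm_minus_commute)
    hence "Re (1 - q z) < 1" using complex_Re_le_cmod[of "1 - q z"] by linarith
    hence "Re (q z) > 0" by simp
    thus "q z \<notin> \<real>\<^sub>\<le>\<^sub>0" "q z \<noteq> 0" by (auto simp: complex_nonpos_Reals_iff)
  qed
  show ?thesis
  proof (rule that[of r g])
    show "g holomorphic_on ball ?x r"
    proof -
      have "q holomorphic_on ball ?x r" by (rule holomorphic_on_subset[OF q]) (use r(2) in auto)
      thus ?thesis unfolding g_def using nn by (intro holomorphic_intros) auto
    qed
    show "g (of_real t) = of_real (\<tau> t)" if t: "\<bar>t - x\<bar> < r" for t
    proof -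
      have a: "\<bar>\<tau> t - \<tau> x\<bar> < pi" using d'(2)[of t] t r(4) by (simp add: dist_real_def)
      have "q (of_real t) = exp (\<i> * of_real (\<tau> t - \<tau> x))"
        unfolding q_def phase by (simp add: exp_diff[symmetric] algebra_simps)
      hence "Ln (q (of_real t)) = \<i> * of_real (\<tau> t - \<tau> x)" using a by (simp del: of_real_diff)
      thus ?thesis unfolding g_def by simp
    qed
    show "F z = exp (\<i> * g z)" if z: "z \<in> ball ?x r" for z
    proof -
      have "\<i> * g z = \<i> * of_real (\<tau> x) + Ln (q z)" unfolding g_def by (simp add: algebra_simps)
      hence "exp (\<i> * g z) = F ?x * q z" using nn(2)[OF z] by (simp add: exp_add phase)
      thus ?thesis unfolding q_def using Fx by simp
    qed
  qed (rule r)
qed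

text \<open>Differentiating \<open>F = exp (\<i> * g)\<close> gives \<open>\<i> * F * g'\<close> for
  the derivative of \<open>F\<close>. In \<open>ker_real_norm\<close> the factor
  \<open>cnj F * F = 1\<close> drops out and \<open>- \<kappa>0 * \<i>\<close> is
  \<open>1 / (2 pi)\<close>.\<close>

lemma phase_derivative: "(\<tau> has_real_derivative 2 * pi * (h2_norm (ker (of_real x)))\<^sup>2) (at x)"
proof -
  let ?x = "of_real x :: complex"
  obtain r g where g: "r > 0" "g holomorphic_on ball ?x r"
    "\<And>t. \<bar>t - x\<bar> < r \<Longrightarrow> g (of_real t) = of_real (\<tau> t)" "\<And>z. z \<in> ball ?x r \<Longrightarrow> F z = exp (\<i> * g z)"
    by (rule local_extension[of x]) (rule that; assumption)
  have xB: "?x \<in> ball ?x r" using g(1) by simp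
  have D: "(g has_field_derivative deriv g ?x) (at ?x)" by (rule holomorphic_derivI[OF g(2) _ xB]) simp
  have "((\<lambda>z. exp (\<i> * g z)) has_field_derivative exp (\<i> * g ?x) * (\<i> * deriv g ?x)) (at ?x)"
    by (auto intro!: derivative_eq_intros D)
  hence "(F has_field_derivative exp (\<i> * g ?x) * (\<i> * deriv g ?x)) (at ?x)"
    by (rule has_field_derivative_transform_within_open[where S = "ball ?x r"]) (use g xB in auto)
  hence dF: "deriv F ?x = F ?x * (\<i> * deriv g ?x)" using g(4)[OF xB] DERIV_imp_deriv by metis
  have "cnj (F ?x) * F ?x = 1" using F_real[of x] complex_norm_square[of "F ?x"] by (simp add: mult.commute)
  moreover have "of_real ((h2_norm (ker ?x))\<^sup>2) = - \<kappa>0 * (cnj (F ?x) * F ?x) * (\<i> * deriv g ?x)"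
    unfolding ker_real_norm dF by (simp only: mult.assoc)
  ultimately have "of_real ((h2_norm (ker ?x))\<^sup>2) = deriv g ?x / (2 * pi)" by simp
  hence dg: "deriv g ?x = of_real (2 * pi * (h2_norm (ker ?x))\<^sup>2)" by (simp add: field_simps)
  have "((\<lambda>t. g (of_real t)) has_vector_derivative deriv g ?x) (at x)"
    by (rule has_vector_derivative_real_field[OF D])
  hence "((\<lambda>t. Re (g (of_real t))) has_field_derivative Re (deriv g ?x)) (at x)"
    unfolding has_vector_derivative_complex_iff by blast
  hence "((\<lambda>t. Re (g (of_real t))) has_field_derivative 2 * pi * (h2_norm (ker ?x))\<^sup>2) (at x)"
    unfolding dg by (simp only: Re_complex_of_real)
  thus ?thesis
  proof (rule has_field_derivative_transform_within_open[where S = "ball x r"])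
    show "Re (g (of_real t)) = \<tau> t" if "t \<in> ball x r" for t
      using g(3)[of t] that by (simp add: dist_real_def abs_minus_commute)
  qed (use g(1) in auto)
qed

lemma phase_smooth: "C_infinity \<tau>"
proof -
  have "(deriv ^^ n) \<tau> differentiable (at x)" for n x
  proof -
    obtain r g where g: "r > 0" "g holomorphic_on ball (of_real x) r"
      "\<And>t. \<bar>t - x\<bar> < r \<Longrightarrow> g (of_real t) = of_real (\<tau> t)"
      by (rule local_extension[of x]) (rule that; assumption)
    have step: "((\<lambda>s. Re ((deriv ^^ n) g (of_real s))) has_field_derivative Re ((deriv ^^ Suc n) g (of_real t))) (at t)"
      if t: "t \<in> ball x r" for t n
    proof -
      have "complex_of_real t \<in> ball (of_real x) r" using t by (simp add: dist_norm flip: of_real_diff)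
      moreover have "(deriv ^^ n) g holomorphic_on ball (of_real x) r" by (rule holomorphic_higher_deriv[OF g(2)]) simp
      ultimately have "((deriv ^^ n) g has_field_derivative deriv ((deriv ^^ n) g) (of_real t)) (at (of_real t))"
        by (intro holomorphic_derivI) auto
      from has_vector_derivative_real_field[OF this]
      show ?thesis unfolding has_vector_derivative_complex_iff by simp
    qed
    \<comment> \<open>Proved on the whole interval rather than at \<open>x\<close> alone, since the
      next derivative depends on a neighbourhood.\<close>
    have eq: "(deriv ^^ n) \<tau> t = Re ((deriv ^^ n) g (of_real t))" if "t \<in> ball x r" for t n
      using that
    proof (induction n arbitrary: t)
      case 0
      thus ?case using g(3)[of t] by (simp add: dist_real_def abs_minus_commute)
    next
      case (Suc n)
      have "((deriv ^^ n) \<tau> has_field_derivative Re ((deriv ^^ Suc n) g (of_real t))) (at t)"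
        by (rule has_field_derivative_transform_within_open[OF step[OF Suc.prems], where S = "ball x r"])
          (use Suc in auto)
      thus ?case using DERIV_imp_deriv by simp
    qed
    have "((deriv ^^ n) \<tau> has_field_derivative Re ((deriv ^^ Suc n) g (of_real x))) (at x)"
      by (rule has_field_derivative_transform_within_open[OF step, where S = "ball x r"]) (use g(1) eq in auto)
    thus ?thesis using real_differentiable_def by blast
  qed
  thus ?thesis unfolding C_infinity_def by blast
qed

lemma phase_derivative_pos: "2 * pi * (h2_norm (ker (of_real x)))\<^sup>2 > 0"
  using ker_real_norm_pos[of x] by simp

lemma phase_strict_mono: "strict_mono \<tau>"
proof (rule strict_monoI)
  fix x y :: real assume "x < y"
  thus "\<tau> x < \<tau> y"
    by (rule DERIV_pos_imp_increasing) (metis phase_derivative phase_derivative_pos)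
qed

text \<open>The local bound on the diagonal kernel lets the limit pass under the integral; the limit
  integrand is the derivative of \<open>\<tau>\<close> divided by \<open>2 * pi\<close>, which the
  fundamental theorem integrates.\<close>

lemma kernel_integral:
  assumes R: "R > 0"
  shows "((\<lambda>y. LINT t|lborel. indicator {-R..R} t * ((1 - msq F y t) / (4 * pi * y)))
    \<longlongrightarrow> (\<tau> R - \<tau> (-R)) / (2 * pi)) (at_right 0)"
proof -
  define n where "n t = (h2_norm (ker (of_real t)))\<^sup>2" for t :: real
  define G where "G y t = (1 - msq F y t) / (4 * pi * y)" for y t :: real
  let ?I = "indicator {-R..R} :: real \<Rightarrow> real"
  obtain C e where C0: "e > 0" "\<And>t y. \<bar>t\<bar> \<le> R \<Longrightarrow> 0 < y \<Longrightarrow> y \<le> e \<Longrightarrow> (1 - msq F y t) / (4 * pi * y) \<le> C"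
    by (rule kernel_diagonal_bounded[of R]) (rule that; assumption)
  note C = C0[folded G_def]
  have lim: "((\<lambda>y. G y t) \<longlongrightarrow> n t) (at_right 0)" for t unfolding G_def n_def by (rule kernel_diagonal_limit)
  have G0: "G y t \<ge> 0" if "y > 0" for y t
    unfolding G_def using F_le_1[of "Complex t y"] that by (intro divide_nonneg_nonneg) (auto simp: power_le_one)
  have ev: "\<forall>\<^sub>F y in at_right 0. 0 < y \<and> y \<le> e"
    by (rule eventually_at_right_le[OF C(1)])
  have nb: "0 \<le> n t" "n t \<le> C" if "\<bar>t\<bar> \<le> R" for t
  proof -
    show "0 \<le> n t" unfolding n_def by simp
    show "n t \<le> C" by (rule tendsto_upperbound[OF lim]) (use ev C(2)[OF that] in \<open>auto elim!: eventually_mono\<close>)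
  qed
  have dn: "deriv \<tau> = (\<lambda>t. 2 * pi * n t)"
    by (rule ext) (use DERIV_imp_deriv[OF phase_derivative] in \<open>simp add: n_def\<close>)
  have "((deriv ^^ 1) \<tau>) differentiable (at t)" for t using phase_smooth unfolding C_infinity_def by blast
  hence "isCont ((deriv ^^ 1) \<tau>) t" for t by (rule differentiable_imp_continuous_within)
  hence "isCont (deriv \<tau>) t" for t by simp
  hence "continuous_on UNIV (deriv \<tau>)" by (simp add: continuous_on_eq_continuous_at)
  hence "continuous_on UNIV (\<lambda>t. deriv \<tau> t / (2 * pi))" by (intro continuous_intros) auto
  hence nc: "continuous_on UNIV n" unfolding dn by simp
  have "(LINT t|lborel. ?I t *\<^sub>R n t) = \<tau> R / (2 * pi) - \<tau> (-R) / (2 * pi)"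
  proof (rule integral_FTC_atLeastAtMost)
    fix t
    have "((\<lambda>t. \<tau> t / (2 * pi)) has_real_derivative (2 * pi * n t) / (2 * pi)) (at t within {-R..R})"
      unfolding n_def by (rule DERIV_cdivide[OF has_field_derivative_at_within[OF phase_derivative]])
    thus "((\<lambda>t. \<tau> t / (2 * pi)) has_vector_derivative n t) (at t within {-R..R})"
      by (simp add: has_real_derivative_iff_has_vector_derivative)
  qed (use R continuous_on_subset[OF nc] in auto)
  hence N: "(LINT t|lborel. ?I t * n t) = (\<tau> R - \<tau> (-R)) / (2 * pi)" by (simp add: diff_divide_distrib)
  have nm: "n \<in> borel_measurable lborel" using nc by (simp add: borel_measurable_continuous_onI)
  have Gm: "G y \<in> borel_measurable lborel" if "y > 0" for y
    using borel_measurable_horizontal_line[OF F_holomorphic, of y] that unfolding G_def by (auto simp: upper_half_plane_def)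
  have Ci: "integrable lborel (\<lambda>t. c * ?I t)" for c
    by (intro integrable_mult_right integrable_real_indicator) (auto simp: emeasure_lborel_Icc_eq)
  have iG: "integrable lborel (\<lambda>t. ?I t * G y t)" if "0 < y" "y \<le> e" for y
  proof (rule Bochner_Integration.integrable_bound[OF Ci[of C]])
    show "AE t in lborel. norm (?I t * G y t) \<le> norm (C * ?I t)"
    proof (rule AE_I2)
      fix t show "norm (?I t * G y t) \<le> norm (C * ?I t)"
        using C(2)[of t y] G0[of y t] that by (auto simp: indicator_def abs_le_iff)
    qed
  qed (use Gm[OF that(1)] in \<open>auto intro!: borel_measurable_times\<close>)
  have iN: "integrable lborel (\<lambda>t. ?I t * n t)"
  proof (rule Bochner_Integration.integrable_bound[OF Ci[of C]])
    show "AE t in lborel. norm (?I t * n t) \<le> norm (C * ?I t)"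
    proof (rule AE_I2)
      fix t show "norm (?I t * n t) \<le> norm (C * ?I t)"
        using nb[of t] by (auto simp: indicator_def abs_le_iff)
    qed
  qed (use nm in \<open>auto intro!: borel_measurable_times\<close>)
  \<comment> \<open>The bound on \<open>G\<close> holds for heights up to \<open>e\<close> only,
    while the convergence lemma asks for domination at all positive heights; \<open>min y e\<close>
    agrees with \<open>y\<close> eventually.\<close>
  have "((\<lambda>y. LINT t|lborel. ?I t * (G (min y e) t - n t)) \<longlongrightarrow> 0) (at_right 0)"
  proof (rule dominated_convergence_at_right)
    show "AE t in lborel. ((\<lambda>y. ?I t * (G (min y e) t - n t)) \<longlongrightarrow> 0) (at_right 0)"
    proof (intro AE_I2 tendsto_mult_right_zero)
      fix t
      have "((\<lambda>y. G y t - n t) \<longlongrightarrow> 0) (at_right 0)" using tendsto_diff[OF lim tendsto_const, of t "n t"] by simp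
      thus "((\<lambda>y. G (min y e) t - n t) \<longlongrightarrow> 0) (at_right 0)"
        by (rule Lim_transform_eventually) (use ev in \<open>eventually_elim, simp add: min_absorb1\<close>)
    qed
    show "integrable lborel (\<lambda>t. (2 * C) * ?I t)" by (rule Ci)
    show "\<bar>?I t * (G (min y e) t - n t)\<bar> \<le> (2 * C) * ?I t" if "y > 0" for y t
      using C(2)[of t "min y e"] C(1) G0[of "min y e" t] nb[of t] that by (auto simp: indicator_def abs_le_iff)
    show "(\<lambda>t. ?I t * (G (min y e) t - n t)) \<in> borel_measurable lborel" if "y > 0" for y
      using Gm[of "min y e"] nm that C(1) by (intro borel_measurable_times borel_measurable_diff) auto
  qed
  hence "((\<lambda>y. (LINT t|lborel. ?I t * G y t) - (LINT t|lborel. ?I t * n t)) \<longlongrightarrow> 0) (at_right 0)"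
  proof (rule Lim_transform_eventually)
    show "\<forall>\<^sub>F y in at_right 0. (LINT t|lborel. ?I t * (G (min y e) t - n t)) = (LINT t|lborel. ?I t * G y t) - (LINT t|lborel. ?I t * n t)"
      using ev
    proof eventually_elim
      case (elim y)
      thus ?case using Bochner_Integration.integral_diff[OF iG[of y] iN] by (simp add: min_absorb1 right_diff_distrib)
    qed
  qed
  hence "((\<lambda>y. LINT t|lborel. ?I t * G y t) \<longlongrightarrow> (LINT t|lborel. ?I t * n t)) (at_right 0)" by (rule LIM_zero_cancel)
  thus ?thesis unfolding N G_def .
qed

text \<open>A trace estimate at small height: each \<open>e i\<close> has mass at least
  \<open>1 - \<delta>\<close> over a large interval, the sum of the squared moduli is at most the
  diagonal kernel by Bessel, and the integral of that kernel tends to the increment of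
  \<open>\<tau>\<close> divided by \<open>2 * pi\<close>.\<close>

lemma orthonormal_size_bound:
  assumes ab: "\<And>x. a \<le> \<tau> x" "\<And>x. \<tau> x \<le> b" and e: "\<And>i. i < n \<Longrightarrow> e i \<in> K" "orthonormal n e"
  shows "real n \<le> (b - a) / (2 * pi)"
proof (rule field_le_epsilon)
  fix \<epsilon> :: real assume \<epsilon>: "\<epsilon> > 0"
  \<comment> \<open>The summand 1 keeps the denominator positive for \<open>n = 0\<close>.\<close>
  define \<delta> where "\<delta> = \<epsilon> / (real n + 1)"
  have \<delta>: "\<delta> > 0" "real n * \<delta> \<le> \<epsilon>" unfolding \<delta>_def using \<epsilon> by (auto simp: field_simps)
  have "\<exists>R0. \<forall>R\<ge>R0. \<forall>\<^sub>F y in at_right 0. 1 - \<delta> \<le> (LINT t|lborel. indicator {-R..R} t * msq (e i) y t)" if i: "i < n" for i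
  proof -
    have "h2_inner (e i) (e i) = 1" using e(2) i unfolding orthonormal_def by simp
    hence n1: "(h2_norm (e i))\<^sup>2 = 1" using h2_inner_self[OF K_H2[OF e(1)[OF i]]] by (metis of_real_eq_1_iff)
    show ?thesis by (rule H2_mass_on_interval[OF K_H2[OF e(1)[OF i]] \<delta>(1)]) (unfold n1, blast)
  qed
  hence "\<forall>i. \<exists>R0. i < n \<longrightarrow> (\<forall>R\<ge>R0. \<forall>\<^sub>F y in at_right 0. 1 - \<delta> \<le> (LINT t|lborel. indicator {-R..R} t * msq (e i) y t))"
    by blast
  from choice[OF this] obtain R0 where R0: "\<And>i R. i < n \<Longrightarrow> R \<ge> R0 i \<Longrightarrow> \<forall>\<^sub>F y in at_right 0. 1 - \<delta> \<le> (LINT t|lborel. indicator {-R..R} t * msq (e i) y t)"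
    by blast
  define R where "R = Max (insert 1 (R0 ` {..<n}))"
  have R: "R \<ge> 1" "\<And>i. i < n \<Longrightarrow> R \<ge> R0 i" unfolding R_def by auto
  have "\<forall>\<^sub>F y in at_right 0. \<forall>i\<in>{..<n}. 1 - \<delta> \<le> (LINT t|lborel. indicator {-R..R} t * msq (e i) y t)"
    using R0 R by (intro eventually_ball_finite) auto
  moreover obtain C d where C: "d > 0" "\<And>t y. \<bar>t\<bar> \<le> R \<Longrightarrow> 0 < y \<Longrightarrow> y \<le> d \<Longrightarrow> (1 - msq F y t) / (4 * pi * y) \<le> C"
    by (rule kernel_diagonal_bounded[of R]) (rule that; assumption)
  have "\<forall>\<^sub>F y in at_right 0. 0 < y \<and> y \<le> d"
    by (rule eventually_at_right_le[OF C(1)])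
  ultimately have "\<forall>\<^sub>F y in at_right 0. real n * (1 - \<delta>) \<le> (LINT t|lborel. indicator {-R..R} t * ((1 - msq F y t) / (4 * pi * y)))"
  proof eventually_elim
    case (elim y)
    let ?I = "indicator {-R..R} :: real \<Rightarrow> real"
    have sq: "integrable lborel (\<lambda>t. ?I t * msq (e i) y t)" if "i < n" for i
      using integrable_mult_indicator[of "{-R..R}" lborel "\<lambda>t. msq (e i) y t"] H2_sq_int[OF K_H2[OF e(1)[OF that]], of y] elim
      by (simp add: sq_int_def)
    have "real n * (1 - \<delta>) = (\<Sum>i<n. 1 - \<delta>)" by simp
    also have "\<dots> \<le> (\<Sum>i<n. (LINT t|lborel. ?I t * msq (e i) y t))"
      using elim(1) by (intro sum_mono) auto
    also have "\<dots> = (LINT t|lborel. (\<Sum>i<n. ?I t * msq (e i) y t))"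
      using sq by (intro Bochner_Integration.integral_sum[symmetric]) auto
    also have "\<dots> \<le> (LINT t|lborel. ?I t * ((1 - msq F y t) / (4 * pi * y)))"
    proof (rule integral_mono)
      show "integrable lborel (\<lambda>t. \<Sum>i<n. ?I t * msq (e i) y t)"
        using sq by (intro Bochner_Integration.integrable_sum) auto
      have Ci: "integrable lborel (\<lambda>t. C * ?I t)"
        by (intro integrable_mult_right integrable_real_indicator) (auto simp: emeasure_lborel_Icc_eq)
      have "(\<lambda>t. F (Complex t y)) \<in> borel_measurable lborel"
        using elim by (intro borel_measurable_horizontal_line[OF F_holomorphic]) (auto simp: upper_half_plane_def)
      hence "(\<lambda>t. ?I t * ((1 - msq F y t) / (4 * pi * y))) \<in> borel_measurable lborel" by measurable
      thus "integrable lborel (\<lambda>t. ?I t * ((1 - msq F y t) / (4 * pi * y)))"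
      proof (rule Bochner_Integration.integrable_bound[OF Ci], intro AE_I2)
        fix t
        have "0 \<le> (1 - msq F y t) / (4 * pi * y)"
          using F_le_1[of "Complex t y"] elim by (intro divide_nonneg_nonneg) (auto simp: power_le_one)
        thus "norm (?I t * ((1 - msq F y t) / (4 * pi * y))) \<le> norm (C * ?I t)"
          using C(2)[of t y] elim by (auto simp: indicator_def abs_le_iff)
      qed
      show "(\<Sum>i<n. ?I t * msq (e i) y t) \<le> ?I t * ((1 - msq F y t) / (4 * pi * y))" for t
        unfolding sum_distrib_left[symmetric] using bessel_kernel[OF e, of "Complex t y"] elim
        by (intro mult_left_mono) auto
    qed
    finally show ?case .
  qed
  hence "real n * (1 - \<delta>) \<le> (\<tau> R - \<tau> (-R)) / (2 * pi)"
    using R(1) by (intro tendsto_lowerbound[OF kernel_integral[of R]]) auto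
  also have "\<dots> \<le> (b - a) / (2 * pi)" using ab(2)[of R] ab(1)[of "-R"] by (intro divide_right_mono) auto
  finally show "real n \<le> (b - a) / (2 * pi) + \<epsilon>" using \<delta>(2) by (simp add: algebra_simps)
qed

end

text \<open>If the phase is bounded, orthonormal systems in the domain of \<open>M\<^sup>F\<close> have bounded size, because the integral of
  \<open>\<parallel>k\<^sub>x\<parallel>\<^sup>2\<close> over the real line is the trace of the identity of the model space. A dense domain would then be finite-dimensional, hence everything,
  and would contain the kernels \<open>k\<^sub>w\<close>.\<close>

locale dense_mero_inner_phase = dense_mero_inner + mero_inner_phase
begin

lemma MF_K: "m \<in> MF_domain F \<Longrightarrow> m \<in> K"
  by (simp add: MF_domain_def)

lemma MF_lin: assumes "f \<in> MF_domain F" "g \<in> MF_domain F" shows "(\<lambda>z. a * f z + b * g z) \<in> MF_domain F"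
  using adjT_lin[OF MF_adjT[OF assms(1)] MF_adjT[OF assms(2)], of a b] by (simp add: adjT_MF)

lemma MF_sum:
  fixes n :: nat and e :: "nat \<Rightarrow> complex \<Rightarrow> complex"
  assumes "f \<in> MF_domain F" "\<And>i. i < n \<Longrightarrow> e i \<in> MF_domain F" shows "(\<lambda>z. f z - (\<Sum>i<n. c i * e i z)) \<in> MF_domain F"
  using assms(2)
proof (induction n rule: nat_induct)
  case 0 thus ?case using assms(1) by simp
next
  case (Suc n)
  hence "(\<lambda>z. 1 * (f z - (\<Sum>i<n. c i * e i z)) + (- c n) * e n z) \<in> MF_domain F" by (intro MF_lin) auto
  thus ?case by (simp add: algebra_simps)
qed

lemma orthonormal_projection:
  assumes e: "\<And>i. i < n \<Longrightarrow> e i \<in> K" "orthonormal n e" and f: "f \<in> K" and j: "j < n"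
  shows "h2_inner (\<lambda>z. f z - (\<Sum>i<n. h2_inner f (e i) * e i z)) (e j) = 0"
proof -
  let ?s = "\<lambda>z. \<Sum>i<n. h2_inner f (e i) * e i z"
  have s: "?s \<in> K" using e(1) by (intro K_sum) auto
  have "h2_inner (\<lambda>z. f z - ?s z) (e j) = h2_inner f (e j) - h2_inner ?s (e j)"
    using h2_inner_lin_left[OF K_H2[OF f] K_H2[OF s] K_H2[OF e(1)[OF j]], of 1 "-1"] by simp
  also have "h2_inner ?s (e j) = (\<Sum>i<n. h2_inner f (e i) * h2_inner (e i) (e j))"
    using e(1) j by (intro h2_inner_sum_left) (auto intro: K_H2)
  also have "\<dots> = (\<Sum>i<n. if i = j then h2_inner f (e i) else 0)"
    using e(2) j unfolding orthonormal_def by (intro sum.cong) auto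
  finally show ?thesis using j by simp
qed

lemma phase_unbounded: "\<not> (bdd_above (range \<tau>) \<and> bdd_below (range \<tau>))"
proof
  assume "bdd_above (range \<tau>) \<and> bdd_below (range \<tau>)"
  then obtain a b where ab: "\<And>x. a \<le> \<tau> x" "\<And>x. \<tau> x \<le> b" unfolding bdd_above_def bdd_below_def by auto
  define P where "P n \<longleftrightarrow> (\<exists>e. (\<forall>i<n. e i \<in> MF_domain F) \<and> orthonormal n e)" for n
  have "n \<le> nat \<lfloor>(b - a) / (2 * pi)\<rfloor>" if "P n" for n
  proof -
    obtain e where "\<forall>i<n. e i \<in> MF_domain F" "orthonormal n e" using \<open>P n\<close> unfolding P_def by blast
    hence "real n \<le> (b - a) / (2 * pi)" using orthonormal_size_bound[OF ab, of n e] MF_K by blast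
    thus ?thesis by (simp add: le_nat_floor)
  qed
  moreover have "P 0" unfolding P_def orthonormal_def by simp
  ultimately obtain n where n: "P n" "\<And>m. P m \<Longrightarrow> m \<le> n" using ex_has_greatest_nat_lemma Nat.ex_has_greatest_nat[of P 0] by (metis (full_types))
  then obtain e where e: "\<And>i. i < n \<Longrightarrow> e i \<in> MF_domain F" "orthonormal n e" unfolding P_def by blast
  have eK: "e i \<in> K" if "i < n" for i using MF_K[OF e(1)[OF that]] .
  \<comment> \<open>A nonzero remainder, once normalised, would enlarge a system of maximal size
    \<open>n\<close>.\<close>
  have span: "(\<lambda>z. g z - (\<Sum>i<n. h2_inner g (e i) * e i z)) = (\<lambda>z. 0)" if g: "g \<in> MF_domain F" for g
  proof (rule ccontr)
    define u where "u = (\<lambda>z. g z - (\<Sum>i<n. h2_inner g (e i) * e i z))"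
    assume "u \<noteq> (\<lambda>z. 0)" (is "?u \<noteq> _")
    hence "u \<noteq> (\<lambda>z. 0)" unfolding u_def .
    have u: "u \<in> MF_domain F" unfolding u_def by (rule MF_sum[OF g e(1)])
    note uH = K_H2[OF MF_K[OF u]]
    have orth: "h2_inner u (e j) = 0" if "j < n" for j
      unfolding u_def by (rule orthonormal_projection[OF eK e(2) MF_K[OF g] that])
    have nz: "h2_norm u \<noteq> 0" using h2_norm_zero_imp[OF uH] \<open>u \<noteq> _\<close> by blast
    define v where "v = (\<lambda>z. (1 / of_real (h2_norm u)) * u z + 0 * u z)"
    have v: "v \<in> MF_domain F" unfolding v_def by (rule MF_lin[OF u u])
    have vv: "h2_inner v v = 1"
      unfolding v_def h2_inner_lin_left[OF uH uH H2_lin[OF uH uH]] h2_inner_lin_right[OF uH uH uH] h2_inner_self[OF uH]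
      using nz by (simp add: power2_eq_square)
    have ve: "h2_inner v (e j) = 0" "h2_inner (e j) v = 0" if "j < n" for j
    proof -
      note ej = K_H2[OF eK[OF that]]
      show 1: "h2_inner v (e j) = 0" unfolding v_def h2_inner_lin_left[OF uH uH ej] orth[OF that] by simp
      show "h2_inner (e j) v = 0" using h2_inner_cnj[OF K_H2[OF MF_K[OF v]] ej] 1 by simp
    qed
    have "orthonormal (Suc n) (e(n := v))"
      using e(2) vv ve unfolding orthonormal_def by (auto simp: less_Suc_eq)
    moreover have "\<forall>i<Suc n. (e(n := v)) i \<in> MF_domain F" using e(1) v by (auto simp: less_Suc_eq)
    ultimately have "P (Suc n)" unfolding P_def by blast
    thus False using n(2)[of "Suc n"] by simp
  qed
  have i: "Im \<i> > 0" by simp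
  define f where "f = ker \<i>"
  have f: "f \<in> K" unfolding f_def by (rule ker_K[OF i])
  let ?s = "\<lambda>z. \<Sum>i<n. h2_inner f (e i) * e i z"
  have s: "?s \<in> K" using eK by (intro K_sum) auto
  have vK: "(\<lambda>z. f z - ?s z) \<in> K" using K_lin[OF f s, of 1 "-1"] by simp
  \<comment> \<open>The remainder of the kernel is orthogonal to every \<open>e i\<close>, hence to
    the whole domain, which they span.\<close>
  have "(\<lambda>z. f z - ?s z) = (\<lambda>z. 0)"
  proof (rule MF_orthogonal_zero[OF vK])
    fix g assume g: "g \<in> MF_domain F"
    have "g = (\<lambda>z. \<Sum>i<n. h2_inner g (e i) * e i z)" using span[OF g] by (auto simp: fun_eq_iff)
    moreover have "h2_inner (\<lambda>z. \<Sum>i<n. h2_inner g (e i) * e i z) (\<lambda>z. f z - ?s z) = (\<Sum>i<n. h2_inner g (e i) * h2_inner (e i) (\<lambda>z. f z - ?s z))"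
      using eK vK by (intro h2_inner_sum_left) (auto intro: K_H2)
    moreover have "h2_inner (e j) (\<lambda>z. f z - ?s z) = 0" if "j < n" for j
      using h2_inner_cnj[OF K_H2[OF vK] K_H2[OF eK[OF that]]] orthonormal_projection[OF eK e(2) f that] by simp
    ultimately show "h2_inner g (\<lambda>z. f z - ?s z) = 0" by simp
  qed
  \<comment> \<open>Brought into the form of \<open>MF_sum\<close>, the zero function minus a sum;
    hence the negated coefficients.\<close>
  hence fs: "f = (\<lambda>z. 0 * e 0 z - (\<Sum>i<n. (- h2_inner f (e i)) * e i z))" by (auto simp: fun_eq_iff sum_negf)
  have "(\<lambda>z. 0) \<in> MF_domain F"
    using K_zero[OF f] by (auto simp: MF_domain_def mult_z_def)
  from MF_sum[where f = "\<lambda>z. 0" and n = n and e = e and c = "\<lambda>i. - h2_inner f (e i)", OF this e(1)] have "f \<in> MF_domain F"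
    using fs by simp
  thus False unfolding f_def using ker_not_MF[OF i] by blast
qed

end

section \<open>Preimages of an arithmetic progression under an increasing function\<close>

abbreviation progression :: "(real \<Rightarrow> real) \<Rightarrow> real \<Rightarrow> real set" where
  "progression \<tau> \<theta> \<equiv> {x. \<exists>k::int. \<tau> x = \<theta> + 2 * pi * k}"

text \<open>A bounded range leaves only finitely many terms of the progression above
  \<open>\<tau> 0\<close>, each with at most one preimage. If the range is unbounded, the
  intermediate value theorem finds a preimage beyond any proposed bound.\<close>

lemma progression_preimage_bdd_above:
  fixes \<tau> :: "real \<Rightarrow> real"
  assumes mono: "strict_mono \<tau>" and cont: "continuous_on UNIV \<tau>"
  shows "bdd_above (progression \<tau> \<theta>) \<longleftrightarrow> bdd_above (range \<tau>)" (is "bdd_above ?X \<longleftrightarrow> _")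
proof
  assume "bdd_above (range \<tau>)"
  then obtain b where b: "\<And>x. \<tau> x \<le> b" unfolding bdd_above_def by auto
  let ?k = "{\<lceil>(\<tau> 0 - \<theta>) / (2 * pi)\<rceil>..\<lfloor>(b - \<theta>) / (2 * pi)\<rfloor>}"
  have "\<tau> ` (?X \<inter> {0..}) \<subseteq> (\<lambda>k::int. \<theta> + 2 * pi * k) ` ?k"
  proof
    fix y assume "y \<in> \<tau> ` (?X \<inter> {0..})"
    then obtain x k where x: "x \<ge> 0" "y = \<tau> x" "\<tau> x = \<theta> + 2 * pi * of_int k" by auto
    have "\<tau> 0 \<le> \<tau> x" using x(1) mono by (simp add: strict_mono_less_eq)
    hence "(\<tau> 0 - \<theta>) / (2 * pi) \<le> k" "k \<le> (b - \<theta>) / (2 * pi)" using x(3) b[of x] by (auto simp: field_simps)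
    hence "k \<in> ?k" by (simp add: ceiling_le_iff le_floor_iff)
    thus "y \<in> (\<lambda>k::int. \<theta> + 2 * pi * k) ` ?k" using x by blast
  qed
  hence "finite (\<tau> ` (?X \<inter> {0..}))" by (rule finite_subset) simp
  hence "finite (?X \<inter> {0..})" using strict_mono_on_imp_inj_on[of UNIV \<tau>] mono
    by (auto simp: strict_mono_on_def strict_mono_def dest!: finite_imageD intro: inj_on_subset)
  hence "bdd_above (?X \<inter> {0..})" by (rule bdd_above_finite)
  hence "bdd_above ((?X \<inter> {0..}) \<union> {..0})" by simp
  thus "bdd_above ?X" by (rule bdd_above_mono) auto
next
  assume "bdd_above ?X"
  then obtain B where B: "\<And>x k. \<tau> x = \<theta> + 2 * pi * of_int k \<Longrightarrow> x \<le> B" unfolding bdd_above_def by blast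
  show "bdd_above (range \<tau>)"
  proof (rule ccontr)
    assume nb: "\<not> bdd_above (range \<tau>)"
    \<comment> \<open>Selects the first term of the progression strictly above
      \<open>\<tau> B\<close>.\<close>
    define k where "k = \<lfloor>(\<tau> B - \<theta>) / (2 * pi)\<rfloor> + 1"
    have "(\<tau> B - \<theta>) / (2 * pi) < k" unfolding k_def by linarith
    hence k: "\<tau> B < \<theta> + 2 * pi * k" by (simp add: field_simps)
    obtain x1 where x1: "\<theta> + 2 * pi * k < \<tau> x1" using nb unfolding bdd_above_def by (metis not_le rangeE)
    have "\<tau> B < \<tau> x1" using k x1 by simp
    hence "B < x1" using mono by (simp add: strict_mono_less)
    moreover have "continuous_on {B..x1} \<tau>" using cont continuous_on_subset by blast
    ultimately obtain x where x: "B \<le> x" "\<tau> x = \<theta> + 2 * pi * k"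
      using IVT'[of \<tau> B "\<theta> + 2 * pi * k" x1] k x1 by auto
    hence "x = B" using B[of x k] by simp
    thus False using x k by simp
  qed
qed

text \<open>The substitution of \<open>- \<tau> (- x)\<close> for \<open>\<tau> x\<close> preserves
  monotonicity and exchanges the two sides.\<close>

lemma progression_preimage_bdd_below:
  fixes \<tau> :: "real \<Rightarrow> real"
  assumes mono: "strict_mono \<tau>" and cont: "continuous_on UNIV \<tau>"
  shows "bdd_below (progression \<tau> \<theta>) \<longleftrightarrow> bdd_below (range \<tau>)"
proof -
  let ?\<sigma> = "\<lambda>x. - \<tau> (- x)"
  have m: "strict_mono ?\<sigma>" using mono by (auto simp: strict_mono_def)
  have c: "continuous_on UNIV ?\<sigma>"
    by (intro continuous_intros continuous_on_compose2[OF cont]) auto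
  have "(progression ?\<sigma> (- \<theta>)) = uminus ` (progression \<tau> \<theta>)"
  proof (intro equalityI subsetI)
    fix x assume "x \<in> (progression ?\<sigma> (- \<theta>))"
    then obtain k :: int where "- \<tau> (- x) = - \<theta> + 2 * pi * k" by auto
    hence "\<tau> (- x) = \<theta> + 2 * pi * of_int (- k)" by simp
    hence "- x \<in> (progression \<tau> \<theta>)" by blast
    thus "x \<in> uminus ` (progression \<tau> \<theta>)" by (rule image_eqI[rotated]) simp
  next
    fix x assume "x \<in> uminus ` (progression \<tau> \<theta>)"
    then obtain y and k :: int where "x = - y" "\<tau> y = \<theta> + 2 * pi * k" by auto
    hence "?\<sigma> x = - \<theta> + 2 * pi * of_int (- k)" by simp
    thus "x \<in> (progression ?\<sigma> (- \<theta>))" by blast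
  qed
  moreover have "range ?\<sigma> = uminus ` range \<tau>"   proof (intro equalityI subsetI)
    fix y assume "y \<in> uminus ` range \<tau>"
    then obtain x where "y = ?\<sigma> (- x)" by auto
    thus "y \<in> range ?\<sigma>" by (rule range_eqI)
  qed auto
  ultimately show ?thesis
    using progression_preimage_bdd_above[OF m c, of "- \<theta>"] by (simp only: bdd_above_uminus)
qed

text \<open>Strict growth prevents a bound from being attained, so with the intermediate value
  theorem the range is an open interval. By \<open>nb\<close> at most one end is finite, and each
  shape becomes a statement on boundedness.\<close>

lemma range_strict_mono_cases:
  fixes \<tau> :: "real \<Rightarrow> real"
  assumes mono: "strict_mono \<tau>" and cont: "continuous_on UNIV \<tau>"
    and nb: "\<not> (bdd_above (range \<tau>) \<and> bdd_below (range \<tau>))"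
  shows "(\<exists>b. range \<tau> = {..<b}) \<longleftrightarrow> bdd_above (range \<tau>)"
    "(\<exists>a. range \<tau> = {a<..}) \<longleftrightarrow> bdd_below (range \<tau>)"
    "range \<tau> = UNIV \<longleftrightarrow> \<not> bdd_above (range \<tau>) \<and> \<not> bdd_below (range \<tau>)"
proof -
  have lt: "\<tau> x < \<tau> (x + 1)" "\<tau> (x - 1) < \<tau> x" for x using mono by (simp_all add: strict_mono_def)
  have ivt: "y \<in> range \<tau>" if "\<tau> u < y" "y < \<tau> v" for u v y
  proof -
    have "\<tau> u < \<tau> v" using that by simp
    hence "u < v" using mono by (simp add: strict_mono_less)
    moreover have "continuous_on {u..v} \<tau>" using cont continuous_on_subset by blast
    ultimately show ?thesis using IVT'[of \<tau> u y v] that by auto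
  qed
  have up: "\<exists>v. y < \<tau> v" if "\<not> bdd_above (range \<tau>)" for y
    using that unfolding bdd_above_def by (metis not_le rangeE)
  have dn: "\<exists>v. \<tau> v < y" if "\<not> bdd_below (range \<tau>)" for y
    using that unfolding bdd_below_def by (metis not_le rangeE)
  have 1: "range \<tau> = {..<Sup (range \<tau>)}" if a: "bdd_above (range \<tau>)"
  proof (intro equalityI subsetI)
    fix y assume "y \<in> range \<tau>"
    then obtain x where "y = \<tau> x" by auto
    moreover have "\<tau> (x + 1) \<le> Sup (range \<tau>)" using a by (intro cSup_upper) auto
    ultimately show "y \<in> {..<Sup (range \<tau>)}" using lt(1)[of x] by simp
  next
    fix y assume "y \<in> {..<Sup (range \<tau>)}"
    hence "y < Sup (range \<tau>)" by simp
    then obtain v where "y < \<tau> v" using less_cSup_iff[OF _ a] by auto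
    moreover obtain u where "\<tau> u < y" using dn[of y] nb a by auto
    ultimately show "y \<in> range \<tau>" using ivt by blast
  qed
  have 2: "range \<tau> = {Inf (range \<tau>)<..}" if a: "bdd_below (range \<tau>)"
  proof (intro equalityI subsetI)
    fix y assume "y \<in> range \<tau>"
    then obtain x where "y = \<tau> x" by auto
    moreover have "Inf (range \<tau>) \<le> \<tau> (x - 1)" using a by (intro cInf_lower) auto
    ultimately show "y \<in> {Inf (range \<tau>)<..}" using lt(2)[of x] by simp
  next
    fix y assume "y \<in> {Inf (range \<tau>)<..}"
    hence "Inf (range \<tau>) < y" by simp
    then obtain u where "\<tau> u < y" using cInf_less_iff[OF _ a] by auto
    moreover obtain v where "y < \<tau> v" using up[of y] nb a by auto
    ultimately show "y \<in> range \<tau>" using ivt by blast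
  qed
  have 3: "range \<tau> = UNIV" if "\<not> bdd_above (range \<tau>)" "\<not> bdd_below (range \<tau>)"
    using up[OF that(1)] dn[OF that(2)] ivt by blast
  show "(\<exists>b. range \<tau> = {..<b}) \<longleftrightarrow> bdd_above (range \<tau>)" using 1 by (metis bdd_above_Iio)
  show "(\<exists>a. range \<tau> = {a<..}) \<longleftrightarrow> bdd_below (range \<tau>)" using 2 by (metis bdd_below_Ioi)
  have "\<not> bdd_above (UNIV :: real set)" "\<not> bdd_below (UNIV :: real set)"
    unfolding bdd_above_def bdd_below_def by (auto simp: not_le intro: gt_ex lt_ex)
  thus "range \<tau> = UNIV \<longleftrightarrow> \<not> bdd_above (range \<tau>) \<and> \<not> bdd_below (range \<tau>)" using 3 by metis
qed

section \<open>Spectra and the range of the phase\<close>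

context dense_mero_inner_phase begin

lemma spectrum_progression:
  assumes sa: "selfadjoint_extension F D A"
  obtains \<theta> where "Re ` op_spectrum F D A = (progression \<tau> \<theta>)"
proof -
  obtain \<alpha> where E: "boundary_extension \<alpha> D A" by (rule selfadjoint_extension_boundary[OF sa])
  have "cmod \<alpha> = 1" using E unfolding boundary_extension_def by blast
  then obtain \<theta> where \<theta>: "\<alpha> = exp (\<i> * of_real \<theta>)" using complex_norm_eq_1_exp by (metis mult.commute)
  have iff: "F (of_real x) = \<alpha> \<longleftrightarrow> (\<exists>k::int. \<tau> x = \<theta> + 2 * pi * k)" for x
  proof -
    have "F (of_real x) = \<alpha> \<longleftrightarrow> (\<exists>k::int. \<i> * of_real (\<tau> x) = \<i> * of_real \<theta> + (of_int (2 * k) * pi) * \<i>)"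
      unfolding phase \<theta> by (rule exp_eq)
    also have "\<dots> \<longleftrightarrow> (\<exists>k::int. \<tau> x = \<theta> + 2 * pi * k)"
      by (simp add: complex_eq_iff mult.commute mult.left_commute)
    finally show ?thesis .
  qed
  have "Re ` {c. Im c = 0 \<and> F c = \<alpha>} = {x. F (of_real x) = \<alpha>}"
  proof (intro equalityI subsetI)
    fix x assume "x \<in> {x. F (of_real x) = \<alpha>}"
    thus "x \<in> Re ` {c. Im c = 0 \<and> F c = \<alpha>}" by (intro image_eqI[of _ _ "of_real x"]) auto
  next
    fix x assume "x \<in> Re ` {c. Im c = 0 \<and> F c = \<alpha>}"
    then obtain c where "x = Re c" "Im c = 0" "F c = \<alpha>" by auto
    moreover from this have "c = of_real x" by (simp add: complex_eq_iff)
    ultimately show "x \<in> {x. F (of_real x) = \<alpha>}" by simp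
  qed
  hence "Re ` op_spectrum F D A = (progression \<tau> \<theta>)"
    unfolding boundary_extension_spectrum[OF E] iff .
  thus ?thesis by (rule that)
qed

lemma spectrum_bdd:
  assumes "selfadjoint_extension F D A"
  shows "bdd_above (Re ` op_spectrum F D A) \<longleftrightarrow> bdd_above (range \<tau>)"
    "bdd_below (Re ` op_spectrum F D A) \<longleftrightarrow> bdd_below (range \<tau>)"
proof -
  obtain \<theta> where \<theta>: "Re ` op_spectrum F D A = (progression \<tau> \<theta>)"
    by (rule spectrum_progression[OF assms])
  show "bdd_above (Re ` op_spectrum F D A) \<longleftrightarrow> bdd_above (range \<tau>)"
    "bdd_below (Re ` op_spectrum F D A) \<longleftrightarrow> bdd_below (range \<tau>)"
    unfolding \<theta> by (rule progression_preimage_bdd_above[OF phase_strict_mono cont] progression_preimage_bdd_below[OF phase_strict_mono cont])+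
qed

end

theorem theorem13:
  fixes F :: "complex \<Rightarrow> complex" and \<tau> :: "real \<Rightarrow> real"
  assumes "meromorphic_inner F"
    and "\<not> (\<exists>c. \<forall>z\<in>upper_half_plane. F z = c)"
    and "MF_densely_defined F"
    and "continuous_on UNIV \<tau>"
    and "\<And>x. F (of_real x) = exp (\<i> * of_real (\<tau> x))"
  shows "(\<forall>x. (\<tau> has_real_derivative (2 * pi * (h2_norm (repr_kernel F x))\<^sup>2)) (at x)
              \<and> 2 * pi * (h2_norm (repr_kernel F x))\<^sup>2 > 0)
    \<and> C_infinity \<tau> \<and> inj \<tau>
    \<and> ((\<exists>b. range \<tau> = {..<b}) \<or> (\<exists>a. range \<tau> = {a<..}) \<or> range \<tau> = UNIV)
    \<and> ((\<exists>b. range \<tau> = {..<b}) \<longleftrightarrow>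
         (\<forall>D A. selfadjoint_extension F D A \<longrightarrow> bdd_above (Re ` op_spectrum F D A)))
    \<and> ((\<exists>a. range \<tau> = {a<..}) \<longleftrightarrow>
         (\<forall>D A. selfadjoint_extension F D A \<longrightarrow> bdd_below (Re ` op_spectrum F D A)))
    \<and> (range \<tau> = UNIV \<longleftrightarrow>
         (\<forall>D A. selfadjoint_extension F D A \<longrightarrow>
            \<not> bdd_above (Re ` op_spectrum F D A) \<and> \<not> bdd_below (Re ` op_spectrum F D A)))
    \<and> (\<forall>x. \<exists>r>0. \<exists>g. g holomorphic_on ball (of_real x) r
            \<and> (\<forall>t. \<bar>t - x\<bar> < r \<longrightarrow> g (of_real t) = of_real (\<tau> t)))"
proof -
  interpret dense_mero_inner_phase F \<tau>
    by unfold_locales (fact assms)+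
  note ranges = range_strict_mono_cases[OF phase_strict_mono cont phase_unbounded]
  \<comment> \<open>Without a witness the conditions on all self-adjoint extensions could hold
    vacuously. With it they are equivalent to boundedness of the range, since each single extension
    already decides that.\<close>
  obtain D0 A0 where ex: "selfadjoint_extension F D0 A0" using selfadjoint_extension_exists by blast
  have deriv: "\<forall>x. (\<tau> has_real_derivative (2 * pi * (h2_norm (repr_kernel F x))\<^sup>2)) (at x)
              \<and> 2 * pi * (h2_norm (repr_kernel F x))\<^sup>2 > 0"
    using phase_derivative phase_derivative_pos unfolding ker_repr by blast
  have above: "bdd_above (range \<tau>) \<longleftrightarrow> (\<forall>D A. selfadjoint_extension F D A \<longrightarrow> bdd_above (Re ` op_spectrum F D A))"
    by (metis spectrum_bdd(1) ex)
  have below: "bdd_below (range \<tau>) \<longleftrightarrow> (\<forall>D A. selfadjoint_extension F D A \<longrightarrow> bdd_below (Re ` op_spectrum F D A))"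
    by (metis spectrum_bdd(2) ex)
  have neither: "\<not> bdd_above (range \<tau>) \<and> \<not> bdd_below (range \<tau>) \<longleftrightarrow>
      (\<forall>D A. selfadjoint_extension F D A \<longrightarrow> \<not> bdd_above (Re ` op_spectrum F D A) \<and> \<not> bdd_below (Re ` op_spectrum F D A))"
    by (metis spectrum_bdd ex)
  have ext: "\<forall>x. \<exists>r>0. \<exists>g. g holomorphic_on ball (of_real x) r \<and> (\<forall>t. \<bar>t - x\<bar> < r \<longrightarrow> g (of_real t) = of_real (\<tau> t))"
  proof
    fix x
    obtain r g where "r > 0" "g holomorphic_on ball (of_real x) r"
      "\<And>t. \<bar>t - x\<bar> < r \<Longrightarrow> g (of_real t) = of_real (\<tau> t)"
      by (rule local_extension[of x]) (rule that; assumption)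
    thus "\<exists>r>0. \<exists>g. g holomorphic_on ball (of_real x) r \<and> (\<forall>t. \<bar>t - x\<bar> < r \<longrightarrow> g (of_real t) = of_real (\<tau> t))" by blast
  qed
  have cases: "(\<exists>b. range \<tau> = {..<b}) \<or> (\<exists>a. range \<tau> = {a<..}) \<or> range \<tau> = UNIV"
    unfolding ranges by auto
  have inj: "inj \<tau>" using phase_strict_mono by (rule strict_mono_imp_inj_on)
  show ?thesis
    by (intro conjI deriv phase_smooth inj cases ranges(1)[unfolded above] ranges(2)[unfolded below] ranges(3)[unfolded neither] ext)
qed

end
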